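(* Let $T$ be a hook-valued tableau, $(P_1,Q_1)=\mathcal{U}_{\mathcal{L}^\infty\mathcal{A}^\infty}(T)$ and $(P_2,Q_2)=\mathcal{U}_{\mathcal{A}^\infty\mathcal{L}^\infty}(T)$. Then $P_2=P_1$ and $Q_2=\mathsf{shuff}(Q_1)$.
   Context: French notation: cell $(i,j)$ in row $i$ (bottom to top), column $j$ (left to right). A hook-valued tableau of shape $\lambda$: each cell of $\lambda$ contains a hook-shaped semistandard tableau with hook entry $h$, leg entries $L_1<\dots<L_\ell$ above ($h<L_1$), arm entries $A_1\le\dots\le A_k$ to the right ($h\le A_1$), positive integers; every entry of a cell is weakly smaller than every entry of the cell to its right and strictly smaller than every entry of the cell above. Arm bumping $\mathcal{A}_b$: if no arms, identity. Else let $c$ be the rightmost column containing an arm entry, $a$ the largest arm entry there (rightmost copy), in cell $(r,c)$. If column $c+1$ has an entry $\ge a$, let $k$ be the smallest, in $(\tilde r,c+1)$: remove $a$ from $(r,c)$, replace this $k$ by $a$, add $k$ as an arm of $(\tilde r,c+1)$; if $\tilde r=r$, also move the legs of $(r,c)$ greater than $a$ to $(r,c+1)$ as legs. Otherwise create a new cell on top of column $c+1$ containing $a$; if it is $(r,c+1)$, also move the legs of $(r,c)$ greater than $a$ into it. Leg bumping $\mathcal{L}_b$: if no legs, identity. Else let $r$ be the topmost row containing a leg, $\ell$ the largest leg in row $r$, in cell $(r,c)$. If row $r+1$ has an entry $>\ell$, let $k$ be the smallest, in $(r+1,\tilde c)$: remove $\ell$ from $(r,c)$, replace this $k$ by $\ell$,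 add $k$ as a leg of $(r+1,\tilde c)$; if $\tilde c=c$, also move the arms of $(r,c)$ that are $\le\ell$ to $(r+1,c)$ as arms. Otherwise create a new cell at the end of row $r+1$ containing $\ell$; if it is $(r+1,c)$, also move the arms of $(r,c)$ that are $\le\ell$ into it. $\mathcal{A}(T)=\mathcal{A}_b^m(T)$ with $m$ minimal such that the shape grows (identity if no arms); $\mathcal{L}$ likewise. For a word $f_n\cdots f_1$ in $\{\mathcal{A},\mathcal{L}\}$, $T_i=f_i\circ\cdots\circ f_1(T)$ of shape $\lambda^{(i)}$, $\mathcal{U}_{f_n\cdots f_1}(T)=(P,Q)$ with $P=T_n$ and $Q$ the filling of $\lambda^{(n)}/\lambda^{(0)}$ whose new cell $\lambda^{(i)}/\lambda^{(i-1)}$ (when one is added) contains $\alpha_c$ if $f_i=\mathcal{A}$ ($c$ the column of the cell of $T_{i-1}$ holding the largest arm entry of its rightmost column with arms) and $\beta_r$ if $f_i=\mathcal{L}$ ($r$ the topmost row of $T_{i-1}$ containing a leg). $\mathcal{U}_{\mathcal{L}^\infty\mathcal{A}^\infty}(T):=\mathcal{U}_{\mathcal{L}^N\mathcal{A}^M}(T)$ and $\mathcal{U}_{\mathcal{A}^\infty\mathcal{L}^\infty}(T):=\mathcal{U}_{\mathcal{A}^M\mathcal{L}^N}(T)$ for $M\ge$ #arm entries, $N\ge$ #leg entries of $T$. Shuffle: for a mixed tableau $Q$ (filling of a skew shape by symbols $\alpha_k,\beta_k$) that is flagged ($\alpha_k$ at $(i,j)$ has $0<k<j$, $\beta_k$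 at $(i,j)$ has $0<k<i$), $\alpha$-column-strict, $\beta$-row-strict (for $\gamma\in\{\alpha,\beta\}$: $\gamma_i$ weakly southwest of $\gamma_j$ implies $i\ge j$, and $\alpha$-entries in a common column, resp. $\beta$-entries in a common row, have distinct indices) and $(\alpha,\beta)$-sorted ($\alpha$-cells form $\nu/\lambda$, $\beta$-cells form $\mu/\nu$, $\lambda\subseteq\nu\subseteq\mu$ partitions), $\mathsf{shuff}(Q)$ is obtained by repeatedly choosing, among $\alpha$-entries with a $\beta$-entry directly above or directly right, the rightmost one with smallest index $\alpha_i$, and while a $\beta$ lies directly above or right of it, swapping $\alpha_i$ with it if only one exists, and if $\beta_k$ is above and $\beta_j$ right, swapping with $\beta_k$ when $k>j$ and with $\beta_j$ when $k\le j$; until no $\alpha$-entry has a $\beta$-entry directly above or right.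
   Formalization: In leg bumping, the arms of (r,c) moved to (r+1,c) are those ≥ ℓ, not ≤ ℓ; with ≤ ℓ the claim fails (one cell with hook 1, legs 2,4, arm 3 gives P_2 ≠ P_1). If the smallest k occurs several times in row r+1, the leftmost copy is bumped. *)

theory Defs
  imports "HOL-Library.Multiset" "HOL-Library.While_Combinator"
begin

text \<open>
  French notation: the cell \<open>(i, j)\<close> lies in row \<open>i\<close> (counted from the bottom) and column \<open>j\<close>
  (counted from the left), both starting at 1.  A partition is represented by its Young diagram,
  a tableau by a partial map on cells whose domain is its shape.
\<close>

type_synonym cell = "nat \<times> nat"

definition young_diagram :: "cell set \<Rightarrow> bool" where
  "young_diagram S \<longleftrightarrow> finite S \<and> (\<forall>(i, j)\<in>S. 1 \<le> i \<and> 1 \<le> j) \<and>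
     (\<forall>i j i' j'. (i, j) \<in> S \<and> 1 \<le> i' \<and> i' \<le> i \<and> 1 \<le> j' \<and> j' \<le> j \<longrightarrow> (i', j') \<in> S)"

text \<open>
  The legs of a hook strictly increase and its arms weakly increase, so a set and a multiset
  determine them.
\<close>

record hook_filling =
  hook :: nat
  legs :: "nat set"
  arms :: "nat multiset"

type_synonym hv_tableau = "cell \<rightharpoonup> hook_filling"

definition ssyt_hook :: "hook_filling \<Rightarrow> bool" where
  "ssyt_hook H \<longleftrightarrow> 0 < hook H \<and> finite (legs H) \<and>
     (\<forall>x\<in>legs H. hook H < x) \<and> (\<forall>x\<in>#arms H. hook H \<le> x)"

definition entries :: "hook_filling \<Rightarrow> nat set" where
  "entries H = insert (hook H) (legs H \<union> set_mset (arms H))"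

definition hook_valued_tableau :: "hv_tableau \<Rightarrow> bool" where
  "hook_valued_tableau T \<longleftrightarrow> young_diagram (dom T) \<and> (\<forall>H\<in>ran T. ssyt_hook H) \<and>
     (\<forall>i j H K. T (i, j) = Some H \<and> T (i, Suc j) = Some K \<longrightarrow>
        (\<forall>x\<in>entries H. \<forall>y\<in>entries K. x \<le> y)) \<and>
     (\<forall>i j H K. T (i, j) = Some H \<and> T (Suc i, j) = Some K \<longrightarrow>
        (\<forall>x\<in>entries H. \<forall>y\<in>entries K. x < y))"

definition num_arms :: "hv_tableau \<Rightarrow> nat" where
  "num_arms T = (\<Sum>p\<in>dom T. size (arms (the (T p))))"

definition num_legs :: "hv_tableau \<Rightarrow> nat" where
  "num_legs T = (\<Sum>p\<in>dom T. card (legs (the (T p))))"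

definition has_arms :: "hv_tableau \<Rightarrow> bool" where
  "has_arms T \<longleftrightarrow> (\<exists>H\<in>ran T. arms H \<noteq> {#})"

definition has_legs :: "hv_tableau \<Rightarrow> bool" where
  "has_legs T \<longleftrightarrow> (\<exists>H\<in>ran T. legs H \<noteq> {})"

definition arm_col :: "hv_tableau \<Rightarrow> nat" where
  "arm_col T = Max {j. \<exists>i H. T (i, j) = Some H \<and> arms H \<noteq> {#}}"

definition leg_row :: "hv_tableau \<Rightarrow> nat" where
  "leg_row T = Max {i. \<exists>j H. T (i, j) = Some H \<and> legs H \<noteq> {}}"

definition col_entries :: "hv_tableau \<Rightarrow> nat \<Rightarrow> nat set" where
  "col_entries T j = {x. \<exists>i H. T (i, j) = Some H \<and> x \<in> entries H}"

definition row_entries :: "hv_tableau \<Rightarrow> nat \<Rightarrow> nat set" where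
  "row_entries T i = {x. \<exists>j H. T (i, j) = Some H \<and> x \<in> entries H}"

definition col_len :: "hv_tableau \<Rightarrow> nat \<Rightarrow> nat" where
  "col_len T j = card {i. (i, j) \<in> dom T}"

definition row_len :: "hv_tableau \<Rightarrow> nat \<Rightarrow> nat" where
  "row_len T i = card {j. (i, j) \<in> dom T}"

text \<open>Of several copies of \<open>k\<close> inside one cell, the leftmost one, i.e. the hook entry, is replaced.\<close>

definition replace_entry :: "nat \<Rightarrow> nat \<Rightarrow> hook_filling \<Rightarrow> hook_filling" where
  "replace_entry k a H =
     (if hook H = k then H\<lparr>hook := a\<rparr>
      else if k \<in> legs H then H\<lparr>legs := insert a (legs H - {k})\<rparr>
      else H\<lparr>arms := add_mset a (arms H - {#k#})\<rparr>)"

definition arm_bump :: "hv_tableau \<Rightarrow> hv_tableau" where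
  "arm_bump T =
     (if \<not> has_arms T then T else
      let c = arm_col T;
          a = Max {x. \<exists>i H. T (i, c) = Some H \<and> x \<in># arms H};
          r = Max {i. \<exists>H. T (i, c) = Some H \<and> a \<in># arms H};
          S = the (T (r, c));
          bigger = {x \<in> col_entries T (Suc c). a \<le> x};
          k = Min bigger;
          r' = (if bigger = {} then Suc (col_len T (Suc c))
                else LEAST i. \<exists>H. T (i, Suc c) = Some H \<and> k \<in> entries H);
          moved = (if r' = r then {x \<in> legs S. a < x} else {});
          D = (if bigger = {} then \<lparr>hook = a, legs = {}, arms = {#}\<rparr>
               else let E = replace_entry k a (the (T (r', Suc c)))
                    in E\<lparr>arms := add_mset k (arms E)\<rparr>)
      in T((r, c) \<mapsto> S\<lparr>legs := legs S - moved, arms := arms S - {#a#}\<rparr>,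
           (r', Suc c) \<mapsto> D\<lparr>legs := legs D \<union> moved\<rparr>))"

text \<open>
  If \<open>k\<close> occurs in several cells of row \<open>r + 1\<close>, the leftmost one is used.  The arms that change
  cell are those \<open>\<ge> l\<close>: they sit to the right of the new hook entry \<open>l\<close>, and the arms \<open>< l\<close> stay
  behind.  This is the transpose of moving the legs \<open>> a\<close> in \<open>arm_bump\<close>.
\<close>

definition leg_bump :: "hv_tableau \<Rightarrow> hv_tableau" where
  "leg_bump T =
     (if \<not> has_legs T then T else
      let r = leg_row T;
          l = Max {x. \<exists>j H. T (r, j) = Some H \<and> x \<in> legs H};
          c = Max {j. \<exists>H. T (r, j) = Some H \<and> l \<in> legs H};
          S = the (T (r, c));
          bigger = {x \<in> row_entries T (Suc r). l < x};
          k = Min bigger;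
          c' = (if bigger = {} then Suc (row_len T (Suc r))
                else LEAST j. \<exists>H. T (Suc r, j) = Some H \<and> k \<in> entries H);
          moved = (if c' = c then {#x \<in># arms S. l \<le> x#} else {#});
          D = (if bigger = {} then \<lparr>hook = l, legs = {}, arms = {#}\<rparr>
               else let E = replace_entry k l (the (T (Suc r, c')))
                    in E\<lparr>legs := insert k (legs E)\<rparr>)
      in T((r, c) \<mapsto> S\<lparr>legs := legs S - {l}, arms := arms S - moved\<rparr>,
           (Suc r, c') \<mapsto> D\<lparr>arms := arms D + moved\<rparr>))"

definition arm_uncrowd :: "hv_tableau \<Rightarrow> hv_tableau" where
  "arm_uncrowd T =
     (if \<not> has_arms T then T
      else (arm_bump ^^ (LEAST m. dom T \<subset> dom ((arm_bump ^^ m) T))) T)"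

definition leg_uncrowd :: "hv_tableau \<Rightarrow> hv_tableau" where
  "leg_uncrowd T =
     (if \<not> has_legs T then T
      else (leg_bump ^^ (LEAST m. dom T \<subset> dom ((leg_bump ^^ m) T))) T)"

datatype letter = A | L

datatype symbol = Alpha nat | Beta nat

type_synonym mixed = "cell \<rightharpoonup> symbol"

fun apply_letter :: "letter \<Rightarrow> hv_tableau \<Rightarrow> hv_tableau" where
  "apply_letter A T = arm_uncrowd T"
| "apply_letter L T = leg_uncrowd T"

fun record_symbol :: "letter \<Rightarrow> hv_tableau \<Rightarrow> symbol" where
  "record_symbol A T = Alpha (arm_col T)"
| "record_symbol L T = Beta (leg_row T)"

text \<open>
  A word is listed as it is written, as a composition: its last letter acts first.
\<close>

fun uncrowd :: "letter list \<Rightarrow> hv_tableau \<Rightarrow> hv_tableau \<times> mixed" where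
  "uncrowd [] T = (T, Map.empty)"
| "uncrowd (f # w) T =
     (let (P, Q) = uncrowd w T; P' = apply_letter f P
      in (P', \<lambda>p. if p \<in> dom P' - dom P then Some (record_symbol f P) else Q p))"

definition mixed_tableau :: "cell set \<Rightarrow> cell set \<Rightarrow> mixed \<Rightarrow> bool" where
  "mixed_tableau lam mu Q \<longleftrightarrow>
     young_diagram lam \<and> young_diagram mu \<and> lam \<subseteq> mu \<and> dom Q = mu - lam"

definition flagged :: "mixed \<Rightarrow> bool" where
  "flagged Q \<longleftrightarrow> (\<forall>i j k. Q (i, j) = Some (Alpha k) \<longrightarrow> 0 < k \<and> k < j) \<and>
                 (\<forall>i j k. Q (i, j) = Some (Beta k) \<longrightarrow> 0 < k \<and> k < i)"

text \<open>Going weakly northeast, the indices of the symbols \<open>\<gamma> k\<close> weakly decrease.\<close>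

definition sw_decreasing :: "(nat \<Rightarrow> symbol) \<Rightarrow> mixed \<Rightarrow> bool" where
  "sw_decreasing \<gamma> Q \<longleftrightarrow>
     (\<forall>i j i' j' k m. Q (i, j) = Some (\<gamma> k) \<and> Q (i', j') = Some (\<gamma> m) \<and> i \<le> i' \<and> j \<le> j'
        \<longrightarrow> m \<le> k)"

definition alpha_column_strict :: "mixed \<Rightarrow> bool" where
  "alpha_column_strict Q \<longleftrightarrow> sw_decreasing Alpha Q \<and>
     (\<forall>i i' j k. Q (i, j) = Some (Alpha k) \<and> Q (i', j) = Some (Alpha k) \<longrightarrow> i = i')"

definition beta_row_strict :: "mixed \<Rightarrow> bool" where
  "beta_row_strict Q \<longleftrightarrow> sw_decreasing Beta Q \<and>
     (\<forall>i j j' k. Q (i, j) = Some (Beta k) \<and> Q (i, j') = Some (Beta k) \<longrightarrow> j = j')"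

definition alpha_beta_sorted :: "cell set \<Rightarrow> cell set \<Rightarrow> mixed \<Rightarrow> bool" where
  "alpha_beta_sorted lam mu Q \<longleftrightarrow>
     (\<exists>nu. young_diagram nu \<and> lam \<subseteq> nu \<and> nu \<subseteq> mu \<and>
        {p. \<exists>k. Q p = Some (Alpha k)} = nu - lam \<and>
        {p. \<exists>k. Q p = Some (Beta k)} = mu - nu)"

text \<open>The domain of the shuffle, for fillings of the skew shape \<open>mu / lam\<close>.\<close>

definition shuff_domain :: "cell set \<Rightarrow> cell set \<Rightarrow> mixed \<Rightarrow> bool" where
  "shuff_domain lam mu Q \<longleftrightarrow> mixed_tableau lam mu Q \<and> flagged Q \<and>
     alpha_column_strict Q \<and> beta_row_strict Q \<and> alpha_beta_sorted lam mu Q"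

fun above :: "cell \<Rightarrow> cell" where "above (i, j) = (Suc i, j)"

fun right_of :: "cell \<Rightarrow> cell" where "right_of (i, j) = (i, Suc j)"

definition has_beta :: "mixed \<Rightarrow> cell \<Rightarrow> bool" where
  "has_beta Q p \<longleftrightarrow> (\<exists>k. Q p = Some (Beta k))"

definition movable :: "mixed \<Rightarrow> nat \<Rightarrow> cell \<Rightarrow> bool" where
  "movable Q i p \<longleftrightarrow> Q p = Some (Alpha i) \<and> (has_beta Q (above p) \<or> has_beta Q (right_of p))"

definition swap_partner :: "mixed \<Rightarrow> cell \<Rightarrow> cell" where
  "swap_partner Q p =
     (case (Q (above p), Q (right_of p)) of
        (Some (Beta k), Some (Beta j)) \<Rightarrow> if k > j then above p else right_of p
      | (Some (Beta k), _) \<Rightarrow> above p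
      | _ \<Rightarrow> right_of p)"

definition swap_cells :: "mixed \<Rightarrow> cell \<Rightarrow> cell \<Rightarrow> mixed" where
  "swap_cells Q p q = Q(p := Q q, q := Q p)"

definition slide :: "mixed \<Rightarrow> cell \<Rightarrow> mixed" where
  "slide Q p =
     fst (while (\<lambda>(Q, p). \<exists>i. movable Q i p)
                (\<lambda>(Q, p). (swap_cells Q p (swap_partner Q p), swap_partner Q p)) (Q, p))"

definition next_alpha :: "mixed \<Rightarrow> cell" where
  "next_alpha Q =
     (SOME p. \<exists>i. movable Q i p \<and> (\<forall>i' p'. movable Q i' p' \<longrightarrow> i \<le> i') \<and>
                 (\<forall>p'. movable Q i p' \<longrightarrow> snd p' \<le> snd p))"

definition shuff :: "mixed \<Rightarrow> mixed" where
  "shuff Q = while (\<lambda>Q. \<exists>i p. movable Q i p) (\<lambda>Q. slide Q (next_alpha Q)) Q"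

end

theory Submission
  imports Defs "HOL-Library.Extended_Nat"
begin

text \<open>
  A leg of row \<open>r\<close> with value \<open>y\<close> can only sit in the last cell of that row whose hook entry is
  below \<open>y\<close>, and an arm of column \<open>c\<close> with value \<open>x\<close> only in the topmost cell of that column whose
  hook entry is at most \<open>x\<close>.  Hence a hook-valued tableau is determined by its hook entries, the
  multiset of arms of each column and the multiset of legs of each row.  In these coordinates the
  legs (arms) that travel with a bumped entry need no attention, transposition exchanges the two
  bumpings up to swapping \<open>\<le>\<close> and \<open><\<close>, and single bumps satisfy a diamond property: an arm bump and a
  leg bump commute, unless both create the same cell, in which case one of the two needs one more
  bump and the second new cell lies directly above or directly to the right of the first.
  Therefore \<open>\<A>\<close> and \<open>\<L>\<close> commute, and exchanging them in a word either leaves the recording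
  tableau unchanged or swaps an \<open>\<alpha>\<close> with a neighbouring \<open>\<beta>\<close>.  Moving the last \<open>\<A>\<close> of a word past all
  \<open>\<L>\<close> is one slide of the shuffle; the \<open>\<A>\<close> added last has the smallest index and, among those with
  that index, the rightmost cell.
\<close>

text \<open>What needs an explanation is why the swap rule of the shuffle picks the correct
  neighbour. Along a block of \<open>L\<close> the recorded indices weakly decrease, and while an
  index repeats the new cells climb strictly. So if an \<alpha> has \<beta> symbols with index k
  above it and j to its right, then k > j means that the upper one was recorded first and k \<le> j
  that the right one was: the rule finds the \<open>L\<close> that collided with the moving
  \<open>A\<close>. The climbing is a form of the row bumping lemma: the entries that a run leaves
  in successive columns (rows, for legs) form an increasing chain, and a later run from the same
  place with an entry that is not larger has to pass all of it. In a collision the smaller entry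
  keeps the contested cell; the larger one goes above it if it was an arm and to its right if it was
  a leg. A slide edits the finished recording tableau although the letters are exchanged early in
  the word. This is harmless because bumping never reads recorded symbols, so the edit can be
  carried past all later letters.\<close>

section \<open>Tableaux in coordinates: hooks, arms per column, legs per row\<close>

text \<open>
  Arms are compared by \<open>cmp w\<close> and legs by \<open>cmp (\<not> w)\<close>: hook-valued tableaux have \<open>w = True\<close>, their
  transposes \<open>w = False\<close>.
\<close>

definition cmp :: "bool \<Rightarrow> enat \<Rightarrow> enat \<Rightarrow> bool" where
  "cmp w x y \<longleftrightarrow> (if w then x \<le> y else x < y)"

lemma cmp_simps [simp]: "cmp True x y \<longleftrightarrow> x \<le> y" "cmp False x y \<longleftrightarrow> x < y"
  by (simp_all add: cmp_def)

text \<open>This duality lets one proof serve arms and legs: negating the arm comparison gives the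
  leg comparison with exchanged arguments, just as transposition exchanges the two roles.\<close>

lemma cmp_not: "\<not> cmp w x y \<longleftrightarrow> cmp (\<not> w) y x"
  by (auto simp: cmp_def)

lemma cmp_le: "cmp w x y \<Longrightarrow> x \<le> y"
  by (auto simp: cmp_def split: if_splits)

lemma cmp_less: "x < y \<Longrightarrow> cmp w x y"
  by (auto simp: cmp_def)

lemma cmp_le_trans: "cmp w x y \<Longrightarrow> y \<le> z \<Longrightarrow> cmp w x z"
  by (auto simp: cmp_def split: if_splits)

lemma le_cmp_trans: "x \<le> y \<Longrightarrow> cmp w y z \<Longrightarrow> cmp w x z"
  by (auto simp: cmp_def split: if_splits)

lemma cmp_cmp_less: "cmp w x y \<Longrightarrow> cmp (\<not> w) y z \<Longrightarrow> x < z"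
  by (auto simp: cmp_def split: if_splits)

lemma cmp_cmp_less': "cmp (\<not> w) x y \<Longrightarrow> cmp w y z \<Longrightarrow> x < z"
  by (auto simp: cmp_def split: if_splits)

lemma cmp_trans: "cmp w x y \<Longrightarrow> cmp w y z \<Longrightarrow> cmp w x z"
  by (auto simp: cmp_def split: if_splits)

lemma le_finite: "x \<le> y \<Longrightarrow> y \<noteq> \<infinity> \<Longrightarrow> x \<noteq> (\<infinity> :: enat)"
  by (cases x; cases y) auto

type_synonym grid = "nat \<Rightarrow> nat \<Rightarrow> enat"
type_synonym extras = "nat \<Rightarrow> enat multiset"
type_synonym state = "grid \<times> extras \<times> extras"

text \<open>The comparisons are asked only when the outer entry is finite: two absent cells both
  hold \<infinity> and could not satisfy a strict one. That the shape is a Young diagram follows,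
  since a finite entry forces finite entries to its left and below it.\<close>

definition tab :: "bool \<Rightarrow> grid \<Rightarrow> bool" where
  "tab w H \<longleftrightarrow> (\<forall>i. H i 0 = 0) \<and> (\<forall>j. H 0 j = 0) \<and> (\<forall>i j. 0 < i \<longrightarrow> 0 < j \<longrightarrow> 0 < H i j) \<and>
     finite {(i, j). 0 < i \<and> 0 < j \<and> H i j \<noteq> \<infinity>} \<and>
     (\<forall>i j. 0 < i \<longrightarrow> H i (Suc j) \<noteq> \<infinity> \<longrightarrow> cmp w (H i j) (H i (Suc j))) \<and>
     (\<forall>i j. 0 < j \<longrightarrow> H (Suc i) j \<noteq> \<infinity> \<longrightarrow> cmp (\<not> w) (H i j) (H (Suc i) j))"

lemma tab_finite: "tab w H \<Longrightarrow> finite {(i, j). 0 < i \<and> 0 < j \<and> H i j \<noteq> \<infinity>}"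
  by (simp only: tab_def)

text \<open>
  The grid is \<open>\<infinity>\<close> outside the shape and \<open>0\<close> in the auxiliary row and column with index 0.  The
  condition on an arm \<open>x\<close> of column \<open>c\<close> says that \<open>x\<close> is admissible in its cell: every row of column
  \<open>c + 1\<close> whose hook entry lies below \<open>x\<close> comes strictly before the row of \<open>x\<close>.
\<close>

definition arms_ok :: "bool \<Rightarrow> grid \<Rightarrow> extras \<Rightarrow> bool" where
  "arms_ok w H \<alpha> \<longleftrightarrow>
     (\<forall>c x. x \<in># \<alpha> c \<longrightarrow> 0 < c \<and> 0 < x \<and> x < \<infinity> \<and>
        (\<forall>i. cmp (\<not> w) (H i (Suc c)) x \<longrightarrow> cmp w (H (Suc i) c) x)) \<and>
     (\<not> w \<longrightarrow> (\<forall>c x. count (\<alpha> c) x \<le> 1))"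

definition tp :: "grid \<Rightarrow> grid" where
  "tp H = (\<lambda>i j. H j i)"

lemma tp_app [simp]: "tp H i j = H j i"
  by (simp add: tp_def)

lemma tp_tp [simp]: "tp (tp H) = H"
  by (simp add: tp_def)

fun tr :: "state \<Rightarrow> state" where
  "tr (H, \<alpha>, \<Lambda>) = (tp H, \<Lambda>, \<alpha>)"

lemma tr_tr [simp]: "tr (tr s) = s"
  by (cases s) simp

text \<open>Legs are arms of the transposed grid under the opposite comparison, so one admissibility
  predicate covers both.\<close>

fun valid :: "bool \<Rightarrow> state \<Rightarrow> bool" where
  "valid w (H, \<alpha>, \<Lambda>) \<longleftrightarrow> tab w H \<and> arms_ok w H \<alpha> \<and> arms_ok (\<not> w) (tp H) \<Lambda>"

lemma tab_tp: "tab w H \<Longrightarrow> tab (\<not> w) (tp H)"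
proof -
  have "{(i, j). 0 < i \<and> 0 < j \<and> H j i \<noteq> \<infinity>} = prod.swap ` {(i, j). 0 < i \<and> 0 < j \<and> H i j \<noteq> \<infinity>}"
    by auto
  then show "tab w H \<Longrightarrow> tab (\<not> w) (tp H)"
    by (auto simp: tab_def)
qed

lemma valid_tr: "valid w s \<Longrightarrow> valid (\<not> w) (tr s)"
  by (cases s) (auto simp: tab_tp)

lemma valid_tr': "valid (\<not> w) (tr s) \<Longrightarrow> valid w s"
  using valid_tr[of "\<not> w" "tr s"] by simp

lemma tab_row_cmp:
  assumes "tab w H" "0 < i" "j < j'" "H i j' \<noteq> \<infinity>"
  shows "cmp w (H i j) (H i j')"
proof -
  have "H i (j + Suc d) \<noteq> \<infinity> \<Longrightarrow> cmp w (H i j) (H i (j + Suc d))" for d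
  proof (induction d)
    case 0
    then show ?case using assms by (auto simp: tab_def)
  next
    case (Suc d)
    then have c: "cmp w (H i (j + Suc d)) (H i (j + Suc (Suc d)))"
      using assms by (auto simp: tab_def)
    then have "H i (j + Suc d) \<noteq> \<infinity>"
      using Suc.prems cmp_le[OF c] le_finite by blast
    then show ?case using Suc.IH c cmp_trans by blast
  qed
  from this[of "j' - Suc j"] show ?thesis using assms by simp
qed

lemma tab_row_le:
  assumes "tab w H" "j \<le> j'"
  shows "H i j \<le> H i j'"
proof (cases "i = 0 \<or> j = j' \<or> H i j' = \<infinity>")
  case True
  then show ?thesis using assms(1) by (auto simp: tab_def)
next
  case False
  then show ?thesis using tab_row_cmp[OF assms(1), of i j j'] assms(2) by (auto dest: cmp_le)
qed

lemma tab_col_le: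
  assumes "tab w H" "i \<le> i'"
  shows "H i j \<le> H i' j"
  using tab_row_le[OF tab_tp[OF assms(1)] assms(2), of j] by simp

lemma tab_col_cmp:
  assumes "tab w H" "0 < j" "i < i'" "H i' j \<noteq> \<infinity>"
  shows "cmp (\<not> w) (H i j) (H i' j)"
  using tab_row_cmp[OF tab_tp[OF assms(1)], of j i i'] assms by simp

lemma tab_col_infinity:
  assumes "tab w H" "0 < j"
  shows "\<exists>i>0. H i j = \<infinity>"
proof (rule ccontr)
  assume "\<not> ?thesis"
  then have "(\<lambda>i. (Suc i, j)) ` UNIV \<subseteq> {(i, j). 0 < i \<and> 0 < j \<and> H i j \<noteq> \<infinity>}"
    using assms by auto
  moreover have "infinite ((\<lambda>i. (Suc i, j)) ` UNIV)"
    by (subst finite_image_iff) (auto simp: inj_on_def)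
  ultimately show False
    using finite_subset[OF _ tab_finite[OF assms(1)]] by blast
qed

section \<open>Single bumps in coordinates\<close>

definition source :: "extras \<Rightarrow> nat \<Rightarrow> enat \<Rightarrow> bool" where
  "source \<alpha> c a \<longleftrightarrow> a \<in># \<alpha> c \<and> (\<forall>x\<in>#\<alpha> c. x \<le> a) \<and> (\<forall>j>c. \<alpha> j = {#})"

lemma source_unique: "source \<alpha> c a \<Longrightarrow> source \<alpha> c' a' \<Longrightarrow> c' = c \<and> a' = a"
  by (metis source_def antisym empty_iff linorder_neqE_nat set_mset_empty)

text \<open>For \<open>w = False\<close> equality is excluded by the multiplicity clause of
  \<open>arms_ok\<close>, since only one copy of \<open>a\<close> could have been there.\<close>

lemma source_rest:
  assumes "arms_ok w H \<alpha>" "source \<alpha> c a" "x \<in># \<alpha> c - {#a#}"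
  shows "cmp w x a"
proof (cases w)
  case True
  then show ?thesis using assms by (auto simp: source_def dest: in_diffD)
next
  case False
  have "x \<noteq> a"
  proof
    assume "x = a"
    then have "0 < count (\<alpha> c - {#a#}) a" using assms(3)
      unfolding count_greater_zero_iff by simp
    moreover have "count (\<alpha> c) a \<le> 1" using assms(1) False by (simp add: arms_ok_def)
    ultimately show False by simp
  qed
  then show ?thesis using assms False by (force simp: source_def dest: in_diffD)
qed

text \<open>Row \<open>i\<close> is the last one of column \<open>c + 1\<close> whose hook lies
  below \<open>a\<close>, possibly the auxiliary row 0. The entry that \<open>a\<close> displaces is
  then either a leg in the cell of row \<open>i\<close> or the hook of row
  \<open>i + 1\<close>.\<close>

definition slot :: "bool \<Rightarrow> grid \<Rightarrow> nat \<Rightarrow> nat \<Rightarrow> enat \<Rightarrow> bool" where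
  "slot w H i c a \<longleftrightarrow> cmp (\<not> w) (H i (Suc c)) a \<and> cmp w a (H (Suc i) (Suc c))"

definition set_hook :: "grid \<Rightarrow> nat \<Rightarrow> nat \<Rightarrow> enat \<Rightarrow> grid" where
  "set_hook H i j a = (\<lambda>i' j'. if i' = i \<and> j' = j then a else H i' j')"

text \<open>An absent hook is \<infinity>, and displacing it must not produce an arm.\<close>

definition single :: "enat \<Rightarrow> enat multiset" where
  "single k = (if k = \<infinity> then {#} else {#k#})"

text \<open>Rule \<open>hook\<close> applies when every leg of row \<open>i\<close> that is not
  below \<open>a\<close> lies to the right of column \<open>c + 1\<close>; the hook of row
  \<open>i + 1\<close> is then the least entry that \<open>a\<close> can replace, and \<infinity>
  there means a new cell. In rule \<open>extra\<close> the displaced \<open>k\<close> is a leg of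
  cell \<open>(i, c + 1)\<close>, and \<open>a\<close> becomes a leg in its stead. In both, a finite
  \<open>k\<close> becomes the only arm of column \<open>c + 1\<close>.\<close>

inductive astep :: "bool \<Rightarrow> state \<Rightarrow> cell option \<Rightarrow> state \<Rightarrow> bool" for w where
  hook: "source \<alpha> c a \<Longrightarrow> slot w H i c a \<Longrightarrow>
    \<forall>y\<in>#\<Lambda> i. cmp w a y \<longrightarrow> cmp (\<not> w) (H i (Suc (Suc c))) y \<Longrightarrow>
    k = H (Suc i) (Suc c) \<Longrightarrow> g = (if k = \<infinity> then Some (Suc i, Suc c) else None) \<Longrightarrow>
    H' = set_hook H (Suc i) (Suc c) a \<Longrightarrow>
    \<alpha>' = \<alpha>(c := \<alpha> c - {#a#}, Suc c := single k) \<Longrightarrow>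
    astep w (H, \<alpha>, \<Lambda>) g (H', \<alpha>', \<Lambda>)"
| extra: "source \<alpha> c a \<Longrightarrow> slot w H i c a \<Longrightarrow>
    k \<in># \<Lambda> i \<Longrightarrow> cmp w a k \<Longrightarrow> cmp w k (H i (Suc (Suc c))) \<Longrightarrow>
    \<forall>y\<in>#\<Lambda> i. cmp w a y \<longrightarrow> k \<le> y \<Longrightarrow>
    \<alpha>' = \<alpha>(c := \<alpha> c - {#a#}, Suc c := {#k#}) \<Longrightarrow>
    \<Lambda>' = \<Lambda>(i := add_mset a (\<Lambda> i - {#k#})) \<Longrightarrow>
    astep w (H, \<alpha>, \<Lambda>) None (H, \<alpha>', \<Lambda>')"

definition lstep :: "bool \<Rightarrow> state \<Rightarrow> cell option \<Rightarrow> state \<Rightarrow> bool" where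
  "lstep w s g s' \<longleftrightarrow> astep (\<not> w) (tr s) (map_option prod.swap g) (tr s')"

lemma slot_unique:
  assumes "tab w H" "slot w H i c a" "slot w H i' c a"
  shows "i' = i"
proof -
  have *: False if "slot w H i c a" "slot w H i' c a" "i < i'" for i i'
  proof -
    have "H (Suc i) (Suc c) \<le> H i' (Suc c)"
      using tab_col_le[OF assms(1)] that by simp
    with that show False unfolding slot_def
      by (meson cmp_cmp_less' cmp_le leD order.strict_trans2)
  qed
  show ?thesis using *[of i i'] *[of i' i] assms by (metis linorder_neqE_nat)
qed

lemma slot_exists:
  assumes "tab w H" "0 < a" "a < \<infinity>"
  shows "\<exists>i. slot w H i c a"
proof -
  have "\<exists>i. cmp w a (H i (Suc c))"
    using tab_col_infinity[OF assms(1), of "Suc c"] assms(3) by (metis cmp_less zero_less_Suc)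
  then obtain i where i: "cmp w a (H i (Suc c))" "\<forall>i'<i. \<not> cmp w a (H i' (Suc c))"
    using exists_least_iff[of "\<lambda>i. cmp w a (H i (Suc c))"] by blast
  have "i \<noteq> 0"
  proof
    assume "i = 0"
    then have "cmp w a 0" using i(1) assms(1) by (simp add: tab_def)
    then show False using assms(2) by (auto dest: cmp_le)
  qed
  then obtain i' where "i = Suc i'" by (cases i) auto
  then have "slot w H i' c a" using i by (auto simp: slot_def cmp_not)
  then show ?thesis ..
qed

lemma arms_okD:
  assumes "arms_ok w H \<alpha>" "x \<in># \<alpha> c"
  shows "0 < c" "0 < x" "x < \<infinity>" "\<And>i. cmp (\<not> w) (H i (Suc c)) x \<Longrightarrow> cmp w (H (Suc i) c) x"
  using assms by (auto simp: arms_ok_def)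

text \<open>Row 0 of the next column has hook 0, which lies below \<open>x\<close>; this is
  admissibility at \<open>i = 0\<close>.\<close>

lemma arms_first:
  assumes "tab w H" "arms_ok w H \<alpha>" "x \<in># \<alpha> c"
  shows "cmp w (H 1 c) x"
proof -
  have "cmp (\<not> w) (H 0 (Suc c)) x"
    using arms_okD(2)[OF assms(2,3)] assms(1) unfolding tab_def by (metis cmp_less)
  then show ?thesis using arms_okD(4)[OF assms(2,3), of 0] by simp
qed

lemma cmp_set_hook_le:
  assumes "cmp w a (H i j)" shows "set_hook H i j a i' j' \<le> H i' j'"
  using assms by (auto simp: set_hook_def dest: cmp_le)

text \<open>The delicate points concern the lowered hook: its left neighbour is not above
  \<open>a\<close> because the arm \<open>a\<close> was admissible, and the legs of row
  \<open>i\<close> stay admissible by the side condition of rule \<open>hook\<close>.\<close>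

lemma astep_valid:
  assumes "astep w s g s'" "valid w s"
  shows "valid w s'"
  using assms
proof cases
  case (hook \<alpha> c a H i \<Lambda> k H' \<alpha>')
  have H: "tab w H" and al: "arms_ok w H \<alpha>" and la: "arms_ok (\<not> w) (tp H) \<Lambda>"
    using assms(2) hook by auto
  have a: "a \<in># \<alpha> c" using hook by (auto simp: source_def)
  note aD = arms_okD[OF al a]
  have sl: "cmp (\<not> w) (H i (Suc c)) a" "cmp w a k" using hook by (auto simp: slot_def)
  have le: "H' i' j' \<le> H i' j'" for i' j'
    using hook sl cmp_set_hook_le by blast
  have H'a: "H' (Suc i) (Suc c) = a" and H'o: "(i', j') \<noteq> (Suc i, Suc c) \<Longrightarrow> H' i' j' = H i' j'" for i' j'
    using hook by (auto simp: set_hook_def)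
  have tab': "tab w H'"
    unfolding tab_def
  proof (intro conjI allI impI)
    fix i' j' :: nat
    show "H' i' 0 = 0" "H' 0 j' = 0" using H H'o by (auto simp: tab_def)
    show "0 < H' i' j'" if "0 < i'" "0 < j'"
      using H H'o[of i' j'] that H'a aD by (cases "(i', j') = (Suc i, Suc c)") (auto simp: tab_def)
    show "cmp w (H' i' j') (H' i' (Suc j'))" if "0 < i'" "H' i' (Suc j') \<noteq> \<infinity>"
    proof (cases "(i', j') = (Suc i, c)")
      case True
      then show ?thesis using H'a H'o[of "Suc i" c] aD(4)[OF sl(1)] by simp
    next
      case False
      then have e: "H' i' (Suc j') = H i' (Suc j')" using H'o by simp
      then have "cmp w (H i' j') (H i' (Suc j'))" using H that by (auto simp: tab_def)
      then show ?thesis using e le le_cmp_trans by metis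
    qed
    show "cmp (\<not> w) (H' i' j') (H' (Suc i') j')" if "0 < j'" "H' (Suc i') j' \<noteq> \<infinity>"
    proof (cases "(i', j') = (i, Suc c)")
      case True
      then show ?thesis using H'a H'o[of i "Suc c"] sl by simp
    next
      case False
      then have e: "H' (Suc i') j' = H (Suc i') j'" using H'o by simp
      then have "cmp (\<not> w) (H i' j') (H (Suc i') j')" using H that by (auto simp: tab_def)
      then show ?thesis using e le le_cmp_trans by metis
    qed
  next
    have "{(i, j). 0 < i \<and> 0 < j \<and> H' i j \<noteq> \<infinity>} \<subseteq>
        insert (Suc i, Suc c) {(i, j). 0 < i \<and> 0 < j \<and> H i j \<noteq> \<infinity>}"
      using H'o by force
    then show "finite {(i, j). 0 < i \<and> 0 < j \<and> H' i j \<noteq> \<infinity>}"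
      by (rule finite_subset) (simp only: finite_insert tab_finite[OF H])
  qed
  have al': "arms_ok w H' \<alpha>'"
    unfolding arms_ok_def
  proof (intro conjI allI impI)
    fix c' x assume x: "x \<in># \<alpha>' c'"
    consider (old) "x \<in># \<alpha> c'" "c' \<noteq> c" "c' < c" | (c) "x \<in># \<alpha> c - {#a#}" "c' = c"
      | (new) "c' = Suc c" "x = k" "k \<noteq> \<infinity>"
    proof -
      have "c' \<le> c" if "x \<in># \<alpha> c'"
        using hook(3) that unfolding source_def by (metis empty_iff leI set_mset_empty)
      then show ?thesis
        using x hook(9) that by (cases "k = \<infinity>") (auto simp: single_def split: if_splits)
    qed
    then have "(0 < c' \<and> 0 < x \<and> x < \<infinity>) \<and> (\<forall>i'. cmp (\<not> w) (H' i' (Suc c')) x \<longrightarrow> cmp w (H' (Suc i') c') x)"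
    proof cases
      case old
      then show ?thesis using arms_okD[OF al old(1)] H'o by simp
    next
      case c
      have x': "x \<in># \<alpha> c" using c by (auto dest: in_diffD)
      have "cmp w (H' (Suc i') c') x" if "cmp (\<not> w) (H' i' (Suc c')) x" for i'
      proof (cases "i' = Suc i")
        case True
        then have "cmp (\<not> w) a x" using that c H'a by simp
        moreover have "cmp w x a" using source_rest[OF al hook(3) c(1)] .
        ultimately show ?thesis using cmp_not by blast
      next
        case False
        then show ?thesis using that c arms_okD(4)[OF al x', of i'] H'o by simp
      qed
      then show ?thesis using arms_okD[OF al x'] c by simp
    next
      case new
      have "cmp w (H' (Suc i') c') x" if *: "cmp (\<not> w) (H' i' (Suc c')) x" for i'
      proof -
        have "cmp (\<not> w) (H i' (Suc (Suc c))) k" using * new H'o by simp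
        \<comment> \<open>From row \<open>i + 1\<close> on, the hooks of column \<open>c + 2\<close>
          are not below \<open>k\<close>, so only rows up to \<open>i\<close> can satisfy the
          premise.\<close>
        then have "i' \<le> i"
        proof (rule contrapos_pp)
          assume "\<not> i' \<le> i"
          then have "H (Suc i) (Suc (Suc c)) \<le> H i' (Suc (Suc c))" using tab_col_le[OF H] by simp
          moreover have "cmp w k (H (Suc i) (Suc (Suc c)))"
            using H new hook(6) tab_row_cmp[OF H, of "Suc i" "Suc c" "Suc (Suc c)"]
            by (cases "H (Suc i) (Suc (Suc c)) = \<infinity>") (auto intro: cmp_less)
          ultimately show "\<not> cmp (\<not> w) (H i' (Suc (Suc c))) k"
            using cmp_not cmp_le_trans by blast
        qed
        then have "H' (Suc i') (Suc c) \<le> a"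
          using tab_col_le[OF tab', of "Suc i'" "Suc i" "Suc c"] H'a by simp
        then show ?thesis using new sl le_cmp_trans by blast
      qed
      moreover have "0 < k" using H hook by (auto simp: tab_def)
      ultimately show ?thesis using new by simp
    qed
    then show "0 < c'" "0 < x" "x < \<infinity>" "\<And>i'. cmp (\<not> w) (H' i' (Suc c')) x \<Longrightarrow> cmp w (H' (Suc i') c') x"
      by auto
  next
    fix c' x assume w: "\<not> w"
    then have "count (\<alpha> c') x \<le> 1" using al by (auto simp: arms_ok_def)
    then show "count (\<alpha>' c') x \<le> 1" using hook by (auto simp: single_def)
  qed
  have la': "arms_ok (\<not> w) (tp H') \<Lambda>"
    unfolding arms_ok_def
  proof (intro conjI allI impI)
    fix r y assume y: "y \<in># \<Lambda> r"
    show "0 < r" "0 < y" "y < \<infinity>" using arms_okD[OF la y] by auto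
    fix j assume *: "cmp (\<not> \<not> w) (tp H' j (Suc r)) y"
    have "cmp (\<not> w) (H' r (Suc j)) y"
    proof (cases "(Suc r, j) = (Suc i, Suc c)")
      case True
      then have "cmp w a y" using * H'a by simp
      then have "cmp (\<not> w) (H i (Suc (Suc c))) y" using hook True y by auto
      then show ?thesis using True H'o[of r "Suc j"] by simp
    next
      case False
      then have "cmp w (H (Suc r) j) y" using * H'o by simp
      then have "cmp (\<not> w) (H r (Suc j)) y" using arms_okD(4)[OF la y, of j] by simp
      then show ?thesis using le le_cmp_trans by blast
    qed
    then show "cmp (\<not> w) (tp H' (Suc j) r) y" by simp
  next
    fix r y show "\<not> \<not> w \<Longrightarrow> count (\<Lambda> r) y \<le> 1" using la by (auto simp: arms_ok_def)
  qed
  show ?thesis using tab' al' la' hook by simp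
next
  case (extra \<alpha> c a H i k \<Lambda> \<alpha>' \<Lambda>')
  have H: "tab w H" and al: "arms_ok w H \<alpha>" and la: "arms_ok (\<not> w) (tp H) \<Lambda>"
    using assms(2) extra by auto
  have a: "a \<in># \<alpha> c" using extra by (auto simp: source_def)
  note aD = arms_okD[OF al a]
  note kD = arms_okD[OF la extra(6)]
  have sl: "cmp (\<not> w) (H i (Suc c)) a" using extra by (auto simp: slot_def)
  \<comment> \<open>If the hook above were not above \<open>k\<close>, admissibility would put the
    leg \<open>k\<close> into a later column than \<open>c + 1\<close>.\<close>
  have k': "cmp (\<not> w) k (H (Suc i) (Suc c))"
    using kD(4)[of "Suc c"] extra(8) cmp_not by auto
  have aH: "a < H (Suc i) (Suc c)" using extra(7) k' cmp_cmp_less by blast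
  have al': "arms_ok w H \<alpha>'"
    unfolding arms_ok_def
  proof (intro conjI allI impI)
    fix c' x assume x: "x \<in># \<alpha>' c'"
    consider (old) "x \<in># \<alpha> c'" | (new) "c' = Suc c" "x = k"
      using x extra(10) by (auto split: if_splits dest: in_diffD)
    then have "(0 < c' \<and> 0 < x \<and> x < \<infinity>) \<and> (\<forall>i'. cmp (\<not> w) (H i' (Suc c')) x \<longrightarrow> cmp w (H (Suc i') c') x)"
    proof cases
      case old
      then show ?thesis using arms_okD[OF al old(1)] by simp
    next
      case new
      have "cmp w (H (Suc i') c') x" if *: "cmp (\<not> w) (H i' (Suc c')) x" for i'
      proof -
        have "i' < i"
        proof (rule ccontr)
          assume "\<not> i' < i"
          then have "H i (Suc (Suc c)) \<le> H i' (Suc (Suc c))" using tab_col_le[OF H] by simp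
          then show False
            using * new extra(8) cmp_not cmp_le_trans by blast
        qed
        then have "H (Suc i') (Suc c) \<le> H i (Suc c)"
          using tab_col_le[OF H, of "Suc i'" i "Suc c"] by simp
        then have "H (Suc i') (Suc c) \<le> a" using sl by (auto dest: cmp_le)
        then show ?thesis using new extra(7) le_cmp_trans by blast
      qed
      then show ?thesis using new kD by simp
    qed
    then show "0 < c'" "0 < x" "x < \<infinity>" "\<And>i'. cmp (\<not> w) (H i' (Suc c')) x \<Longrightarrow> cmp w (H (Suc i') c') x"
      by auto
  next
    fix c' x assume w: "\<not> w"
    then have "count (\<alpha> c') x \<le> 1" using al by (auto simp: arms_ok_def)
    then show "count (\<alpha>' c') x \<le> 1" using extra(10) by auto
  qed
  have la': "arms_ok (\<not> w) (tp H) \<Lambda>'"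
    unfolding arms_ok_def
  proof (intro conjI allI impI)
    fix r y assume y: "y \<in># \<Lambda>' r"
    consider (old) "y \<in># \<Lambda> r" | (new) "r = i" "y = a"
      using y extra(11) by (auto split: if_splits dest: in_diffD)
    then have "(0 < r \<and> 0 < y \<and> y < \<infinity>) \<and> (\<forall>j. cmp w (H (Suc r) j) y \<longrightarrow> cmp (\<not> w) (H r (Suc j)) y)"
    proof cases
      case old
      then show ?thesis using arms_okD[OF la old] by simp
    next
      case new
      have "cmp (\<not> w) (H i (Suc j)) a" if "cmp w (H (Suc i) j) a" for j
      proof -
        have "j \<le> c"
        proof (rule ccontr)
          assume "\<not> j \<le> c"
          then have "H (Suc i) (Suc c) \<le> H (Suc i) j" using tab_row_le[OF H] by simp
          then show False using aH that by (auto dest: cmp_le)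
        qed
        then have "H i (Suc j) \<le> H i (Suc c)" using tab_row_le[OF H] by simp
        then show ?thesis using sl le_cmp_trans by blast
      qed
      then show ?thesis using new aD kD by simp
    qed
    then show "0 < r" "0 < y" "y < \<infinity>"
      "\<And>j. cmp (\<not> \<not> w) (tp H j (Suc r)) y \<Longrightarrow> cmp (\<not> w) (tp H (Suc j) r) y"
      by auto
  next
    fix r y assume "\<not> \<not> w"
    then have w by simp
    have c1: "count (\<Lambda> r) y \<le> 1" for r y using la \<open>w\<close> by (auto simp: arms_ok_def)
    \<comment> \<open>Legs must stay distinct: if \<open>a\<close> already is a leg of row
      \<open>i\<close>, minimality forces \<open>k = a\<close>, and that copy is the one
      removed.\<close>
    have "a \<in># \<Lambda> i \<Longrightarrow> k = a"
      using extra(7,9) \<open>w\<close> by (auto intro: antisym)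
    then have ak: "count (\<Lambda> i) a = 0" if "k \<noteq> a"
      using that not_in_iff by metis
    have "count (\<Lambda> i - {#k#}) a = 0"
    proof (cases "k = a")
      case True
      then show ?thesis using c1[of i a] by (simp only: count_diff count_single if_True diff_is_0_eq simp_thms)
    next
      case False
      then show ?thesis unfolding count_diff ak[OF False] by (simp only: diff_0_eq_0)
    qed
    then have "count (\<Lambda>' i) a \<le> 1" using extra(11) by simp
    moreover have "count (\<Lambda>' r) y \<le> count (\<Lambda> r) y" if "(r, y) \<noteq> (i, a)"
      using that extra(11) by auto
    ultimately show "count (\<Lambda>' r) y \<le> 1"
      using c1[of r y] order.trans prod.inject by metis
  qed
  show ?thesis using H al' la' extra by simp
qed

section \<open>The diamond property of single bumps\<close>

text \<open>The premises of the two rules as predicates, which allows one to say that a step remains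
  possible after another step.\<close>

definition hook_step where
  "hook_step w H \<alpha> \<Lambda> c a i \<longleftrightarrow> source \<alpha> c a \<and> slot w H i c a \<and>
     (\<forall>y\<in>#\<Lambda> i. cmp w a y \<longrightarrow> cmp (\<not> w) (H i (Suc (Suc c))) y)"

definition extra_step where
  "extra_step w H \<alpha> \<Lambda> c a i k \<longleftrightarrow> source \<alpha> c a \<and> slot w H i c a \<and>
     k \<in># \<Lambda> i \<and> cmp w a k \<and> cmp w k (H i (Suc (Suc c))) \<and> (\<forall>y\<in>#\<Lambda> i. cmp w a y \<longrightarrow> k \<le> y)"

definition move :: "extras \<Rightarrow> nat \<Rightarrow> enat \<Rightarrow> enat \<Rightarrow> extras" where
  "move \<alpha> c a k = \<alpha>(c := \<alpha> c - {#a#}, Suc c := single k)"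

definition swap_extra :: "extras \<Rightarrow> nat \<Rightarrow> enat \<Rightarrow> enat \<Rightarrow> extras" where
  "swap_extra \<Lambda> i k a = \<Lambda>(i := add_mset a (\<Lambda> i - {#k#}))"

definition grown :: "grid \<Rightarrow> nat \<Rightarrow> nat \<Rightarrow> cell option" where
  "grown H i j = (if H i j = \<infinity> then Some (i, j) else None)"

lemma tp_set_hook: "tp (set_hook H i j a) = set_hook (tp H) j i a"
  by (auto simp: set_hook_def fun_eq_iff)

lemma swap_grown: "map_option prod.swap (grown H i j) = grown (tp H) j i"
  by (simp add: grown_def)

lemma astep_hookI:
  "hook_step w H \<alpha> \<Lambda> c a i \<Longrightarrow> H' = set_hook H (Suc i) (Suc c) a \<Longrightarrow>
   \<alpha>' = move \<alpha> c a (H (Suc i) (Suc c)) \<Longrightarrow> g = grown H (Suc i) (Suc c) \<Longrightarrow>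
   astep w (H, \<alpha>, \<Lambda>) g (H', \<alpha>', \<Lambda>)"
  unfolding hook_step_def move_def grown_def by (blast intro: astep.hook)

lemma single_finite: "k \<noteq> \<infinity> \<Longrightarrow> single k = {#k#}"
  by (auto simp: single_def)

lemma single_infinity [simp]: "single \<infinity> = {#}"
  by (auto simp: single_def)

lemma astep_extraI:
  "extra_step w H \<alpha> \<Lambda> c a i k \<Longrightarrow> k \<noteq> \<infinity> \<Longrightarrow> \<alpha>' = move \<alpha> c a k \<Longrightarrow> \<Lambda>' = swap_extra \<Lambda> i k a \<Longrightarrow>
   astep w (H, \<alpha>, \<Lambda>) None (H, \<alpha>', \<Lambda>')"
  unfolding extra_step_def move_def swap_extra_def
  by (rule astep.extra) (auto simp: single_finite)

lemma astepE [consumes 2, case_names hook extra]: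
  assumes "astep w (H, \<alpha>, \<Lambda>) g s'" "valid w (H, \<alpha>, \<Lambda>)"
  obtains (hook) c a i where "hook_step w H \<alpha> \<Lambda> c a i" "g = grown H (Suc i) (Suc c)"
      "s' = (set_hook H (Suc i) (Suc c) a, move \<alpha> c a (H (Suc i) (Suc c)), \<Lambda>)"
  | (extra) c a i k where "extra_step w H \<alpha> \<Lambda> c a i k" "g = None" "k \<noteq> \<infinity>"
      "s' = (H, move \<alpha> c a k, swap_extra \<Lambda> i k a)"
  using assms(1)
proof cases
  case (hook c a i k)
  then show ?thesis using that(1)[of c a i] by (auto simp: hook_step_def move_def grown_def)
next
  case (extra c a i k)
  then have "k \<noteq> \<infinity>" using assms(2) arms_okD(3) by fastforce
  with extra show ?thesis using that(2)[of c a i k]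
    by (auto simp: extra_step_def move_def swap_extra_def single_def)
qed

lemma lstep_hookI:
  assumes "hook_step (\<not> w) (tp H) \<Lambda> \<alpha> r l j" "H' = set_hook H (Suc r) (Suc j) l"
    "\<Lambda>' = move \<Lambda> r l (H (Suc r) (Suc j))" "g = grown H (Suc r) (Suc j)"
  shows "lstep w (H, \<alpha>, \<Lambda>) g (H', \<alpha>, \<Lambda>')"
  unfolding lstep_def using astep_hookI[OF assms(1)] assms(2-)
  by (simp add: tp_set_hook swap_grown)

lemma lstep_extraI:
  assumes "extra_step (\<not> w) (tp H) \<Lambda> \<alpha> r l j k" "k \<noteq> \<infinity>" "\<Lambda>' = move \<Lambda> r l k" "\<alpha>' = swap_extra \<alpha> j k l"
  shows "lstep w (H, \<alpha>, \<Lambda>) None (H, \<alpha>', \<Lambda>')"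
  unfolding lstep_def using astep_extraI[OF assms(1,2)] assms(3-) by simp

lemma lstepE [consumes 2, case_names hook extra]:
  assumes "lstep w (H, \<alpha>, \<Lambda>) g s'" "valid w (H, \<alpha>, \<Lambda>)"
  obtains (hook) r l j where "hook_step (\<not> w) (tp H) \<Lambda> \<alpha> r l j" "g = grown H (Suc r) (Suc j)"
      "s' = (set_hook H (Suc r) (Suc j) l, \<alpha>, move \<Lambda> r l (H (Suc r) (Suc j)))"
  | (extra) r l j k where "extra_step (\<not> w) (tp H) \<Lambda> \<alpha> r l j k" "g = None" "k \<noteq> \<infinity>"
      "s' = (H, swap_extra \<alpha> j k l, move \<Lambda> r l k)"
proof -
  obtain H' \<alpha>' \<Lambda>' where s': "s' = (H', \<alpha>', \<Lambda>')" by (cases s')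
  have "astep (\<not> w) (tp H, \<Lambda>, \<alpha>) (map_option prod.swap g) (tp H', \<Lambda>', \<alpha>')"
    using assms(1) s' by (simp add: lstep_def)
  moreover have "valid (\<not> w) (tp H, \<Lambda>, \<alpha>)" using valid_tr[OF assms(2)] by simp
  ultimately show ?thesis
  proof (cases rule: astepE)
    case (hook r l j)
    have "g = map_option prod.swap (map_option prod.swap g)" by (cases g) auto
    then have "g = grown H (Suc r) (Suc j)" using hook(2) by (simp add: swap_grown)
    moreover have "H' = tp (set_hook (tp H) (Suc j) (Suc r) l)" using hook(3) by (metis prod.inject tp_tp)
    ultimately show ?thesis using that(1)[OF hook(1)] hook s' by (simp add: tp_set_hook)
  next
    case (extra r l j k)
    then have "H' = H" by (metis prod.inject tp_tp)
    then show ?thesis using that(2)[OF extra(1)] extra s' by simp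
  qed
qed

lemma lstep_valid: "lstep w s g s' \<Longrightarrow> valid w s \<Longrightarrow> valid w s'"
  unfolding lstep_def using astep_valid valid_tr valid_tr' by blast

lemma slotD: "slot w H i c a \<Longrightarrow> cmp (\<not> w) (H i (Suc c)) a" "slot w H i c a \<Longrightarrow> cmp w a (H (Suc i) (Suc c))"
  by (simp_all add: slot_def)

lemma sourceD: "source \<alpha> c a \<Longrightarrow> a \<in># \<alpha> c" "source \<alpha> c a \<Longrightarrow> x \<in># \<alpha> c \<Longrightarrow> x \<le> a"
    "source \<alpha> c a \<Longrightarrow> c < j \<Longrightarrow> \<alpha> j = {#}"
  by (auto simp: source_def)

lemma in_remove_neq: "x \<noteq> y \<Longrightarrow> x \<in># M - {#y#} \<longleftrightarrow> x \<in># M"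
  by (auto simp: in_diff_count)

lemma in_remove_swap: "k \<in># M \<Longrightarrow> l \<in># M - {#k#} \<Longrightarrow> k \<in># M - {#l#}"
  by (cases "k = l") (auto simp: in_remove_neq)

lemma add_remove_swap: "l \<in># M - {#k#} \<Longrightarrow> add_mset a (M - {#k#}) - {#l#} = add_mset a (M - {#l#} - {#k#})"
  by (simp add: diff_union_swap2 add_mset_commute)

text \<open>The arm step lowers one hook and may create one arm, in column \<open>c + 1\<close>.
  Only for \<open>j = c + 1\<close> has the displaced hook to be kept from becoming a candidate for
  \<open>l\<close>.\<close>

lemma hook_hook_persist:
  assumes "valid w (H, \<alpha>, \<Lambda>)" and A: "hook_step w H \<alpha> \<Lambda> c a i"
    and L: "hook_step (\<not> w) (tp H) \<Lambda> \<alpha> r l j" and ne: "(i, c) \<noteq> (r, j)"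
  shows "hook_step (\<not> w) (tp (set_hook H (Suc i) (Suc c) a)) \<Lambda> (move \<alpha> c a (H (Suc i) (Suc c))) r l j"
proof -
  define H' where "H' = set_hook H (Suc i) (Suc c) a"
  let ?k = "H (Suc i) (Suc c)"
  have tab: "tab w H" using assms by simp
  have ak: "cmp w a ?k" and Ha: "cmp (\<not> w) (H i (Suc c)) a" using A by (auto simp: hook_step_def slot_def)
  have le: "H' i' j' \<le> H i' j'" for i' j'
    unfolding H'_def using ak by (rule cmp_set_hook_le)
  have l: "cmp w (H (Suc r) j) l" "cmp (\<not> w) l (H (Suc r) (Suc j))" using L by (auto simp: hook_step_def slot_def)
  have "slot (\<not> w) (tp H') j r l"
    using le_cmp_trans[OF le l(1)] l(2) ne by (auto simp: slot_def H'_def set_hook_def)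
  moreover have "cmp w (H' (Suc (Suc r)) j) x" if x: "x \<in># move \<alpha> c a ?k j" "cmp (\<not> w) l x" for x
  proof (cases "j = Suc c")
    case False
    then have "x \<in># \<alpha> j" using x by (auto simp: move_def split: if_splits dest: in_diffD)
    then have "cmp w (H (Suc (Suc r)) j) x" using L x by (auto simp: hook_step_def)
    then show ?thesis using le le_cmp_trans by blast
  next
    case True
    then have k: "x = ?k" using x by (auto simp: move_def single_def split: if_splits)
    \<comment> \<open>Row \<open>i + 1\<close>, from which \<open>k\<close> came, is compared with
      row \<open>r + 2\<close>. If they agree, the new hook there is \<open>a\<close>, which is not
      above \<open>k\<close>; if row \<open>i + 1\<close> is lower, \<open>k\<close> is not above
      \<open>l\<close>, contrary to assumption; if it is higher, the hook of row
      \<open>r + 2\<close> is at most \<open>a\<close>.\<close>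
    consider "Suc (Suc r) = Suc i" | "Suc i \<le> Suc r" | "Suc (Suc r) \<le> i" by linarith
    then show ?thesis
    proof cases
      case 1
      then show ?thesis using True k ak by (simp add: H'_def set_hook_def)
    next
      case 2
      then have "x \<le> H (Suc r) j" using tab_col_le[OF tab] True k by simp
      then have "cmp w x l" using l le_cmp_trans by blast
      then show ?thesis using x(2) cmp_not by blast
    next
      case 3
      then have "H (Suc (Suc r)) j \<le> H i (Suc c)" using tab_col_le[OF tab] True by simp
      then have "H' (Suc (Suc r)) j \<le> a" using le cmp_le[OF Ha] order_trans by metis
      then show ?thesis using k ak le_cmp_trans by blast
    qed
  qed
  ultimately show ?thesis using L by (simp add: hook_step_def H'_def)
qed

text \<open>The rule compares \<open>k\<close> only with the hook to the right of its cell; the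
  bound by the hook above comes from admissibility of the leg \<open>k\<close>.\<close>

lemma extra_bound:
  assumes "valid w (H, \<alpha>, \<Lambda>)" "extra_step w H \<alpha> \<Lambda> c a i k"
  shows "cmp (\<not> w) k (H (Suc i) (Suc c))"
proof -
  have "arms_ok (\<not> w) (tp H) \<Lambda>" "k \<in># \<Lambda> i" using assms by (auto simp: extra_step_def)
  from arms_okD(4)[OF this, of "Suc c"] show ?thesis
    using assms(2) cmp_not by (auto simp: extra_step_def)
qed

text \<open>Excluded by \<open>ne\<close> is the case that the leg displaced by the arm is the very
  copy to be bumped. Otherwise \<open>a\<close> is at most \<open>l\<close> when they share a row,
  so \<open>l\<close> remains the largest leg, and a new arm \<open>k\<close> in the landing column
  is below \<open>l\<close> and does not attract it.\<close>

lemma extra_hook_persist: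
  assumes v: "valid w (H, \<alpha>, \<Lambda>)" and A: "extra_step w H \<alpha> \<Lambda> c a i k"
    and L: "hook_step (\<not> w) (tp H) \<Lambda> \<alpha> r l j" and ne: "i \<noteq> r \<or> l \<in># \<Lambda> i - {#k#}"
  shows "hook_step (\<not> w) (tp H) (swap_extra \<Lambda> i k a) (move \<alpha> c a k) r l j"
    and "extra_step w (set_hook H (Suc r) (Suc j) l) \<alpha> (move \<Lambda> r l (H (Suc r) (Suc j))) c a i k"
proof -
  have tab: "tab w H" using v by simp
  have ir: "i \<le> r" using A L by (metis extra_step_def hook_step_def source_def empty_iff leI set_mset_empty)
  have kH: "cmp (\<not> w) k (H (Suc i) (Suc c))" using extra_bound[OF v A] .
  have ak: "cmp w a k" using A by (simp add: extra_step_def)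
  have s: "source \<Lambda> r l" and l: "cmp w (H (Suc r) j) l" "cmp (\<not> w) l (H (Suc r) (Suc j))"
    using L by (auto simp: hook_step_def slot_def)
  have al: "a \<le> l" if "i = r"
  proof -
    have "k \<le> l" using that A s by (auto simp: extra_step_def source_def)
    then show ?thesis using ak by (auto dest: cmp_le)
  qed
  have "source (swap_extra \<Lambda> i k a) r l"
    using s al ne ir unfolding source_def swap_extra_def
    by (auto split: if_splits dest: in_diffD)
  moreover have "cmp w (H (Suc (Suc r)) j) x" if x: "x \<in># move \<alpha> c a k j" "cmp (\<not> w) l x" for x
  proof (cases "j = Suc c")
    case False
    then have "x \<in># \<alpha> j" using x by (auto simp: move_def split: if_splits dest: in_diffD)
    then show ?thesis using L x by (auto simp: hook_step_def)
  next
    case True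
    then have k: "x = k" using x by (auto simp: move_def single_def split: if_splits)
    have "cmp (\<not> w) k (H (Suc r) j)"
      using True kH tab_col_le[OF tab, of "Suc i" "Suc r"] ir cmp_le_trans by blast
    then have "k < l" using l cmp_cmp_less' by blast
    then show ?thesis using x k cmp_le leD by blast
  qed
  ultimately show "hook_step (\<not> w) (tp H) (swap_extra \<Lambda> i k a) (move \<alpha> c a k) r l j"
    using L by (simp add: hook_step_def)
  define H' where "H' = set_hook H (Suc r) (Suc j) l"
  have le: "H' i' j' \<le> H i' j'" for i' j'
    unfolding H'_def using l(2) by (rule cmp_set_hook_le)
  have Ho: "H' i' j' = H i' j'" if "i' \<le> r" for i' j' using that by (simp add: H'_def set_hook_def)
  have "cmp w a (H' (Suc i) (Suc c))"
  proof (cases "Suc i = Suc r \<and> Suc c = Suc j")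
    case True
    then have "k \<le> l" using A s by (auto simp: extra_step_def source_def)
    then show ?thesis using True ak cmp_le_trans by (auto simp: H'_def set_hook_def)
  next
    case False
    then show ?thesis using A by (auto simp: H'_def set_hook_def extra_step_def slot_def)
  qed
  moreover have "k \<in># move \<Lambda> r l (H (Suc r) (Suc j)) i"
  proof (cases "i = r")
    case True
    then have "l \<in># \<Lambda> i - {#k#}" using ne by simp
    then have "k \<in># \<Lambda> i - {#l#}" using A
      unfolding extra_step_def by (blast intro: in_remove_swap)
    then show ?thesis using True by (simp add: move_def)
  next
    case False
    then show ?thesis using A ir by (simp add: move_def extra_step_def)
  qed
  moreover have "y \<in># \<Lambda> i" if "y \<in># move \<Lambda> r l (H (Suc r) (Suc j)) i" for y
    using that ir by (auto simp: move_def split: if_splits dest: in_diffD)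
  ultimately show "extra_step w (set_hook H (Suc r) (Suc j) l) \<alpha> (move \<Lambda> r l (H (Suc r) (Suc j))) c a i k"
    using A Ho[OF ir] unfolding extra_step_def slot_def H'_def[symmetric] by simp
qed

text \<open>The leg \<open>l\<close> sits in cell \<open>(r, c + 1)\<close>, and admissibility of
  the arm \<open>a\<close> bounds the hook of \<open>(r + 1, c)\<close> by \<open>l\<close>. So
  column \<open>c\<close> is a slot for \<open>l\<close> in row \<open>r + 1\<close>, and slots are
  unique: \<open>l\<close> would land directly above the cell it leaves.\<close>

lemma extra_last_col:
  assumes v: "valid w (H, \<alpha>, \<Lambda>)" and A: "extra_step w H \<alpha> \<Lambda> c a r l"
    and L: "cmp w (H (Suc r) j) l" "cmp (\<not> w) l (H (Suc r) (Suc j))"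
  shows "j = c"
proof -
  have tab: "tab w H" using v by simp
  have lH: "cmp (\<not> w) l (H (Suc r) (Suc c))" using extra_bound[OF v A] .
  have "arms_ok w H \<alpha>" "a \<in># \<alpha> c" "cmp (\<not> w) (H r (Suc c)) a" "cmp w a l"
    using v A by (auto simp: extra_step_def slot_def source_def)
  then have "cmp w (H (Suc r) c) l" using arms_okD(4) cmp_trans by blast
  then have "slot (\<not> w) (tp H) c r l" "slot (\<not> w) (tp H) j r l" using lH L by (auto simp: slot_def)
  then show ?thesis using slot_unique[OF tab_tp[OF tab]] by blast
qed

text \<open>The first line is the plain commuting square. The other two describe a collision, in
  which one side makes two bumps before its cell appears: above the contested cell when the leg is
  the smaller entry, to its right when the arm is.\<close>

definition diamond where
  "diamond w s1 g1 s2 g2 \<longleftrightarrow>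
     (g1 = None \<or> g1 \<noteq> g2) \<and> (\<exists>s3. lstep w s1 g2 s3 \<and> astep w s2 g1 s3) \<or>
     (\<exists>i j s3 s4. g1 = Some (i, j) \<and> g2 = Some (i, j) \<and>
        (lstep w s1 None s3 \<and> lstep w s3 (Some (Suc i, j)) s4 \<and> astep w s2 (Some (Suc i, j)) s4 \<or>
         astep w s2 None s3 \<and> astep w s3 (Some (i, Suc j)) s4 \<and> lstep w s1 (Some (i, Suc j)) s4))"

lemma swap_swap [simp]: "map_option prod.swap (map_option prod.swap g) = g"
  by (cases g) auto

lemma lstep_tr: "lstep (\<not> w) s g s' \<longleftrightarrow> astep w (tr s) (map_option prod.swap g) (tr s')"
  by (simp add: lstep_def)

lemma astep_tr: "astep (\<not> w) s g s' \<longleftrightarrow> lstep w (tr s) (map_option prod.swap g) (tr s')"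
  by (simp add: lstep_def del: option.map_comp)

lemma swap_option_Some: "map_option prod.swap g = Some (i, j) \<longleftrightarrow> g = Some (j, i)"
  by (cases g) auto

text \<open>Transposition exchanges the two sides of the diamond and its two collision alternatives,
  which halves the case analysis.\<close>

lemma diamond_tr:
  assumes "diamond (\<not> w) (tr s2) (map_option prod.swap g2) (tr s1) (map_option prod.swap g1)"
  shows "diamond w s1 g1 s2 g2"
  using assms unfolding diamond_def lstep_tr astep_tr
proof (elim disjE conjE exE, goal_cases)
  case (1 s3)
  then show ?case
    by - (rule disjI1, (intro conjI exI[of _ "tr s3"]; cases g1; auto simp del: option.map_comp))
next
  case (2 s3)
  then show ?case
    by - (rule disjI1, (intro conjI exI[of _ "tr s3"]; cases g1; auto simp del: option.map_comp))
next
  case (3 i j s3 s4)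
  then show ?case
    by (intro disjI2 exI[of _ j] exI[of _ i] exI[of _ "tr s3"] exI[of _ "tr s4"])
      (auto simp: swap_option_Some)
next
  case (4 i j s3 s4)
  then show ?case
    by (intro disjI2 exI[of _ j] exI[of _ i] exI[of _ "tr s3"] exI[of _ "tr s4"])
      (auto simp: swap_option_Some)
qed

lemma diamondI1: "g1 = None \<or> g1 \<noteq> g2 \<Longrightarrow> lstep w s1 g2 s3 \<Longrightarrow> astep w s2 g1 s3 \<Longrightarrow> diamond w s1 g1 s2 g2"
  unfolding diamond_def by blast

lemma diamondI2: "lstep w s1 None s3 \<Longrightarrow> lstep w s3 (Some (Suc i, j)) s4 \<Longrightarrow> astep w s2 (Some (Suc i, j)) s4 \<Longrightarrow>
  diamond w s1 (Some (i, j)) s2 (Some (i, j))"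
  unfolding diamond_def by blast

text \<open>Both steps target the same cell and the leg \<open>l\<close> is the smaller one, so it ends up as the hook.\<close>

lemma diamond_same_cell:
  assumes v: "valid w (H, \<alpha>, \<Lambda>)" and A: "hook_step w H \<alpha> \<Lambda> c a r"
    and L: "hook_step (\<not> w) (tp H) \<Lambda> \<alpha> r l c" and la: "cmp (\<not> w) l a"
  shows "diamond w (set_hook H (Suc r) (Suc c) a, move \<alpha> c a (H (Suc r) (Suc c)), \<Lambda>) (grown H (Suc r) (Suc c))
     (set_hook H (Suc r) (Suc c) l, \<alpha>, move \<Lambda> r l (H (Suc r) (Suc c))) (grown H (Suc r) (Suc c))"
proof -
  let ?k = "H (Suc r) (Suc c)"
  define H1 where "H1 = set_hook H (Suc r) (Suc c) a"
  define H2 where "H2 = set_hook H (Suc r) (Suc c) l"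
  define \<alpha>1 where "\<alpha>1 = move \<alpha> c a ?k"
  define \<Lambda>2 where "\<Lambda>2 = move \<Lambda> r l ?k"
  have tab: "tab w H" and al: "arms_ok w H \<alpha>" using v by auto
  have sa: "source \<alpha> c a" and sl: "source \<Lambda> r l" using A L by (auto simp: hook_step_def)
  have a: "a < \<infinity>" using arms_okD(3)[OF al sourceD(1)[OF sa]] .
  have slA: "cmp (\<not> w) (H r (Suc c)) a" "cmp w a ?k"
    and slL: "cmp w (H (Suc r) c) l" "cmp (\<not> w) l ?k"
    using A L by (auto simp: hook_step_def slot_def)
  have L1: "hook_step (\<not> w) (tp H1) \<Lambda> \<alpha>1 r l c"
    using L la by (auto simp: hook_step_def slot_def H1_def \<alpha>1_def set_hook_def move_def dest: in_diffD)
  have H12: "set_hook H1 (Suc r) (Suc c) l = H2" by (auto simp: H1_def H2_def set_hook_def fun_eq_iff)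
  have H1a: "H1 (Suc r) (Suc c) = a" by (simp add: H1_def set_hook_def)
  \<comment> \<open>After the arm step the contested hook is \<open>a\<close>, and \<open>l\<close>
    displaces it into the legs of row \<open>r + 1\<close>.\<close>
  have l1: "lstep w (H1, \<alpha>1, \<Lambda>) None (H2, \<alpha>1, move \<Lambda> r l a)"
    by (rule lstep_hookI[OF L1]) (use a H12 H1a in \<open>auto simp: grown_def\<close>)
  show ?thesis
  proof (cases "?k = \<infinity>")
    case False
    \<comment> \<open>In the other order the old hook \<open>?k\<close> has become a leg of the
      contested cell, and \<open>a\<close> displaces it from there. Both orders leave
      \<open>l\<close> as hook, \<open>a\<close> as leg and \<open>?k\<close> as arm.\<close>
    have "extra_step w H2 \<alpha> \<Lambda>2 c a (Suc r) ?k"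
      unfolding extra_step_def
    proof (intro conjI)
      show "source \<alpha> c a" by (rule sa)
      have "?k \<le> H (Suc (Suc r)) (Suc c)" using tab_col_le[OF tab] by simp
      then show "slot w H2 (Suc r) c a"
        using la cmp_le_trans[OF slA(2)] by (auto simp: slot_def H2_def set_hook_def)
      show "?k \<in># \<Lambda>2 (Suc r)" using False by (simp add: \<Lambda>2_def move_def single_def)
      show "cmp w a ?k" by (rule slA)
      show "cmp w ?k (H2 (Suc r) (Suc (Suc c)))"
        using tab_row_cmp[OF tab, of "Suc r" "Suc c" "Suc (Suc c)"] False
        by (cases "H (Suc r) (Suc (Suc c)) = \<infinity>") (auto simp: H2_def set_hook_def intro: cmp_less)
      show "\<forall>y\<in>#\<Lambda>2 (Suc r). cmp w a y \<longrightarrow> ?k \<le> y" by (auto simp: \<Lambda>2_def move_def single_def)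
    qed
    moreover have "move \<Lambda> r l a = swap_extra \<Lambda>2 (Suc r) ?k a"
      using False a by (auto simp: \<Lambda>2_def move_def swap_extra_def single_def fun_eq_iff)
    ultimately have "astep w (H2, \<alpha>, \<Lambda>2) None (H2, \<alpha>1, move \<Lambda> r l a)"
      using False \<alpha>1_def by (intro astep_extraI) auto
    with l1 False show ?thesis
      unfolding H1_def[symmetric] H2_def[symmetric] \<alpha>1_def[symmetric] \<Lambda>2_def[symmetric]
      by (intro diamondI1) (auto simp: grown_def)
  next
    case True
    have v2: "valid w (H2, \<alpha>, \<Lambda>2)"
      using lstep_valid[OF lstep_hookI[OF L refl refl refl] v] by (simp add: H2_def \<Lambda>2_def)
    have kk: "H (Suc (Suc r)) (Suc c) = \<infinity>" using tab_col_le[OF tab, of "Suc r" "Suc (Suc r)" "Suc c"] True by simp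
    define H3 where "H3 = set_hook H2 (Suc (Suc r)) (Suc c) a"
    have H2l: "H2 (Suc r) (Suc c) = l" and H2i: "H2 (Suc (Suc r)) (Suc c) = \<infinity>"
      using kk by (auto simp: H2_def set_hook_def)
    have \<Lambda>e: "\<Lambda>2 (Suc r) = {#}" "\<Lambda>2 (Suc (Suc r)) = {#}"
      using True sourceD(3)[OF sl] by (auto simp: \<Lambda>2_def move_def)
    \<comment> \<open>Leg first: the contested cell is new and contains only \<open>l\<close>, so
      \<open>a\<close> creates the cell above it.\<close>
    have A2: "hook_step w H2 \<alpha> \<Lambda>2 c a (Suc r)"
      using sa la H2l H2i \<Lambda>e a by (auto simp: hook_step_def slot_def intro: cmp_less)
    have "arms_ok w H2 \<alpha>" using v2 by simp
    from arms_okD(4)[OF this sourceD(1)[OF sa], of "Suc r"]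
    have c2: "cmp w (H2 (Suc (Suc r)) c) a" using H2l la by simp
    have "\<not> cmp (\<not> w) a x" if "x \<in># \<alpha> c - {#a#}" for x
      using source_rest[OF al sa that] cmp_not by blast
    \<comment> \<open>Arm first: \<open>a\<close> has been displaced into the legs of row
      \<open>r + 1\<close>, so leg bumping has not finished; one more bump brings \<open>a\<close>
      to the same cell above.\<close>
    then have "hook_step (\<not> w) (tp H2) (move \<Lambda> r l a) \<alpha>1 (Suc r) a c"
      using sourceD(3)[OF sl] c2 H2i a True
      by (auto simp: hook_step_def slot_def \<alpha>1_def move_def source_def single_def intro: cmp_less)
    then have "lstep w (H2, \<alpha>1, move \<Lambda> r l a) (Some (Suc (Suc r), Suc c)) (H3, \<alpha>1, \<Lambda>2)"
      apply (rule lstep_hookI)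
      using H2i True \<Lambda>e a by (auto simp: H3_def grown_def move_def \<Lambda>2_def fun_eq_iff single_def)
    moreover have "astep w (H2, \<alpha>, \<Lambda>2) (Some (Suc (Suc r), Suc c)) (H3, \<alpha>1, \<Lambda>2)"
      by (rule astep_hookI[OF A2]) (use H2i True in \<open>auto simp: H3_def grown_def \<alpha>1_def\<close>)
    ultimately show ?thesis
      using l1 True diamondI2 unfolding H1_def[symmetric] H2_def[symmetric] \<alpha>1_def[symmetric] \<Lambda>2_def[symmetric]
      by (metis grown_def)
  qed
qed

text \<open>The interesting case is \<open>k = l\<close> without a second copy. Arm first:
  \<open>a\<close> becomes the largest leg of row \<open>r\<close> and is bumped to the cell that
  \<open>l\<close> was heading for. Leg first: \<open>l\<close> becomes the hook there and
  \<open>a\<close> displaces it. Either way \<open>a\<close> ends as that hook and \<open>l\<close>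
  as an arm of column \<open>c + 1\<close>.\<close>

lemma diamond_extra_hook:
  assumes v: "valid w (H, \<alpha>, \<Lambda>)" and A: "extra_step w H \<alpha> \<Lambda> c a i k" and k: "k \<noteq> \<infinity>"
    and L: "hook_step (\<not> w) (tp H) \<Lambda> \<alpha> r l j"
  shows "diamond w (H, move \<alpha> c a k, swap_extra \<Lambda> i k a) None
     (set_hook H (Suc r) (Suc j) l, \<alpha>, move \<Lambda> r l (H (Suc r) (Suc j))) (grown H (Suc r) (Suc j))"
proof (cases "i \<noteq> r \<or> l \<in># \<Lambda> i - {#k#}")
  case True
  have ir: "i \<le> r" using A L by (metis extra_step_def hook_step_def source_def empty_iff leI set_mset_empty)
  note p = extra_hook_persist[OF v A L True]
  have kl: "k \<in># \<Lambda> i" "l \<in># \<Lambda> r" using A L by (auto simp: extra_step_def hook_step_def source_def)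
  have "move (swap_extra \<Lambda> i k a) r l (H (Suc r) (Suc j)) =
      swap_extra (move \<Lambda> r l (H (Suc r) (Suc j))) i k a"
  proof (cases "i = r")
    case True
    then have "l \<in># \<Lambda> i - {#k#}" using \<open>i \<noteq> r \<or> l \<in># \<Lambda> i - {#k#}\<close> by simp
    then have "add_mset a (\<Lambda> i - {#k#}) - {#l#} = add_mset a (\<Lambda> i - {#l#} - {#k#})"
      by (rule add_remove_swap)
    then show ?thesis using True by (auto simp: move_def swap_extra_def fun_eq_iff)
  next
    case False
    then show ?thesis using ir by (auto simp: move_def swap_extra_def fun_eq_iff)
  qed
  then show ?thesis
    using lstep_hookI[OF p(1) refl refl refl] astep_extraI[OF p(2) k refl refl]
    by (intro diamondI1) auto
next
  case False
  then have i: "i = r" and ln: "l \<notin># \<Lambda> r - {#k#}" by auto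
  have kl: "k = l"
  proof (rule ccontr)
    assume "k \<noteq> l"
    moreover have "l \<in># \<Lambda> r" using L by (simp add: hook_step_def source_def)
    ultimately show False using ln by (simp add: in_remove_neq)
  qed
  have A': "extra_step w H \<alpha> \<Lambda> c a r l" using A i kl by simp
  have tab: "tab w H" and al: "arms_ok w H \<alpha>" using v by auto
  have slL: "cmp w (H (Suc r) j) l" "cmp (\<not> w) l (H (Suc r) (Suc j))" and sl: "source \<Lambda> r l"
    using L by (auto simp: hook_step_def slot_def)
  have j: "j = c" using extra_last_col[OF v A' slL] .
  have sa: "source \<alpha> c a" and slA: "cmp (\<not> w) (H r (Suc c)) a" and la: "cmp w a l"
    and lb: "cmp w l (H r (Suc (Suc c)))"
    using A' by (auto simp: extra_step_def slot_def)
  have a: "a < \<infinity>" using arms_okD(3)[OF al sourceD(1)[OF sa]] .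
  let ?k = "H (Suc r) (Suc c)"
  have la': "\<not> cmp w a y" if "y \<in># \<Lambda> r - {#l#}" for y
  proof
    assume "cmp w a y"
    then have "l \<le> y" using A' that by (auto simp: extra_step_def dest: in_diffD)
    moreover have "y \<le> l" using sl that by (auto simp: source_def dest: in_diffD)
    ultimately show False using that ln kl by auto
  qed
  have "source (swap_extra \<Lambda> r l a) r a"
    using sl la' cmp_not cmp_le by (fastforce simp: source_def swap_extra_def)
  moreover have "cmp (\<not> w) a ?k" using cmp_less cmp_cmp_less[OF la slL(2)] j by simp
  moreover have "cmp w (H (Suc r) c) a" using arms_okD(4)[OF al sourceD(1)[OF sa] slA] .
  moreover have "\<not> cmp (\<not> w) a x" if "x \<in># move \<alpha> c a l c" for x
    using source_rest[OF al sa, of x] that cmp_not by (auto simp: move_def)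
  ultimately have L1: "hook_step (\<not> w) (tp H) (swap_extra \<Lambda> r l a) (move \<alpha> c a l) r a c"
    by (auto simp: hook_step_def slot_def)
  define H2 where "H2 = set_hook H (Suc r) (Suc c) l"
  define \<Lambda>2 where "\<Lambda>2 = move \<Lambda> r l ?k"
  have A2: "hook_step w H2 \<alpha> \<Lambda>2 c a r"
    using sa slA la la' by (auto simp: hook_step_def slot_def H2_def \<Lambda>2_def set_hook_def move_def)
  have "astep w (H2, \<alpha>, \<Lambda>2) None (set_hook H (Suc r) (Suc c) a, move \<alpha> c a l, \<Lambda>2)"
    by (rule astep_hookI[OF A2]) (use k kl in \<open>auto simp: H2_def set_hook_def grown_def fun_eq_iff\<close>)
  moreover have "lstep w (H, move \<alpha> c a l, swap_extra \<Lambda> r l a) (grown H (Suc r) (Suc c))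
      (set_hook H (Suc r) (Suc c) a, move \<alpha> c a l, \<Lambda>2)"
    by (rule lstep_hookI[OF L1]) (auto simp: \<Lambda>2_def move_def swap_extra_def fun_eq_iff)
  ultimately show ?thesis
    unfolding i kl j H2_def[symmetric] \<Lambda>2_def[symmetric] by (intro diamondI1) auto
qed

lemma diamond_hook_hook:
  assumes v: "valid w (H, \<alpha>, \<Lambda>)" and A: "hook_step w H \<alpha> \<Lambda> c a i"
    and L: "hook_step (\<not> w) (tp H) \<Lambda> \<alpha> r l j" and ne: "(i, c) \<noteq> (r, j)"
  shows "diamond w (set_hook H (Suc i) (Suc c) a, move \<alpha> c a (H (Suc i) (Suc c)), \<Lambda>) (grown H (Suc i) (Suc c))
     (set_hook H (Suc r) (Suc j) l, \<alpha>, move \<Lambda> r l (H (Suc r) (Suc j))) (grown H (Suc r) (Suc j))"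
proof -
  have v': "valid (\<not> w) (tp H, \<Lambda>, \<alpha>)" using valid_tr[OF v] by simp
  have A': "hook_step (\<not> \<not> w) (tp (tp H)) \<alpha> \<Lambda> c a i" using A by simp
  have ne': "(j, r) \<noteq> (c, i)" using ne by auto
  note L1 = hook_hook_persist[OF v A L ne]
  note A1 = hook_hook_persist[OF v' L A' ne']
  have e: "set_hook H (Suc i) (Suc c) a (Suc r) (Suc j) = H (Suc r) (Suc j)"
    "set_hook H (Suc r) (Suc j) l (Suc i) (Suc c) = H (Suc i) (Suc c)"
    "grown (set_hook H (Suc i) (Suc c) a) (Suc r) (Suc j) = grown H (Suc r) (Suc j)"
    "grown (set_hook H (Suc r) (Suc j) l) (Suc i) (Suc c) = grown H (Suc i) (Suc c)"
    using ne by (auto simp: set_hook_def grown_def)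
  have A2: "hook_step w (set_hook H (Suc r) (Suc j) l) \<alpha> (move \<Lambda> r l (H (Suc r) (Suc j))) c a i"
    using A1 by (simp add: tp_set_hook)
  have comm: "set_hook (set_hook H (Suc i) (Suc c) a) (Suc r) (Suc j) l =
      set_hook (set_hook H (Suc r) (Suc j) l) (Suc i) (Suc c) a"
    using ne by (auto simp: set_hook_def fun_eq_iff)
  show ?thesis
  proof (rule diamondI1)
    show "grown H (Suc i) (Suc c) = None \<or> grown H (Suc i) (Suc c) \<noteq> grown H (Suc r) (Suc j)"
      using ne by (auto simp: grown_def)
    show "lstep w (set_hook H (Suc i) (Suc c) a, move \<alpha> c a (H (Suc i) (Suc c)), \<Lambda>) (grown H (Suc r) (Suc j))
      (set_hook (set_hook H (Suc i) (Suc c) a) (Suc r) (Suc j) l, move \<alpha> c a (H (Suc i) (Suc c)), move \<Lambda> r l (H (Suc r) (Suc j)))"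
      by (rule lstep_hookI[OF L1]) (auto simp: e)
    show "astep w (set_hook H (Suc r) (Suc j) l, \<alpha>, move \<Lambda> r l (H (Suc r) (Suc j))) (grown H (Suc i) (Suc c))
      (set_hook (set_hook H (Suc i) (Suc c) a) (Suc r) (Suc j) l, move \<alpha> c a (H (Suc i) (Suc c)), move \<Lambda> r l (H (Suc r) (Suc j)))"
      by (rule astep_hookI[OF A2]) (simp_all add: e comm)
  qed
qed

text \<open>The steps cannot compete for the same copy of a leg: if \<open>k = l\<close>, then
  \<open>j = c\<close>, and now \<open>m\<close> is at most \<open>a\<close>, \<open>a\<close> at
  most \<open>l\<close> and \<open>l\<close> at most \<open>m\<close>, one of the last two strictly.
  By transposition they do not compete for an arm either, so both steps persist.\<close>

lemma diamond_extra_extra: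
  assumes v: "valid w (H, \<alpha>, \<Lambda>)" and A: "extra_step w H \<alpha> \<Lambda> c a i k" and k: "k \<noteq> \<infinity>"
    and L: "extra_step (\<not> w) (tp H) \<Lambda> \<alpha> r l j m" and m: "m \<noteq> \<infinity>"
  shows "diamond w (H, move \<alpha> c a k, swap_extra \<Lambda> i k a) None
     (H, swap_extra \<alpha> j m l, move \<Lambda> r l m) None"
proof -
  have aux: "i \<noteq> r \<or> l \<in># \<Lambda> i - {#k#}"
    if v: "valid w (H, \<alpha>, \<Lambda>)" and A: "extra_step w H \<alpha> \<Lambda> c a i k" and
      L: "extra_step (\<not> w) (tp H) \<Lambda> \<alpha> r l j m" for w H \<alpha> \<Lambda> c a i k r l j m
  proof (rule ccontr)
    assume "\<not> ?thesis"
    then have i: "i = r" and ln: "l \<notin># \<Lambda> r - {#k#}" by auto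
    have kl: "k = l"
    proof (rule ccontr)
      assume "k \<noteq> l"
      moreover have "l \<in># \<Lambda> r" using L by (simp add: extra_step_def source_def)
      ultimately show False using ln by (simp add: in_remove_neq)
    qed
    have "j = c" using extra_last_col[OF v, of c a r l j] A L i kl by (auto simp: extra_step_def slot_def)
    then have "m \<le> a" "cmp w a l" "cmp (\<not> w) l m" using A L kl by (auto simp: extra_step_def source_def)
    then show False using cmp_cmp_less leD by blast
  qed
  have v': "valid (\<not> w) (tp H, \<Lambda>, \<alpha>)" using valid_tr[OF v] by simp
  have A': "extra_step (\<not> \<not> w) (tp (tp H)) \<alpha> \<Lambda> c a i k" using A by simp
  have aux2: "extra_step (\<not> w) (tp H) (swap_extra \<Lambda> i k a) (move \<alpha> c a k) r l j m"
    "move (swap_extra \<Lambda> i k a) r l m = swap_extra (move \<Lambda> r l m) i k a"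
    if v: "valid w (H, \<alpha>, \<Lambda>)" and A: "extra_step w H \<alpha> \<Lambda> c a i k" and
      L: "extra_step (\<not> w) (tp H) \<Lambda> \<alpha> r l j m"
      and n1: "i \<noteq> r \<or> l \<in># \<Lambda> i - {#k#}" and n2: "j \<noteq> c \<or> a \<in># \<alpha> j - {#m#}"
    for w H \<alpha> \<Lambda> c a i k r l j m
  proof -
    have ir: "i \<le> r" using A L by (metis extra_step_def source_def empty_iff leI set_mset_empty)
    have jc: "j \<le> c" using A L by (metis extra_step_def source_def empty_iff leI set_mset_empty)
    have s: "source \<Lambda> r l" using L by (simp add: extra_step_def)
    have al: "a \<le> l" if "i = r"
      using A s that order_trans[of a k l] by (auto simp: extra_step_def source_def dest: cmp_le)
    have "source (swap_extra \<Lambda> i k a) r l"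
      using s al n1 ir unfolding source_def swap_extra_def
      by (auto split: if_splits dest: in_diffD)
    moreover have "m \<in># move \<alpha> c a k j"
    proof (cases "j = c")
      case True
      then have "m \<in># \<alpha> j - {#a#}" using L n2
        unfolding extra_step_def by (blast intro: in_remove_swap)
      then show ?thesis using True by (simp add: move_def)
    next
      case False
      then show ?thesis using L jc by (simp add: move_def extra_step_def)
    qed
    moreover have "y \<in># \<alpha> j" if "y \<in># move \<alpha> c a k j" for y
      using that jc by (auto simp: move_def split: if_splits dest: in_diffD)
    ultimately show "extra_step (\<not> w) (tp H) (swap_extra \<Lambda> i k a) (move \<alpha> c a k) r l j m"
      using L by (auto simp: extra_step_def)
    show "move (swap_extra \<Lambda> i k a) r l m = swap_extra (move \<Lambda> r l m) i k a"
    proof (cases "i = r")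
      case True
      then have "l \<in># \<Lambda> i - {#k#}" using n1 by simp
      then have "add_mset a (\<Lambda> i - {#k#}) - {#l#} = add_mset a (\<Lambda> i - {#l#} - {#k#})"
        by (rule add_remove_swap)
      then show ?thesis using True by (auto simp: move_def swap_extra_def fun_eq_iff)
    next
      case False
      then show ?thesis using ir by (auto simp: move_def swap_extra_def fun_eq_iff)
    qed
  qed
  have n1: "i \<noteq> r \<or> l \<in># \<Lambda> i - {#k#}" using aux[OF v A L] .
  have n2: "j \<noteq> c \<or> a \<in># \<alpha> j - {#m#}" using aux[OF v' L A'] .
  note p = aux2[OF v A L n1 n2] and q = aux2[OF v' L A' n2 n1]
  show ?thesis
    using lstep_extraI[OF p(1) m refl refl] astep_extraI[of w H "swap_extra \<alpha> j m l" "move \<Lambda> r l m" c a i k, OF _ k refl refl] q p(2)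
    by (intro diamondI1) auto
qed

lemma diamond:
  assumes v: "valid w s" and A: "astep w s g1 s1" and L: "lstep w s g2 s2"
  shows "diamond w s1 g1 s2 g2"
proof -
  obtain H \<alpha> \<Lambda> where s: "s = (H, \<alpha>, \<Lambda>)" by (cases s)
  note v' = v[unfolded s] and A' = A[unfolded s] and L' = L[unfolded s]
  have vt: "valid (\<not> w) (tp H, \<Lambda>, \<alpha>)" using valid_tr[OF v'] by simp
  show ?thesis
    using A' v'
  proof (cases rule: astepE)
    case a: (hook c a i)
    have at: "hook_step (\<not> \<not> w) (tp (tp H)) \<alpha> \<Lambda> c a i" using a by simp
    show ?thesis using L' v'
    proof (cases rule: lstepE)
      case l: (hook r l j)
      show ?thesis
      proof (cases "(i, c) = (r, j)")
        case False
        then show ?thesis using diamond_hook_hook[OF v' a(1) l(1)] a l by simp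
      next
        case True
        show ?thesis
        proof (cases "cmp (\<not> w) l a")
          case c: True
          then show ?thesis using diamond_same_cell[OF v' _ _ c] a l True by simp
        next
          case False
          then have c: "cmp (\<not> \<not> w) a l" using cmp_not by auto
          show ?thesis
            by (rule diamond_tr)
              (use diamond_same_cell[OF vt _ _ c] a l True in \<open>simp add: tp_set_hook swap_grown\<close>)
        qed
      qed
    next
      case l: (extra r l j k)
      show ?thesis
        by (rule diamond_tr)
          (use diamond_extra_hook[OF vt l(1,3) at] a l in \<open>simp add: tp_set_hook swap_grown\<close>)
    qed
  next
    case a: (extra c a i k)
    show ?thesis using L' v'
    proof (cases rule: lstepE)
      case l: (hook r l j)
      then show ?thesis using diamond_extra_hook[OF v' a(1,3) l(1)] a l by simp
    next
      case l: (extra r l j m)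
      then show ?thesis using diamond_extra_extra[OF v' a(1,3) l(1,3)] a l by simp
    qed
  qed
qed

section \<open>Runs of bumps and their confluence\<close>

inductive arun :: "bool \<Rightarrow> state \<Rightarrow> cell \<Rightarrow> state \<Rightarrow> bool" for w where
  last: "astep w s (Some x) s' \<Longrightarrow> arun w s x s'"
| step: "astep w s None s1 \<Longrightarrow> arun w s1 x s' \<Longrightarrow> arun w s x s'"

inductive lrun :: "bool \<Rightarrow> state \<Rightarrow> cell \<Rightarrow> state \<Rightarrow> bool" for w where
  last: "lstep w s x' s' \<Longrightarrow> x' = Some x \<Longrightarrow> lrun w s x s'"
| step: "lstep w s None s1 \<Longrightarrow> lrun w s1 x s' \<Longrightarrow> lrun w s x s'"

lemma arun_tr: "arun w s x s' \<Longrightarrow> lrun (\<not> w) (tr s) (prod.swap x) (tr s')"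
proof (induction rule: arun.induct)
  case (last s x s')
  then show ?case by (intro lrun.last[OF _ refl]) (simp add: lstep_tr)
next
  case (step s s1 x s')
  then show ?case by (intro lrun.step[of "\<not> w" "tr s" "tr s1"]) (simp_all add: lstep_tr)
qed

lemma lrun_tr: "lrun w s x s' \<Longrightarrow> arun (\<not> w) (tr s) (prod.swap x) (tr s')"
proof (induction rule: lrun.induct)
  case (last s x' s' x)
  then show ?case by (intro arun.last) (simp add: lstep_def)
next
  case (step s s1 x s')
  then show ?case by (intro arun.step[of "\<not> w" "tr s" "tr s1"]) (simp_all add: lstep_def)
qed

lemma arun_valid: "arun w s x s' \<Longrightarrow> valid w s \<Longrightarrow> valid w s'"
  by (induction rule: arun.induct) (auto intro: astep_valid)

lemma lrun_valid: "lrun w s x s' \<Longrightarrow> valid w s \<Longrightarrow> valid w s'"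
  by (induction rule: lrun.induct) (auto intro: lstep_valid)

text \<open>As in the strip lemma of rewriting, one arm step is pushed through a whole leg run. Only
  the last leg step can collide, since the earlier ones create no cell. The collision either
  prolongs the leg run by one bump or turns the arm step into a run of two bumps.\<close>

lemma strip:
  assumes "lrun w s y s2" "astep w s g s1" "valid w s"
  shows "(\<exists>s3. lrun w s1 y s3 \<and> astep w s2 g s3) \<and> g \<noteq> Some y \<or>
    g = Some y \<and> (\<exists>s3. lrun w s1 (above y) s3 \<and> astep w s2 (Some (above y)) s3 \<or>
      lrun w s1 (right_of y) s3 \<and> arun w s2 (right_of y) s3)"
  using assms
proof (induction arbitrary: s1 rule: lrun.induct)
  case (last s y' s2 y)
  from diamond[OF last(4,3,1)] show ?case
    unfolding diamond_def last(2)
  proof (elim disjE conjE exE, goal_cases)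
    case (3 i j s3 s4)
    have "lrun w s1 (above y) s4"
      using 3 by (intro lrun.step[OF 3(3)] lrun.last[OF 3(4)]) auto
    with 3 show ?case by (intro disjI2 conjI exI[of _ s4] disjI1) auto
  next
    case (4 i j s3 s4)
    have "arun w s2 (right_of y) s4"
      using 4 by (intro arun.step[OF 4(3)] arun.last) auto
    moreover have "lrun w s1 (right_of y) s4"
      using 4 by (intro lrun.last[OF 4(5)]) auto
    ultimately show ?case using 4 by (intro disjI2 conjI exI[of _ s4]) auto
  qed (auto intro: lrun.last)
next
  case (step s s' y s2)
  from diamond[OF step(5,4,1)] obtain s3 where s3: "lstep w s1 None s3" "astep w s' g s3"
    unfolding diamond_def by auto
  from step.IH[OF s3(2) lstep_valid[OF step(1,5)]] s3(1) show ?case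
    by (meson lrun.step)
qed

text \<open>Here \<open>x'\<close> and \<open>y'\<close> are the cells created when the respective
  run acts in second place.\<close>

definition meet :: "cell \<Rightarrow> cell \<Rightarrow> cell \<Rightarrow> cell \<Rightarrow> bool" where
  "meet x y x' y' \<longleftrightarrow> x \<noteq> y \<and> x' = x \<and> y' = y \<or> x = y \<and> x' = y' \<and> (x' = above x \<or> x' = right_of x)"

text \<open>Strips are stacked along the arm run; its steps before the last create no cell, so again
  only the last can collide.\<close>

lemma run_commute:
  assumes "arun w s x s1" "lrun w s y s2" "valid w s"
  shows "\<exists>s3 x' y'. meet x y x' y' \<and> lrun w s1 y' s3 \<and> arun w s2 x' s3"
  using assms
proof (induction arbitrary: s2 rule: arun.induct)
  case (last s x s1)
  from strip[OF last(2,1,3)] show ?case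
    unfolding meet_def using arun.last by blast
next
  case (step s s' x s1)
  from strip[OF step(4,1,5)] obtain s3 where s3: "lrun w s' y s3" "astep w s2 None s3" by auto
  from step.IH[OF s3(1) astep_valid[OF step(1,5)]] s3(2) show ?case
    by (meson arun.step)
qed

section \<open>Existence and net effect of a run\<close>

definition bump_col :: "state \<Rightarrow> nat \<Rightarrow> enat \<Rightarrow> bool" where
  "bump_col s c a \<longleftrightarrow> source (fst (snd s)) c a"

lemma bump_col_simp [simp]: "bump_col (H, \<alpha>, \<Lambda>) c a \<longleftrightarrow> source \<alpha> c a"
  by (simp add: bump_col_def)

text \<open>A finite displaced \<open>k\<close> is alone in column \<open>c + 1\<close> and thus is
  the next source: a run advances one column per step until \<infinity> is displaced.\<close>

lemma astep_col:
  assumes "astep w s g s'" "valid w s" "bump_col s c a"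
  shows "\<exists>k. fst (snd s') = move (fst (snd s)) c a k \<and>
    (if k = \<infinity> then \<exists>i. g = Some (i, Suc c) \<and> 0 < i else g = None \<and> bump_col s' (Suc c) k)"
proof -
  obtain H \<alpha> \<Lambda> where s: "s = (H, \<alpha>, \<Lambda>)" by (cases s)
  show ?thesis
    using assms(1,2)[unfolded s]
  proof (cases rule: astepE)
    case (hook c' a' i)
    then have "c' = c" "a' = a" using source_unique assms(3) by (auto simp: s hook_step_def)
    then show ?thesis using hook assms(3)
      by (intro exI[of _ "H (Suc i) (Suc c)"]) (auto simp: s grown_def move_def single_def source_def)
  next
    case (extra c' a' i k)
    then have "c' = c" "a' = a" using source_unique assms(3) by (auto simp: s extra_step_def)
    then show ?thesis using extra assms(3)
      by (intro exI[of _ k]) (auto simp: s move_def single_def source_def)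
  qed
qed

text \<open>Each intermediate arm is taken away again by the following step, so the run as a whole
  just deletes \<open>a\<close>.\<close>

lemma arun_col:
  assumes "arun w s x s'" "valid w s" "bump_col s c a"
  shows "c < snd x \<and> 0 < fst x \<and> fst (snd s') = (fst (snd s))(c := fst (snd s) c - {#a#})"
  using assms
proof (induction arbitrary: c a rule: arun.induct)
  case (last s x s')
  from astep_col[OF last(1-3)] last(3) show ?case
    by (fastforce simp: move_def bump_col_def source_def split: if_splits)
next
  case (step s s1 x s')
  from astep_col[OF step(1,4,5)] obtain k where k: "k \<noteq> \<infinity>" "bump_col s1 (Suc c) k"
      "fst (snd s1) = move (fst (snd s)) c a k"
    by (auto split: if_splits)
  from step.IH[OF astep_valid[OF step(1,4)] k(2)] k step(5) show ?case
    by (fastforce simp: move_def single_def bump_col_def source_def)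
qed

text \<open>A leg step at most exchanges the value of an arm. Hence the index that a later
  \<open>A\<close> records does not depend on the \<open>L\<close> before it.\<close>

lemma lstep_sizes:
  assumes "lstep w s g s'" "valid w s"
  shows "size (fst (snd s') j) = size (fst (snd s) j)"
proof -
  obtain H \<alpha> \<Lambda> where s: "s = (H, \<alpha>, \<Lambda>)" by (cases s)
  show ?thesis
    using assms[unfolded s]
  proof (cases rule: lstepE)
    case (extra r l j k)
    then have "k \<in># \<alpha> j" by (simp add: extra_step_def)
    then show ?thesis using extra
      by (auto simp: s swap_extra_def size_Suc_Diff1)
  qed (auto simp: s)
qed

lemma lrun_sizes:
  assumes "lrun w s x s'" "valid w s"
  shows "size (fst (snd s') j) = size (fst (snd s) j)"
  using assms by (induction rule: lrun.induct) (auto simp: lstep_sizes dest: lstep_valid)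

lemma arms_col_bound:
  assumes "tab w H" "arms_ok w H \<alpha>" "x \<in># \<alpha> c"
  shows "(1, c) \<in> {(i, j). 0 < i \<and> 0 < j \<and> H i j \<noteq> \<infinity>}"
  using arms_okD(1)[OF assms(2,3)] le_finite[OF cmp_le[OF arms_first[OF assms]]] arms_okD(3)[OF assms(2,3)]
  by simp

lemma source_exists:
  assumes "valid w (H, \<alpha>, \<Lambda>)" "\<alpha> c \<noteq> {#}"
  shows "\<exists>c a. source \<alpha> c a"
proof -
  let ?C = "{c. \<alpha> c \<noteq> {#}}"
  have "?C \<subseteq> snd ` {(i, j). 0 < i \<and> 0 < j \<and> H i j \<noteq> \<infinity>}"
  proof
    fix c assume "c \<in> ?C"
    then obtain x where x: "x \<in># \<alpha> c" using multiset_nonemptyE by blast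
    have c1: "(1, c) \<in> {(i, j). 0 < i \<and> 0 < j \<and> H i j \<noteq> \<infinity>}"
      by (rule arms_col_bound[of w H \<alpha> x c, OF _ _ x]) (use assms(1) in simp_all)
    show "c \<in> snd ` {(i, j). 0 < i \<and> 0 < j \<and> H i j \<noteq> \<infinity>}"
      by (rule rev_image_eqI[OF c1]) simp
  qed
  moreover have "finite (snd ` {(i, j). 0 < i \<and> 0 < j \<and> H i j \<noteq> \<infinity>})"
    using assms(1) unfolding valid.simps by (blast intro: finite_imageI[OF tab_finite])
  ultimately have f: "finite ?C" using finite_subset by blast
  define m where "m = Max ?C"
  have "m \<in> ?C" using Max_in[OF f] assms(2) unfolding m_def by blast
  moreover have "\<alpha> j = {#}" if "m < j" for j
    using Max_ge[OF f, of j] that unfolding m_def[symmetric] by (meson leD mem_Collect_eq)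
  ultimately show ?thesis
    by (intro exI[of _ m] exI[of _ "Max_mset (\<alpha> m)"]) (auto simp: source_def)
qed

lemma astep_exists:
  assumes v: "valid w (H, \<alpha>, \<Lambda>)" and s: "source \<alpha> c a"
  shows "\<exists>g s'. astep w (H, \<alpha>, \<Lambda>) g s'"
proof -
  have tab: "tab w H" and al: "arms_ok w H \<alpha>" and la: "arms_ok (\<not> w) (tp H) \<Lambda>" using v by auto
  obtain i where i: "slot w H i c a"
    using slot_exists[OF tab] arms_okD[OF al sourceD(1)[OF s]] by blast
  let ?C = "{y \<in> set_mset (\<Lambda> i). cmp w a y \<and> cmp w y (H i (Suc (Suc c)))}"
  show ?thesis
  proof (cases "?C = {}")
    case True
    then have "\<forall>y\<in>#\<Lambda> i. cmp w a y \<longrightarrow> cmp (\<not> w) (H i (Suc (Suc c))) y"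
      using cmp_not by blast
    then have "hook_step w H \<alpha> \<Lambda> c a i" using s i by (simp add: hook_step_def)
    then show ?thesis using astep_hookI by blast
  next
    case False
    define k where "k = Min ?C"
    have k: "k \<in> ?C" using False Min_in[of ?C] by (auto simp: k_def)
    have "k \<le> y" if "y \<in># \<Lambda> i" "cmp w a y" for y
    proof (cases "y \<in> ?C")
      case True
      then show ?thesis by (simp add: k_def)
    next
      case False
      then have "cmp (\<not> w) (H i (Suc (Suc c))) y" using that cmp_not by blast
      then have "k < y" using k cmp_cmp_less by blast
      then show ?thesis by simp
    qed
    then have "extra_step w H \<alpha> \<Lambda> c a i k" using s i k by (auto simp: extra_step_def)
    moreover have "k \<noteq> \<infinity>" using arms_okD(3)[OF la, of k i] k by auto
    ultimately show ?thesis using astep_extraI by blast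
  qed
qed

text \<open>The measure is the distance from the current column to the last column
  \<open>B s\<close> of the shape. The shape is constant while no cell is created, and a column with
  an arm meets it in row 1.\<close>

lemma arun_exists:
  assumes "valid w s" "bump_col s c a"
  shows "\<exists>x s'. arun w s x s'"
proof -
  define B where "B s = Max (snd ` {(i, j). 0 < i \<and> 0 < j \<and> fst s i j \<noteq> \<infinity>})" for s :: state
  have bd: "c \<le> B s" if "valid w s" "bump_col s c a" for s c a
  proof -
    obtain H \<alpha> \<Lambda> where s: "s = (H, \<alpha>, \<Lambda>)" by (cases s)
    have c1: "(1, c) \<in> {(i, j). 0 < i \<and> 0 < j \<and> H i j \<noteq> \<infinity>}"
      by (rule arms_col_bound[of w _ \<alpha> a]) (use that in \<open>simp_all add: s sourceD(1)\<close>)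
    have "c \<in> snd ` {(i, j). 0 < i \<and> 0 < j \<and> H i j \<noteq> \<infinity>}"
      by (rule rev_image_eqI[OF c1]) simp
    moreover have "finite (snd ` {(i, j). 0 < i \<and> 0 < j \<and> H i j \<noteq> \<infinity>})"
      using that(1) unfolding s valid.simps by (blast intro: finite_imageI[OF tab_finite])
    ultimately show ?thesis unfolding B_def s by (simp only: fst_conv Max_ge)
  qed
  have fin: "astep w s None s' \<Longrightarrow> valid w s \<Longrightarrow> fst s' i j = \<infinity> \<longleftrightarrow> fst s i j = \<infinity>" for s s' i j
  proof -
    assume a: "astep w s None s'" "valid w s"
    obtain H \<alpha> \<Lambda> where s: "s = (H, \<alpha>, \<Lambda>)" by (cases s)
    show ?thesis
      using a[unfolded s]
    proof (cases rule: astepE)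
      case (hook c a i)
      have "a \<in># \<alpha> c" using hook(1) by (simp add: hook_step_def source_def)
      moreover have "arms_ok w H \<alpha>" using a(2) by (simp add: s)
      ultimately have "a < \<infinity>" using arms_okD(3) by blast
      then show ?thesis using hook by (auto simp: s grown_def set_hook_def split: if_splits)
    qed (auto simp: s)
  qed
  show ?thesis
    using assms
  proof (induction "B s - c" arbitrary: s c a rule: less_induct)
    case less
    obtain H \<alpha> \<Lambda> where s: "s = (H, \<alpha>, \<Lambda>)" by (cases s)
    obtain g s' where g: "astep w s g s'" using astep_exists[of w H \<alpha> \<Lambda> c a] less.prems unfolding s bump_col_simp by blast
    show ?case
    proof (cases g)
      case (Some x)
      then show ?thesis using g arun.last by blast
    next
      case None
      then obtain k where k: "bump_col s' (Suc c) k"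
        using astep_col[OF g less.prems] by (auto split: if_splits)
      have v': "valid w s'" using astep_valid[OF g less.prems(1)] .
      have "B s' = B s" unfolding B_def fin[OF g[unfolded None] less.prems(1)] ..
      moreover have "Suc c \<le> B s'" using bd[OF v' k] .
      ultimately have "B s' - Suc c < B s - c" by simp
      from less.hyps[OF this v' k] show ?thesis using g None arun.step by blast
    qed
  qed
qed

section \<open>Successive runs from one column\<close>

text \<open>
  Entries that stay in a column: the arms that pass through a column during one run block a later
  run with smaller arms, so that the latter ends strictly further to the right.
\<close>

definition present :: "bool \<Rightarrow> state \<Rightarrow> nat \<Rightarrow> enat \<Rightarrow> bool" where
  "present w s j x \<longleftrightarrow> (case s of (H, \<alpha>, \<Lambda>) \<Rightarrow> x \<noteq> \<infinity> \<and>
     ((\<exists>i>0. H i j = x) \<or> (\<exists>i. x \<in># \<Lambda> i \<and> cmp (\<not> w) (H i j) x \<and> cmp w x (H i (Suc j)))))"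

text \<open>A bump takes the least entry of the next column that \<open>a\<close> may replace; a
  known candidate \<open>x\<close> therefore bounds what is displaced and rules out a new
  cell.\<close>

lemma bump_le_present:
  assumes v: "valid w (H, \<alpha>, \<Lambda>)" and A: "astep w (H, \<alpha>, \<Lambda>) g s'" and s: "source \<alpha> c a"
    and p: "present w (H, \<alpha>, \<Lambda>) (Suc c) x" and ax: "cmp w a x"
  shows "\<exists>k\<le>x. g = None \<and> bump_col s' (Suc c) k"
proof -
  have tab: "tab w H" and la: "arms_ok (\<not> w) (tp H) \<Lambda>" using v by auto
  \<comment> \<open>A candidate cannot lie under the slot: it is a leg of the slot cell or not below
    the hook over it.\<close>
  have low: "H (Suc i) (Suc c) \<le> x \<or> x \<in># \<Lambda> i \<and> cmp w x (H i (Suc (Suc c)))"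
    if sl: "slot w H i c a" for i
  proof -
    have no: "\<not> x \<le> H i (Suc c)"
      using slotD(1)[OF sl] ax le_cmp_trans cmp_not by blast
    from p consider (hook) i' where "0 < i'" "H i' (Suc c) = x"
      | (leg) i' where "x \<in># \<Lambda> i'" "cmp (\<not> w) (H i' (Suc c)) x" "cmp w x (H i' (Suc (Suc c)))"
      by (auto simp: present_def)
    then show ?thesis
    proof cases
      case hook
      then have "\<not> i' \<le> i" using no tab_col_le[OF tab, of i' i "Suc c"] by blast
      then show ?thesis using hook tab_col_le[OF tab, of "Suc i" i' "Suc c"] by simp
    next
      case leg
      have "\<not> cmp (\<not> w) (tp H (Suc (Suc c)) i') x" using leg cmp_not by auto
      then have "\<not> cmp (\<not> \<not> w) (tp H (Suc c) (Suc i')) x" using arms_okD(4)[OF la leg(1)] by blast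
      then have "x \<le> H (Suc i') (Suc c)" using cmp_not cmp_le by auto
      then have "\<not> i' < i" using no tab_col_le[OF tab, of "Suc i'" i "Suc c"] order_trans by fastforce
      then consider "i' = i" | "Suc i \<le> i'" by linarith
      then show ?thesis
      proof cases
        case 2
        then show ?thesis using tab_col_le[OF tab 2, of "Suc c"] cmp_le[OF leg(2)] order_trans by blast
      qed (use leg in simp)
    qed
  qed
  have x: "x \<noteq> \<infinity>" using p by (simp add: present_def)
  from A v show ?thesis
  proof (cases rule: astepE)
    case (hook c' a' i)
    have [simp]: "c' = c" "a' = a" using source_unique s hook(1) by (auto simp: hook_step_def)
    have "\<not> (x \<in># \<Lambda> i \<and> cmp w x (H i (Suc (Suc c))))"
      using hook(1) ax cmp_not by (simp add: hook_step_def)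
    moreover have "slot w H i c a" using hook(1) by (simp add: hook_step_def)
    ultimately have le: "H (Suc i) (Suc c) \<le> x" using low by blast
    then have fin: "H (Suc i) (Suc c) \<noteq> \<infinity>" using x le_finite by blast
    then have "bump_col s' (Suc c) (H (Suc i) (Suc c))" "g = None"
      using hook(2,3) s by (simp_all add: grown_def source_def move_def single_finite)
    then show ?thesis using le by blast
  next
    case (extra c' a' i k)
    have [simp]: "c' = c" "a' = a" using source_unique s extra(1) by (auto simp: extra_step_def)
    have "k \<le> x"
    proof -
      have "slot w H i c a" using extra(1) by (simp add: extra_step_def)
      from low[OF this] show ?thesis
      proof
        assume "H (Suc i) (Suc c) \<le> x"
        then show ?thesis using cmp_le[OF extra_bound[OF v, of c a i k]] extra(1) order_trans by fastforce
      next
        assume "x \<in># \<Lambda> i \<and> cmp w x (H i (Suc (Suc c)))"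
        then show ?thesis using extra(1) ax by (simp add: extra_step_def)
      qed
    qed
    moreover have "bump_col s' (Suc c) k"
      using extra(3,4) s by (simp add: source_def move_def single_finite)
    ultimately show ?thesis using extra(2) by blast
  qed
qed

lemma present_new:
  assumes v: "valid w (H, \<alpha>, \<Lambda>)" and A: "astep w (H, \<alpha>, \<Lambda>) g s'" and s: "source \<alpha> c a"
  shows "present w s' (Suc c) a"
proof -
  have "a \<noteq> \<infinity>" using arms_okD(3)[of w H \<alpha> a c] sourceD(1)[OF s] v by auto
  from A v show ?thesis
  proof (cases rule: astepE)
    case (hook c' a' i)
    have [simp]: "c' = c" "a' = a" using source_unique s hook(1) by (auto simp: hook_step_def)
    show ?thesis using \<open>a \<noteq> \<infinity>\<close> hook(3) by (auto simp: present_def set_hook_def)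
  next
    case (extra c' a' i k)
    have [simp]: "c' = c" "a' = a" using source_unique s extra(1) by (auto simp: extra_step_def)
    have "cmp w a k" "cmp w k (H i (Suc (Suc c)))" using extra(1) by (auto simp: extra_step_def)
    then have "cmp w a (H i (Suc (Suc c)))" by (rule cmp_trans)
    then show ?thesis using \<open>a \<noteq> \<infinity>\<close> extra
      by (auto simp: present_def swap_extra_def extra_step_def slot_def)
  qed
qed

lemma present_stays:
  assumes v: "valid w (H, \<alpha>, \<Lambda>)" and A: "astep w (H, \<alpha>, \<Lambda>) g s'" and s: "source \<alpha> c a"
    and p: "present w (H, \<alpha>, \<Lambda>) j x" and j: "j < c \<or> j = c \<and> cmp w x a \<or> Suc c < j"
  shows "present w s' j x"
  using A v
proof (cases rule: astepE)
  case (hook c' a' i)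
  have [simp]: "c' = c" "a' = a" using source_unique s hook(1) by (auto simp: hook_step_def)
  define H' where "H' = set_hook H (Suc i) (Suc c) a"
  have H': "H' i' j = H i' j" for i' using j by (auto simp: H'_def set_hook_def)
  have "cmp w x (H' i' (Suc j))" if "cmp w x (H i' (Suc j))" for i'
    using that j by (cases "j = c \<and> i' = Suc i") (auto simp: H'_def set_hook_def)
  then show ?thesis using p unfolding hook(3) \<open>c' = c\<close> \<open>a' = a\<close> H'_def[symmetric] present_def prod.case H'
    by blast
next
  case (extra c' a' i k)
  have [simp]: "c' = c" "a' = a" using source_unique s extra(1) by (auto simp: extra_step_def)
  have tab: "tab w H" using v by simp
  have E: "cmp (\<not> w) (H i (Suc c)) a" "cmp w a k" "cmp w k (H i (Suc (Suc c)))"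
    using extra(1) by (auto simp: extra_step_def slot_def)
  \<comment> \<open>The displaced leg \<open>k\<close> is located in column \<open>c + 1\<close>, so
    it is not the leg that is present in column \<open>j\<close>.\<close>
  have "\<not> (cmp (\<not> w) (H i j) k \<and> cmp w k (H i (Suc j)))"
  proof
    assume *: "cmp (\<not> w) (H i j) k \<and> cmp w k (H i (Suc j))"
    show False
    proof (cases "j \<le> c")
      case True
      then have "H i (Suc j) \<le> H i (Suc c)" using tab_row_le[OF tab] by simp
      then have "k \<le> H i (Suc c)" using * cmp_le order_trans by blast
      then show False using le_cmp_trans[OF _ E(1)] E(2) cmp_not[of w a k] by simp
    next
      case False
      then have "H i (Suc (Suc c)) \<le> H i j" using j tab_row_le[OF tab] by simp
      then show False using cmp_le_trans[OF E(3)] * cmp_not[of w k "H i j"] by simp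
    qed
  qed
  then have "x \<in># swap_extra \<Lambda> i k a i'"
    if "x \<in># \<Lambda> i'" "cmp (\<not> w) (H i' j) x" "cmp w x (H i' (Suc j))" for i'
    using that by (cases "x = k") (auto simp: swap_extra_def in_remove_neq)
  then show ?thesis using p unfolding extra(4) \<open>c' = c\<close> \<open>a' = a\<close> present_def prod.case by blast
qed

lemma present_new': "valid w s \<Longrightarrow> astep w s g s' \<Longrightarrow> bump_col s c a \<Longrightarrow> present w s' (Suc c) a"
  using present_new[of w "fst s" "fst (snd s)" "snd (snd s)"] by (simp add: bump_col_def)

lemma present_stays': "valid w s \<Longrightarrow> astep w s g s' \<Longrightarrow> bump_col s c a \<Longrightarrow> present w s j x \<Longrightarrow>
    j < c \<or> j = c \<and> cmp w x a \<or> Suc c < j \<Longrightarrow> present w s' j x"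
  using present_stays[of w "fst s" "fst (snd s)" "snd (snd s)"] by (simp add: bump_col_def)

lemma arun_present_stays:
  assumes "arun w s y s'" "valid w s" "bump_col s c a" "present w s j x" "j < c \<or> j = c \<and> cmp w x a"
  shows "present w s' j x"
  using assms
proof (induction arbitrary: c a rule: arun.induct)
  case (last s y s')
  show ?case by (rule present_stays'[OF last(2,1,3,4)]) (use last(5) in blast)
next
  case (step s s1 y s')
  have p: "present w s1 j x" 
    by (rule present_stays'[OF step(4,1,5,6)]) (use step(7) in blast)
  obtain k where k: "bump_col s1 (Suc c) k"
    using astep_col[OF step(1,4,5)] by (auto split: if_splits)
  show ?case
    by (rule step.IH[OF astep_valid[OF step(1,4)] k p]) (use step.prems(4) in auto)
qed

text \<open>Models the chain of entries that a run leaves behind: \<open>K j\<close> is the value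
  inserted into column \<open>j\<close>, and \<open>e\<close> is the column of the new cell.\<close>

definition trail :: "bool \<Rightarrow> state \<Rightarrow> nat \<Rightarrow> nat \<Rightarrow> (nat \<Rightarrow> enat) \<Rightarrow> bool" where
  "trail w s c e K \<longleftrightarrow> (\<forall>j. c < j \<and> j \<le> e \<longrightarrow> present w s j (K j)) \<and>
     (\<forall>j. c < j \<and> j < e \<longrightarrow> cmp w (K j) (K (Suc j)))"

lemma arun_trail:
  assumes "arun w s x s'" "valid w s" "bump_col s c a"
  shows "\<exists>K. K (Suc c) = a \<and> trail w s' c (snd x) K"
  using assms
proof (induction arbitrary: c a rule: arun.induct)
  case (last s x s')
  have "snd x = Suc c" using astep_col[OF last] by (auto split: if_splits)
  moreover have "present w s' (Suc c) a" by (rule present_new'[OF last(2,1,3)])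
  ultimately show ?case by (intro exI[of _ "\<lambda>_. a"]) (auto simp: trail_def dest!: le_antisym)
next
  case (step s s1 x s')
  obtain k where k: "bump_col s1 (Suc c) k" "fst (snd s1) = move (fst (snd s)) c a k"
    using astep_col[OF step(1,4,5)] by (auto split: if_splits)
  have v1: "valid w s1" using astep_valid[OF step(1,4)] .
  obtain K where K: "K (Suc (Suc c)) = k" "trail w s' (Suc c) (snd x) K" using step.IH[OF v1 k(1)] by blast
  have p: "present w s1 (Suc c) a" by (rule present_new'[OF step(4,1,5)])
  have ak: "cmp w a k"
    using step(1,4,5)
  proof (cases s)
    case s: (fields H \<alpha> \<Lambda>)
    show ?thesis
      using step(1)[unfolded s] step(4)[unfolded s]
    proof (cases rule: astepE)
      case (hook c' a' i)
      have [simp]: "c' = c" "a' = a" using source_unique step(5) hook(1) by (auto simp: s hook_step_def)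
      have "k = H (Suc i) (Suc c)"
        using k(1) hook(3) by (auto simp: source_def move_def single_def split: if_splits)
      then show ?thesis using hook(1) by (simp add: hook_step_def slot_def)
    next
      case (extra c' a' i k')
      have [simp]: "c' = c" "a' = a" using source_unique step(5) extra(1) by (auto simp: s extra_step_def)
      have "k = k'"
        using k(1) extra(4) by (auto simp: source_def move_def single_def split: if_splits)
      then show ?thesis using extra(1) by (simp add: extra_step_def)
    qed
  qed
  \<comment> \<open>The rest of the run starts in column \<open>c + 1\<close> with an arm
    \<open>k\<close> not below \<open>a\<close>, so the inserted \<open>a\<close> survives
    it.\<close>
  have p': "present w s' (Suc c) a"
    by (rule arun_present_stays[OF step(2) v1 k(1) p]) (use ak in simp)
  show ?case
  proof (intro exI[of _ "K(Suc c := a)"] conjI)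
    show "trail w s' c (snd x) (K(Suc c := a))"
      unfolding trail_def
    proof (intro conjI allI impI)
      fix j assume j: "c < j \<and> j \<le> snd x"
      show "present w s' j ((K(Suc c := a)) j)"
        using j p' K(2) by (cases "j = Suc c") (auto simp: trail_def)
    next
      fix j assume j: "c < j \<and> j < snd x"
      show "cmp w ((K(Suc c := a)) j) ((K(Suc c := a)) (Suc j))"
        using j ak K by (cases "j = Suc c") (auto simp: trail_def)
    qed
  qed simp
qed

text \<open>In each column of the trail the current arm finds the candidate \<open>K j\<close>, so
  it creates no cell there and displaces something that is at most \<open>K j\<close>, hence
  comparable in the same way with the next value of the trail.\<close>

lemma arun_beyond_trail:
  assumes "arun w s x s'" "valid w s" "bump_col s c a" "trail w s c e K" "c < e \<longrightarrow> cmp w a (K (Suc c))"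
  shows "e < snd x"
  using assms
proof (induction arbitrary: c a rule: arun.induct)
  case (last s x s')
  obtain H \<alpha> \<Lambda> where s: "s = (H, \<alpha>, \<Lambda>)" by (cases s)
  have "snd x = Suc c" using astep_col[OF last(1-3)] by (auto split: if_splits)
  moreover have "\<not> c < e"
  proof
    assume "c < e"
    then have "present w s (Suc c) (K (Suc c))" "cmp w a (K (Suc c))" using last(4,5) by (auto simp: trail_def)
    then show False using bump_le_present[of w H \<alpha> \<Lambda> "Some x" s' c a "K (Suc c)"] last by (auto simp: s)
  qed
  ultimately show ?case by simp
next
  case (step s s1 x s')
  obtain H \<alpha> \<Lambda> where s: "s = (H, \<alpha>, \<Lambda>)" by (cases s)
  have v1: "valid w s1" using astep_valid[OF step(1,4)] .
  show ?case
  proof (cases "c < e")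
    case False
    obtain k where k: "bump_col s1 (Suc c) k"
      using astep_col[OF step(1,4,5)] by (auto split: if_splits)
    then show ?thesis using arun_col[OF step(2) v1 k] False by simp
  next
    case True
    then have "present w s (Suc c) (K (Suc c))" "cmp w a (K (Suc c))" using step by (auto simp: trail_def)
    then obtain k where k: "k \<le> K (Suc c)" "bump_col s1 (Suc c) k"
      using bump_le_present[of w H \<alpha> \<Lambda> None s1 c a "K (Suc c)"] step by (auto simp: s)
    have "present w s1 j (K j)" if "Suc c < j" "j \<le> e" for j
      using present_stays[of w H \<alpha> \<Lambda> None s1 c a j "K j"] step that by (auto simp: s trail_def)
    then have "trail w s1 (Suc c) e K" using step.prems(3) by (auto simp: trail_def)
    moreover have "Suc c < e \<longrightarrow> cmp w k (K (Suc (Suc c)))"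
      using k(1) step.prems(3) le_cmp_trans by (auto simp: trail_def)
    ultimately show ?thesis using step.IH[OF v1 k(2)] by blast
  qed
qed

text \<open>The row bumping lemma of this setting: \<open>a'\<close> was still among the arms of
  column \<open>c\<close> when the maximum \<open>a\<close> was chosen, so its run must pass the
  whole trail of the first run.\<close>

lemma arun_col_strict:
  assumes A: "arun w s x s1" "arun w s1 y s2" and v: "valid w s"
    and c: "bump_col s c a" "bump_col s1 c a'"
  shows "snd x < snd y"
proof -
  obtain K where K: "K (Suc c) = a" "trail w s1 c (snd x) K" using arun_trail[OF A(1) v c(1)] by blast
  have "fst (snd s1) = (fst (snd s))(c := fst (snd s) c - {#a#})" using arun_col[OF A(1) v c(1)] by blast
  then have "a' \<in># fst (snd s) c - {#a#}" using c(2) by (simp add: bump_col_def source_def)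
  then have "cmp w a' a"
    using source_rest[of w "fst s" "fst (snd s)" c a a'] v c(1) by (cases s) auto
  then show ?thesis using arun_beyond_trail[OF A(2) arun_valid[OF A(1) v] c(2) K(2)] K(1) by blast
qed

section \<open>From coordinates to hook-valued tableaux\<close>

fun tableau_of :: "state \<Rightarrow> hv_tableau" where
  "tableau_of (H, \<alpha>, \<Lambda>) = (\<lambda>(i, j). if i = 0 \<or> j = 0 \<or> H i j = \<infinity> then None else
     Some \<lparr>hook = the_enat (H i j),
       legs = {y. enat y \<in># \<Lambda> i \<and> H i j < enat y \<and> enat y \<le> H i (Suc j)},
       arms = image_mset the_enat (filter_mset (\<lambda>x. H i j \<le> x \<and> x < H (Suc i) j) (\<alpha> j))\<rparr>)"

text \<open>The cell contents of \<open>tableau_of\<close> under a name, so that cells can be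
  compared without its case distinction.\<close>

definition filling :: "grid \<Rightarrow> extras \<Rightarrow> extras \<Rightarrow> nat \<Rightarrow> nat \<Rightarrow> hook_filling" where
  "filling H \<alpha> \<Lambda> i j = \<lparr>hook = the_enat (H i j),
       legs = {y. enat y \<in># \<Lambda> i \<and> H i j < enat y \<and> enat y \<le> H i (Suc j)},
       arms = image_mset the_enat (filter_mset (\<lambda>x. H i j \<le> x \<and> x < H (Suc i) j) (\<alpha> j))\<rparr>"

lemma tableau_of_filling:
  "tableau_of (H, \<alpha>, \<Lambda>) (i, j) = (if i = 0 \<or> j = 0 \<or> H i j = \<infinity> then None else Some (filling H \<alpha> \<Lambda> i j))"
  by (simp add: filling_def)

lemma dom_tableau_of: "dom (tableau_of (H, \<alpha>, \<Lambda>)) = {(i, j). 0 < i \<and> 0 < j \<and> H i j \<noteq> \<infinity>}"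
  by (auto simp: dom_def split: if_splits)

lemma tableau_ofD:
  assumes "valid w (H, \<alpha>, \<Lambda>)" "tableau_of (H, \<alpha>, \<Lambda>) (i, j) = Some F"
  shows "0 < i" "0 < j" "H i j = enat (hook F)"
    "y \<in> legs F \<longleftrightarrow> enat y \<in># \<Lambda> i \<and> H i j < enat y \<and> enat y \<le> H i (Suc j)"
    "x \<in># arms F \<longleftrightarrow> enat x \<in># \<alpha> j \<and> H i j \<le> enat x \<and> enat x < H (Suc i) j"
proof -
  have F: "0 < i" "0 < j" "H i j \<noteq> \<infinity>" "F = filling H \<alpha> \<Lambda> i j"
    using assms(2) unfolding tableau_of_filling by (simp_all split: if_splits)
  show "0 < i" "0 < j" by (rule F)+
  show "H i j = enat (hook F)" using F(3) unfolding F(4) filling_def by auto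
  show "y \<in> legs F \<longleftrightarrow> enat y \<in># \<Lambda> i \<and> H i j < enat y \<and> enat y \<le> H i (Suc j)"
    unfolding F(4) filling_def by simp
  have al: "arms_ok w H \<alpha>" using assms(1) by simp
  have "x \<in># image_mset the_enat (filter_mset P (\<alpha> j)) \<longleftrightarrow> enat x \<in># \<alpha> j \<and> P (enat x)" for P
  proof
    assume "x \<in># image_mset the_enat (filter_mset P (\<alpha> j))"
    then obtain z where z: "z \<in># \<alpha> j" "P z" "x = the_enat z" by auto
    then have "z = enat x" using arms_okD(3)[OF al z(1)] by auto
    then show "enat x \<in># \<alpha> j \<and> P (enat x)" using z by simp
  next
    assume "enat x \<in># \<alpha> j \<and> P (enat x)"
    then have "the_enat (enat x) \<in># image_mset the_enat (filter_mset P (\<alpha> j))"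
      unfolding set_image_mset by (intro imageI) simp
    then show "x \<in># image_mset the_enat (filter_mset P (\<alpha> j))" by simp
  qed
  then show "x \<in># arms F \<longleftrightarrow> enat x \<in># \<alpha> j \<and> H i j \<le> enat x \<and> enat x < H (Suc i) j"
    unfolding F(4) filling_def by simp
qed

lemma arm_location:
  assumes v: "valid True (H, \<alpha>, \<Lambda>)" and x: "x \<in># \<alpha> c"
  shows "\<exists>r F. tableau_of (H, \<alpha>, \<Lambda>) (r, c) = Some F \<and> H r c \<le> x \<and> x < H (Suc r) c"
proof -
  have tab: "tab True H" and al: "arms_ok True H \<alpha>" using v by auto
  note D = arms_okD[OF al x]
  have "\<exists>i. x < H i c" using tab_col_infinity[OF tab D(1)] D(3) by metis
  then obtain i where i: "x < H i c" "\<forall>i'<i. \<not> x < H i' c"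
    using exists_least_iff[of "\<lambda>i. x < H i c"] by blast
  \<comment> \<open>The cell sought lies just below the first row whose hook exceeds
    \<open>x\<close>; this is not row 1, whose hook is bounded by \<open>x\<close>.\<close>
  have "1 < i"
  proof (rule ccontr)
    assume "\<not> 1 < i"
    then have "H i c \<le> H 1 c" using tab_col_le[OF tab] by simp
    then show False using arms_first[OF tab al x] i by simp
  qed
  then obtain r where r: "i = Suc r" "0 < r" by (cases i) auto
  have "\<not> x < H r c" using i(2) unfolding r(1) by blast
  then have "H r c \<le> x" by simp
  moreover have "H r c \<noteq> \<infinity>" using le_less_trans[OF calculation D(3)] by simp
  then have "\<exists>F. tableau_of (H, \<alpha>, \<Lambda>) (r, c) = Some F" using r D(1) by auto
  ultimately show ?thesis using i(1) unfolding r(1) by blast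
qed

lemma leg_location:
  assumes v: "valid True (H, \<alpha>, \<Lambda>)" and x: "x \<in># \<Lambda> r"
  shows "\<exists>c F. tableau_of (H, \<alpha>, \<Lambda>) (r, c) = Some F \<and> H r c < x \<and> x \<le> H r (Suc c)"
proof -
  have tab: "tab False (tp H)" and al: "arms_ok False (tp H) \<Lambda>" using v tab_tp[of True H] by auto
  note D = arms_okD[OF al x]
  have "\<exists>i. x \<le> H r i" using tab_col_infinity[OF tab D(1)] D(3) by (metis enat_ord_code(3) tp_app)
  then obtain i where i: "x \<le> H r i" "\<forall>i'<i. \<not> x \<le> H r i'"
    using exists_least_iff[of "\<lambda>i. x \<le> H r i"] by blast
  have "1 < i"
  proof (rule ccontr)
    assume "\<not> 1 < i"
    then have "H r i \<le> H r 1" using tab_col_le[OF tab, of i 1 r] by simp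
    then show False using arms_first[OF tab al x] i by simp
  qed
  then obtain c where c: "i = Suc c" "0 < c" by (cases i) auto
  then have "H r c < x" using i by auto
  moreover have "H r c \<noteq> \<infinity>" using calculation D(3) le_finite[of "H r c" x] by auto
  then have "\<exists>F. tableau_of (H, \<alpha>, \<Lambda>) (r, c) = Some F" using c D(1) by auto
  ultimately show ?thesis using i c by blast
qed

lemma col_slot_unique:
  assumes "tab w H" "H i c \<le> x" "x < H (Suc i) c" "H i' c \<le> x" "x < H (Suc i') c"
  shows "i' = i"
proof -
  have *: False if "x < H (Suc i) c" "H i' c \<le> x" "i < i'" for i i'
    using tab_col_le[OF assms(1), of "Suc i" i' c] that by simp
  show ?thesis using *[of i i'] *[of i' i] assms by (metis linorder_neqE_nat)
qed

lemma row_slot_unique: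
  assumes "tab w H" "H r j < x" "x \<le> H r (Suc j)" "H r j' < x" "x \<le> H r (Suc j')"
  shows "j' = j"
proof -
  have *: False if "x \<le> H r (Suc j)" "H r j' < x" "j < j'" for j j'
    using tab_row_le[OF assms(1), of "Suc j" j' r] that by simp
  show ?thesis using *[of j j'] *[of j' j] assms by (metis linorder_neqE_nat)
qed

lemma has_arms_tableau_of:
  assumes v: "valid True (H, \<alpha>, \<Lambda>)"
  shows "has_arms (tableau_of (H, \<alpha>, \<Lambda>)) \<longleftrightarrow> (\<exists>c. \<alpha> c \<noteq> {#})"
    "(\<exists>i F. tableau_of (H, \<alpha>, \<Lambda>) (i, c) = Some F \<and> arms F \<noteq> {#}) \<longleftrightarrow> \<alpha> c \<noteq> {#}"
    "(\<exists>i F. tableau_of (H, \<alpha>, \<Lambda>) (i, c) = Some F \<and> x \<in># arms F) \<longleftrightarrow> enat x \<in># \<alpha> c"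
proof -
  show 1: "(\<exists>i F. tableau_of (H, \<alpha>, \<Lambda>) (i, c) = Some F \<and> x \<in># arms F) \<longleftrightarrow> enat x \<in># \<alpha> c" for c x
    using tableau_ofD(5)[OF v] arm_location[OF v, of "enat x" c] by blast
  show 2: "(\<exists>i F. tableau_of (H, \<alpha>, \<Lambda>) (i, c) = Some F \<and> arms F \<noteq> {#}) \<longleftrightarrow> \<alpha> c \<noteq> {#}" for c
  proof
    assume "\<exists>i F. tableau_of (H, \<alpha>, \<Lambda>) (i, c) = Some F \<and> arms F \<noteq> {#}"
    then show "\<alpha> c \<noteq> {#}" using 1 multiset_nonemptyE by (metis empty_iff set_mset_empty)
  next
    assume "\<alpha> c \<noteq> {#}"
    then obtain x where x: "x \<in># \<alpha> c" using multiset_nonemptyE by blast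
    then obtain n where "x = enat n" using arms_okD(3)[of True H \<alpha> x c] v by auto
    then show "\<exists>i F. tableau_of (H, \<alpha>, \<Lambda>) (i, c) = Some F \<and> arms F \<noteq> {#}"
      using 1 x by (metis empty_iff set_mset_empty)
  qed
  show "has_arms (tableau_of (H, \<alpha>, \<Lambda>)) \<longleftrightarrow> (\<exists>c. \<alpha> c \<noteq> {#})"
    unfolding has_arms_def ran_def 2[symmetric] by fast
qed

lemma has_legs_tableau_of:
  assumes v: "valid True (H, \<alpha>, \<Lambda>)"
  shows "has_legs (tableau_of (H, \<alpha>, \<Lambda>)) \<longleftrightarrow> (\<exists>r. \<Lambda> r \<noteq> {#})"
    "(\<exists>j F. tableau_of (H, \<alpha>, \<Lambda>) (r, j) = Some F \<and> legs F \<noteq> {}) \<longleftrightarrow> \<Lambda> r \<noteq> {#}"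
    "(\<exists>j F. tableau_of (H, \<alpha>, \<Lambda>) (r, j) = Some F \<and> x \<in> legs F) \<longleftrightarrow> enat x \<in># \<Lambda> r"
proof -
  show 1: "(\<exists>i F. tableau_of (H, \<alpha>, \<Lambda>) (r, i) = Some F \<and> x \<in> legs F) \<longleftrightarrow> enat x \<in># \<Lambda> r" for r x
    using tableau_ofD(4)[OF v] leg_location[OF v, of "enat x" r] by blast
  show 2: "(\<exists>i F. tableau_of (H, \<alpha>, \<Lambda>) (r, i) = Some F \<and> legs F \<noteq> {}) \<longleftrightarrow> \<Lambda> r \<noteq> {#}" for r
  proof
    assume "\<exists>i F. tableau_of (H, \<alpha>, \<Lambda>) (r, i) = Some F \<and> legs F \<noteq> {}"
    then obtain y where "enat y \<in># \<Lambda> r" using 1 by blast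
    then show "\<Lambda> r \<noteq> {#}" by (metis empty_iff set_mset_empty)
  next
    assume "\<Lambda> r \<noteq> {#}"
    then obtain x where x: "x \<in># \<Lambda> r" using multiset_nonemptyE by blast
    then obtain n where "x = enat n" using arms_okD(3)[of False "tp H" \<Lambda> x r] v by auto
    then show "\<exists>i F. tableau_of (H, \<alpha>, \<Lambda>) (r, i) = Some F \<and> legs F \<noteq> {}"
      using 1 x by blast
  qed
  show "has_legs (tableau_of (H, \<alpha>, \<Lambda>)) \<longleftrightarrow> (\<exists>c. \<Lambda> c \<noteq> {#})"
    unfolding has_legs_def ran_def 2[symmetric] by fast
qed

lemma arm_col_tableau_of:
  assumes v: "valid True (H, \<alpha>, \<Lambda>)" and s: "source \<alpha> c a"
  shows "arm_col (tableau_of (H, \<alpha>, \<Lambda>)) = c"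
  unfolding arm_col_def has_arms_tableau_of(2)[OF v]
proof (rule Max_eqI)
  have le: "j \<le> c" if "\<alpha> j \<noteq> {#}" for j using s that unfolding source_def by (metis leI)
  then have "{j. \<alpha> j \<noteq> {#}} \<subseteq> {..c}" by blast
  then show "finite {j. \<alpha> j \<noteq> {#}}" by (rule finite_subset) simp
  show "j \<le> c" if "j \<in> {j. \<alpha> j \<noteq> {#}}" for j using le that by blast
  show "c \<in> {j. \<alpha> j \<noteq> {#}}" using s by (auto simp: source_def)
qed

lemma leg_row_tableau_of:
  assumes v: "valid True (H, \<alpha>, \<Lambda>)" and s: "source \<Lambda> r l"
  shows "leg_row (tableau_of (H, \<alpha>, \<Lambda>)) = r"
  unfolding leg_row_def has_legs_tableau_of(2)[OF v]
proof (rule Max_eqI)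
  have le: "j \<le> r" if "\<Lambda> j \<noteq> {#}" for j using s that unfolding source_def by (metis leI)
  then have "{j. \<Lambda> j \<noteq> {#}} \<subseteq> {..r}" by blast
  then show "finite {j. \<Lambda> j \<noteq> {#}}" by (rule finite_subset) simp
  show "j \<le> r" if "j \<in> {j. \<Lambda> j \<noteq> {#}}" for j using le that by blast
  show "r \<in> {j. \<Lambda> j \<noteq> {#}}" using s by (auto simp: source_def)
qed

lemma Max_enat:
  assumes "enat n \<in># X" "\<forall>x\<in>#X. x \<le> enat n"
  shows "Max {x. enat x \<in># X} = n"
proof (rule Max_eqI)
  show "finite {x. enat x \<in># X}"
    using finite_vimageI[of "set_mset X" enat] by (simp add: vimage_def inj_on_def)
qed (use assms in auto)

text \<open>\<open>present\<close> speaks of hooks and legs only. At the moment of a bump column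
  \<open>c + 1\<close> has no arms, so \<open>present\<close> then describes exactly the entries
  from which the bump chooses.\<close>

lemma col_entries_tableau_of:
  assumes v: "valid True (H, \<alpha>, \<Lambda>)" and e: "\<alpha> (Suc c) = {#}"
  shows "x \<in> col_entries (tableau_of (H, \<alpha>, \<Lambda>)) (Suc c) \<longleftrightarrow> present True (H, \<alpha>, \<Lambda>) (Suc c) (enat x)"
proof -
  have tab: "tab True H" and la: "arms_ok False (tp H) \<Lambda>" using v by auto
  show ?thesis
  proof
    assume "x \<in> col_entries (tableau_of (H, \<alpha>, \<Lambda>)) (Suc c)"
    then obtain i F where F: "tableau_of (H, \<alpha>, \<Lambda>) (i, Suc c) = Some F" "x \<in> entries F"
      by (auto simp: col_entries_def)
    note D = tableau_ofD[OF v F(1)]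
    have "x \<notin># arms F" using D(5) e by simp
    then consider "x = hook F" | "x \<in> legs F" using F(2) by (auto simp: entries_def)
    then show "present True (H, \<alpha>, \<Lambda>) (Suc c) (enat x)"
      using D(1,3,4) by cases (auto simp: present_def simp del: tableau_of.simps)
  next
    assume "present True (H, \<alpha>, \<Lambda>) (Suc c) (enat x)"
    then consider i where "0 < i" "H i (Suc c) = enat x"
      | i where "enat x \<in># \<Lambda> i" "H i (Suc c) < enat x" "enat x \<le> H i (Suc (Suc c))"
      by (auto simp: present_def)
    then show "x \<in> col_entries (tableau_of (H, \<alpha>, \<Lambda>)) (Suc c)"
    proof cases
      case (1 i)
      then obtain F where F: "tableau_of (H, \<alpha>, \<Lambda>) (i, Suc c) = Some F" by auto
      then have "hook F = x" using tableau_ofD(3)[OF v F] 1 by simp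
      then show ?thesis using F by (auto simp: col_entries_def entries_def simp del: tableau_of.simps)
    next
      case (2 i)
      have "0 < i" using arms_okD(1)[OF la 2(1)] .
      moreover have "H i (Suc c) \<noteq> \<infinity>" using 2(2) le_finite[of "H i (Suc c)" "enat x"] by simp
      ultimately obtain F where F: "tableau_of (H, \<alpha>, \<Lambda>) (i, Suc c) = Some F" by auto
      then have "x \<in> legs F" using tableau_ofD(4)[OF v F] 2 by simp
      then show ?thesis using F by (auto simp: col_entries_def entries_def simp del: tableau_of.simps)
    qed
  qed
qed

lemma row_entries_tableau_of:
  assumes v: "valid True (H, \<alpha>, \<Lambda>)" and e: "\<Lambda> (Suc r) = {#}"
  shows "x \<in> row_entries (tableau_of (H, \<alpha>, \<Lambda>)) (Suc r) \<longleftrightarrow> present False (tp H, \<Lambda>, \<alpha>) (Suc r) (enat x)"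
proof -
  have tab: "tab True H" and al: "arms_ok True H \<alpha>" using v by auto
  show ?thesis
  proof
    assume "x \<in> row_entries (tableau_of (H, \<alpha>, \<Lambda>)) (Suc r)"
    then obtain i F where F: "tableau_of (H, \<alpha>, \<Lambda>) (Suc r, i) = Some F" "x \<in> entries F"
      by (auto simp: row_entries_def)
    note D = tableau_ofD[OF v F(1)]
    have "x \<notin> legs F" using D(4) e by simp
    then consider "x = hook F" | "x \<in># arms F" using F(2) by (auto simp: entries_def)
    then show "present False (tp H, \<Lambda>, \<alpha>) (Suc r) (enat x)"
      using D(2,3,5) by cases (auto simp: present_def simp del: tableau_of.simps)
  next
    assume "present False (tp H, \<Lambda>, \<alpha>) (Suc r) (enat x)"
    then consider i where "0 < i" "H (Suc r) i = enat x"
      | i where "enat x \<in># \<alpha> i" "H (Suc r) i \<le> enat x" "enat x < H (Suc (Suc r)) i"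
      by (auto simp: present_def)
    then show "x \<in> row_entries (tableau_of (H, \<alpha>, \<Lambda>)) (Suc r)"
    proof cases
      case (1 i)
      then obtain F where F: "tableau_of (H, \<alpha>, \<Lambda>) (Suc r, i) = Some F" by auto
      then have "hook F = x" using tableau_ofD(3)[OF v F] 1 by simp
      then show ?thesis using F by (auto simp: row_entries_def entries_def simp del: tableau_of.simps)
    next
      case (2 i)
      have "0 < i" using arms_okD(1)[OF al 2(1)] .
      moreover have "H (Suc r) i \<noteq> \<infinity>" using 2(2) le_finite[of "H (Suc r) i" "enat x"] by simp
      ultimately obtain F where F: "tableau_of (H, \<alpha>, \<Lambda>) (Suc r, i) = Some F" by auto
      then have "x \<in># arms F" using tableau_ofD(5)[OF v F] 2 by simp
      then show ?thesis using F by (auto simp: row_entries_def entries_def simp del: tableau_of.simps)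
    qed
  qed
qed

section \<open>Unfolding a bump, with its choices given as equations\<close>

lemma arm_bump_new:
  assumes "has_arms T" "arm_col T = c" "Max {x. \<exists>i H. T (i, c) = Some H \<and> x \<in># arms H} = n"
    "Max {i. \<exists>H. T (i, c) = Some H \<and> n \<in># arms H} = r" "T (r, c) = Some S"
    "\<forall>x\<in>col_entries T (Suc c). \<not> n \<le> x" "col_len T (Suc c) = i"
    "mv = (if Suc i = r then {x \<in> legs S. n < x} else {})"
  shows "arm_bump T = T((r, c) \<mapsto> S\<lparr>legs := legs S - mv, arms := arms S - {#n#}\<rparr>,
     (Suc i, Suc c) \<mapsto> \<lparr>hook = n, legs = mv, arms = {#}\<rparr>)"
proof -
  have "{x \<in> col_entries T (Suc c). n \<le> x} = {}" using assms(6) by blast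
  with assms show ?thesis unfolding arm_bump_def Let_def by simp
qed

lemma arm_bump_old:
  assumes "has_arms T" "arm_col T = c" "Max {x. \<exists>i H. T (i, c) = Some H \<and> x \<in># arms H} = n"
    "Max {i. \<exists>H. T (i, c) = Some H \<and> n \<in># arms H} = r" "T (r, c) = Some S"
    "Min {x \<in> col_entries T (Suc c). n \<le> x} = k" "k \<in> col_entries T (Suc c)" "n \<le> k"
    "(LEAST i. \<exists>H. T (i, Suc c) = Some H \<and> k \<in> entries H) = i" "T (i, Suc c) = Some F"
    "mv = (if i = r then {x \<in> legs S. n < x} else {})" "E = replace_entry k n F"
  shows "arm_bump T = T((r, c) \<mapsto> S\<lparr>legs := legs S - mv, arms := arms S - {#n#}\<rparr>,
     (i, Suc c) \<mapsto> E\<lparr>arms := add_mset k (arms E), legs := legs E \<union> mv\<rparr>)"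
proof -
  have ne: "{x \<in> col_entries T (Suc c). n \<le> x} \<noteq> {}" using assms(7,8) by blast
  show ?thesis
    unfolding arm_bump_def Let_def assms(2) assms(3) assms(4) if_not_P[OF ne] assms(6) assms(9) assms(10)
      assms(5) option.sel assms(11) assms(12)
    using assms(1) by simp
qed

lemma leg_bump_new:
  assumes "has_legs T" "leg_row T = r" "Max {x. \<exists>j H. T (r, j) = Some H \<and> x \<in> legs H} = n"
    "Max {j. \<exists>H. T (r, j) = Some H \<and> n \<in> legs H} = c" "T (r, c) = Some S"
    "\<forall>x\<in>row_entries T (Suc r). \<not> n < x" "row_len T (Suc r) = j"
    "mv = (if Suc j = c then {#x \<in># arms S. n \<le> x#} else {#})"
  shows "leg_bump T = T((r, c) \<mapsto> S\<lparr>legs := legs S - {n}, arms := arms S - mv\<rparr>,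
     (Suc r, Suc j) \<mapsto> \<lparr>hook = n, legs = {}, arms = mv\<rparr>)"
proof -
  have "{x \<in> row_entries T (Suc r). n < x} = {}" using assms(6) by blast
  with assms show ?thesis unfolding leg_bump_def Let_def by simp
qed

lemma leg_bump_old:
  assumes "has_legs T" "leg_row T = r" "Max {x. \<exists>j H. T (r, j) = Some H \<and> x \<in> legs H} = n"
    "Max {j. \<exists>H. T (r, j) = Some H \<and> n \<in> legs H} = c" "T (r, c) = Some S"
    "Min {x \<in> row_entries T (Suc r). n < x} = k" "k \<in> row_entries T (Suc r)" "n < k"
    "(LEAST j. \<exists>H. T (Suc r, j) = Some H \<and> k \<in> entries H) = j" "T (Suc r, j) = Some F"
    "mv = (if j = c then {#x \<in># arms S. n \<le> x#} else {#})" "E = replace_entry k n F"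
  shows "leg_bump T = T((r, c) \<mapsto> S\<lparr>legs := legs S - {n}, arms := arms S - mv\<rparr>,
     (Suc r, j) \<mapsto> E\<lparr>legs := insert k (legs E), arms := arms E + mv\<rparr>)"
proof -
  have ne: "{x \<in> row_entries T (Suc r). n < x} \<noteq> {}" using assms(7,8) by blast
  show ?thesis
    unfolding leg_bump_def Let_def assms(2) assms(3) assms(4) if_not_P[OF ne] assms(6) assms(9) assms(10)
      assms(5) option.sel assms(11) assms(12)
    using assms(1) by simp
qed

lemma astep_no_present:
  assumes "valid w (H, \<alpha>, \<Lambda>)" "astep w (H, \<alpha>, \<Lambda>) (Some x) s'" "source \<alpha> c a" "present w (H, \<alpha>, \<Lambda>) (Suc c) y"
  shows "\<not> cmp w a y"
  using bump_le_present[OF assms] by auto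

text \<open>Identifies the \<open>k\<close> of a step with the minimum taken in the definition of
  the bump.\<close>

lemma astep_min_present:
  assumes "valid w (H, \<alpha>, \<Lambda>)" "astep w (H, \<alpha>, \<Lambda>) g (H', move \<alpha> c a k, \<Lambda>')" "source \<alpha> c a"
    "present w (H, \<alpha>, \<Lambda>) (Suc c) y" "cmp w a y"
  shows "k \<le> y"
proof -
  obtain k' where k': "k' \<le> y" "source (move \<alpha> c a k) (Suc c) k'"
    using bump_le_present[OF assms] by auto
  then have "k' = k" by (auto simp: source_def move_def single_def split: if_splits)
  with k' show ?thesis by simp
qed

lemma finite_col_entries:
  assumes "finite (dom T)" "\<And>p F. T p = Some F \<Longrightarrow> finite (legs F)"
  shows "finite (col_entries T c)" "finite (row_entries T r)"
proof -
  have *: "finite (\<Union>p\<in>dom T. entries (the (T p)))"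
    using assms by (fastforce simp: entries_def)
  show "finite (col_entries T c)"
    by (rule finite_subset[OF _ *]) (force simp: col_entries_def)
  show "finite (row_entries T r)"
    by (rule finite_subset[OF _ *]) (force simp: row_entries_def)
qed

lemma finite_entries_tableau_of:
  assumes v: "valid True (H, \<alpha>, \<Lambda>)"
  shows "finite (col_entries (tableau_of (H, \<alpha>, \<Lambda>)) c)" "finite (row_entries (tableau_of (H, \<alpha>, \<Lambda>)) r)"
proof -
  have d: "finite (dom (tableau_of (H, \<alpha>, \<Lambda>)))"
    unfolding dom_tableau_of by (rule tab_finite[of True]) (use v in simp)
  have l: "finite (legs F)" if "tableau_of (H, \<alpha>, \<Lambda>) p = Some F" for p F
  proof -
    obtain i j where p: "p = (i, j)" by (cases p)
    have "finite {y. enat y \<in># \<Lambda> i}"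
      using finite_vimageI[of "set_mset (\<Lambda> i)" enat] by (simp add: vimage_def inj_on_def)
    then show ?thesis
      by (rule finite_subset[rotated]) (use tableau_ofD(4)[OF v that[unfolded p]] in auto)
  qed
  show "finite (col_entries (tableau_of (H, \<alpha>, \<Lambda>)) c)"
    by (rule finite_col_entries(1)[OF d]) (rule l)
  show "finite (row_entries (tableau_of (H, \<alpha>, \<Lambda>)) r)"
    by (rule finite_col_entries(2)[OF d]) (rule l)
qed

lemma arm_source:
  assumes v: "valid True (H, \<alpha>, \<Lambda>)" and s: "source \<alpha> c a"
  obtains n r F where "a = enat n" "tableau_of (H, \<alpha>, \<Lambda>) (r, c) = Some F" "H r c \<le> a" "a < H (Suc r) c"
    "Max {x. \<exists>i F. tableau_of (H, \<alpha>, \<Lambda>) (i, c) = Some F \<and> x \<in># arms F} = n"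
    "Max {i. \<exists>F. tableau_of (H, \<alpha>, \<Lambda>) (i, c) = Some F \<and> n \<in># arms F} = r"
    "has_arms (tableau_of (H, \<alpha>, \<Lambda>))" "arm_col (tableau_of (H, \<alpha>, \<Lambda>)) = c"
proof -
  have tab: "tab True H" and al: "arms_ok True H \<alpha>" using v by auto
  have a: "a \<in># \<alpha> c" "\<forall>x\<in>#\<alpha> c. x \<le> a" using s by (auto simp: source_def)
  obtain n where n: "a = enat n" using arms_okD(3)[OF al a(1)] by auto
  obtain r F where r: "tableau_of (H, \<alpha>, \<Lambda>) (r, c) = Some F" "H r c \<le> a" "a < H (Suc r) c"
    using arm_location[OF v a(1)] by blast
  have "Max {x. \<exists>i F. tableau_of (H, \<alpha>, \<Lambda>) (i, c) = Some F \<and> x \<in># arms F} = n"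
    unfolding has_arms_tableau_of(3)[OF v] using Max_enat a n by blast
  \<comment> \<open>All copies of an arm value within a column lie in one cell, so the maximum over
    rows is taken over a singleton.\<close>
  moreover have "{i. \<exists>F. tableau_of (H, \<alpha>, \<Lambda>) (i, c) = Some F \<and> n \<in># arms F} = {r}"
  proof -
    have "n \<in># arms F" using tableau_ofD(5)[OF v r(1)] a r n by simp
    moreover have "i = r" if "tableau_of (H, \<alpha>, \<Lambda>) (i, c) = Some G" "n \<in># arms G" for i G
      using tableau_ofD(5)[OF v that(1)] that(2) col_slot_unique[OF tab r(2,3)] n by blast
    ultimately show ?thesis using r by blast
  qed
  moreover have "has_arms (tableau_of (H, \<alpha>, \<Lambda>))"
    unfolding has_arms_tableau_of(1)[OF v] using a by (metis empty_iff set_mset_empty)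
  ultimately show ?thesis using that n r arm_col_tableau_of[OF v s] by simp
qed

lemma filter_remove: "filter_mset P (M - {#a#}) = (if P a then filter_mset P M - {#a#} else filter_mset P M)"
  by simp

lemma image_remove: "a \<in># M \<Longrightarrow> image_mset f (M - {#a#}) = image_mset f M - {#f a#}"
  by (simp add: image_mset_Diff)

declare tableau_of.simps [simp del]

section \<open>The bumping maps in coordinates\<close>

lemma lt_finite: "x < y \<Longrightarrow> x \<noteq> (\<infinity> :: enat)"
  by (cases x; cases y) auto

lemma leg_upper:
  assumes "valid True (H, \<alpha>, \<Lambda>)" "y \<in># \<Lambda> p" "y \<le> H p (Suc q)"
  shows "y < H (Suc p) q"
proof (rule ccontr)
  assume *: "\<not> y < H (Suc p) q"
  have "arms_ok False (tp H) \<Lambda>" using assms(1) by simp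
  from arms_okD(4)[OF this assms(2), of q] * assms(3) show False by (simp add: not_less)
qed

lemma arm_upper:
  assumes "valid True (H, \<alpha>, \<Lambda>)" "x \<in># \<alpha> c" "x < H (Suc p) c"
  shows "x \<le> H p (Suc c)"
proof (rule ccontr)
  assume *: "\<not> x \<le> H p (Suc c)"
  have "arms_ok True H \<alpha>" using assms(1) by simp
  from arms_okD(4)[OF this assms(2), of p] * assms(3) show False by (simp add: not_less not_le)
qed

lemma two_updates:
  assumes "\<And>z. z \<noteq> p \<Longrightarrow> z \<noteq> q \<Longrightarrow> T' z = T z" "T' p = Some X" "T' q = Some Y"
  shows "T(p \<mapsto> X, q \<mapsto> Y) = T'"
  using assms by (auto simp: fun_eq_iff)

text \<open>Both sides are compared cell by cell: \<open>C1\<close> to \<open>C3\<close> cover the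
  cells that do not change, \<open>C4\<close> the cell that loses \<open>a\<close>,
  \<open>C5\<close> the cell that receives it. The legs that must travel are those between
  \<open>a\<close> and \<open>k\<close>, whose location changes when the hook drops from
  \<open>k\<close> to \<open>a\<close>.\<close>

lemma arm_bump_hook:
  assumes v: "valid True (H, \<alpha>, \<Lambda>)" and st: "hook_step True H \<alpha> \<Lambda> c a i"
  shows "arm_bump (tableau_of (H, \<alpha>, \<Lambda>)) =
    tableau_of (set_hook H (Suc i) (Suc c) a, move \<alpha> c a (H (Suc i) (Suc c)), \<Lambda>)"
proof -
  let ?T = "tableau_of (H, \<alpha>, \<Lambda>)"
  define k where "k = H (Suc i) (Suc c)"
  define H' where "H' = set_hook H (Suc i) (Suc c) a"
  define \<alpha>' where "\<alpha>' = move \<alpha> c a k"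
  let ?T' = "tableau_of (H', \<alpha>', \<Lambda>)"
  have tab: "tab True H" and al: "arms_ok True H \<alpha>" and la: "arms_ok False (tp H) \<Lambda>" using v by auto
  have s: "source \<alpha> c a" and Ha: "H i (Suc c) < a" and ak: "a \<le> k"
    using st by (auto simp: hook_step_def slot_def k_def)
  have a: "a \<in># \<alpha> c" and e: "\<alpha> (Suc c) = {#}" using s by (auto simp: source_def)
  have c0: "0 < c" using arms_okD(1)[OF al a] .
  obtain n r F where n: "a = enat n" and F: "?T (r, c) = Some F" and r: "H r c \<le> a" "a < H (Suc r) c"
    and sel: "Max {x. \<exists>i F. ?T (i, c) = Some F \<and> x \<in># arms F} = n"
      "Max {i. \<exists>F. ?T (i, c) = Some F \<and> n \<in># arms F} = r" "has_arms ?T" "arm_col ?T = c"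
    using arm_source[OF v s] by blast
  have Hc: "H (Suc i) c \<le> a" using arms_okD(4)[OF al a, of i] Ha by simp
  have ir: "Suc i \<le> r"
  proof (rule ccontr)
    assume "\<not> Suc i \<le> r"
    then show False using tab_col_le[OF tab, of "Suc r" "Suc i" c] Hc r by simp
  qed
  \<comment> \<open>A leg of row \<open>i + 1\<close> in the gap between \<open>a\<close> and
    \<open>k\<close> can exist only if \<open>a\<close> itself comes from row \<open>i + 1\<close>,
    which is exactly when the definition moves legs.\<close>
  have leg_r: "Suc i = r" if y: "y \<in># \<Lambda> (Suc i)" "y \<le> k" "a < y" for y
  proof (rule ccontr)
    assume "Suc i \<noteq> r"
    then have "H (Suc (Suc i)) c \<le> y"
      using tab_col_le[OF tab, of "Suc (Suc i)" r c] ir r y by simp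
    then have "k < y" using arms_okD(4)[OF la y(1), of c] by (simp add: k_def)
    then show False using y by simp
  qed
  define mv where "mv = (if Suc i = r then {x \<in> legs F. n < x} else {})"
  have F': "F = filling H \<alpha> \<Lambda> r c" and r0: "0 < r" "H r c \<noteq> \<infinity>"
    using F by (auto simp: tableau_of_filling split: if_splits)
  have H'o: "H' p q = (if p = Suc i \<and> q = Suc c then a else H p q)" for p q
    by (simp add: H'_def set_hook_def)
  have aP: "H p c \<le> a \<and> a < H (Suc p) c \<longleftrightarrow> p = r" for p
    using col_slot_unique[OF tab, of p c a r] r by blast
  have C1: "?T' (p, q) = ?T (p, q)" if "q \<noteq> c" "q \<noteq> Suc c" for p q
    using that by (simp add: tableau_of_filling filling_def H'o \<alpha>'_def move_def)
  have C2: "?T' (p, c) = ?T (p, c)" if "p \<noteq> r" for p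
  proof -
    have l: "enat y \<le> a \<longleftrightarrow> enat y \<le> k" if "enat y \<in># \<Lambda> p" "p = Suc i" for y
      using leg_r[of "enat y"] that \<open>p \<noteq> r\<close> ak order_trans[of "enat y" a k] by fastforce
    have "{y. enat y \<in># \<Lambda> p \<and> H p c < enat y \<and> enat y \<le> H' p (Suc c)} =
        {y. enat y \<in># \<Lambda> p \<and> H p c < enat y \<and> enat y \<le> H p (Suc c)}"
    proof (cases "p = Suc i")
      case True
      then show ?thesis using l by (auto simp: H'o k_def)
    qed (simp add: H'o)
    moreover have "filter_mset (\<lambda>x. H p c \<le> x \<and> x < H (Suc p) c) (\<alpha>' c) =
        filter_mset (\<lambda>x. H p c \<le> x \<and> x < H (Suc p) c) (\<alpha> c)"
      using aP[of p] that unfolding \<alpha>'_def move_def by (auto simp: filter_remove)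
    moreover have "H' p c = H p c" "H' (Suc p) c = H (Suc p) c" by (simp_all add: H'o)
    ultimately have "filling H' \<alpha>' \<Lambda> p c = filling H \<alpha> \<Lambda> p c" by (simp add: filling_def)
    then show ?thesis by (simp add: tableau_of_filling H'o)
  qed
  have kS: "k < H (Suc (Suc i)) (Suc c)" if "k \<noteq> \<infinity>"
    using tab_col_cmp[OF tab, of "Suc c" "Suc i" "Suc (Suc i)"] that
    by (cases "H (Suc (Suc i)) (Suc c) = \<infinity>") (auto simp: k_def)
  have kP: "\<not> (H p (Suc c) \<le> k \<and> k < H (Suc p) (Suc c))" if "p \<noteq> Suc i" "p \<noteq> i" "k \<noteq> \<infinity>" for p
    using col_slot_unique[OF tab, of "Suc i" "Suc c" k p] kS that by (auto simp: k_def)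
  have C3: "?T' (p, Suc c) = ?T (p, Suc c)" if p: "p \<noteq> Suc i" for p
  proof -
    have "filter_mset (\<lambda>x. H' p (Suc c) \<le> x \<and> x < H' (Suc p) (Suc c)) (single k) = {#}"
      using kP[of p] p ak by (cases "k = \<infinity>"; cases "p = i") (auto simp: single_finite H'o)
    then have "filling H' \<alpha>' \<Lambda> p (Suc c) = filling H \<alpha> \<Lambda> p (Suc c)"
      using p e by (simp add: filling_def H'o \<alpha>'_def move_def)
    then show ?thesis using p by (simp add: tableau_of_filling H'o)
  qed
  have C4: "?T' (r, c) = Some (F\<lparr>legs := legs F - mv, arms := arms F - {#n#}\<rparr>)"
  proof -
    have l: "{y. enat y \<in># \<Lambda> r \<and> H r c < enat y \<and> enat y \<le> (if r = Suc i then a else H r (Suc c))} = legs F - mv"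
      using ak n order_trans[of _ a k] unfolding mv_def F' filling_def k_def by auto
    have "image_mset the_enat (filter_mset (\<lambda>x. H r c \<le> x \<and> x < H (Suc r) c) (\<alpha> c - {#a#})) = arms F - {#n#}"
      using a r n unfolding F' filling_def filter_remove by (simp add: image_remove)
    then have "filling H' \<alpha>' \<Lambda> r c = F\<lparr>legs := legs F - mv, arms := arms F - {#n#}\<rparr>"
      using l by (simp add: filling_def H'o \<alpha>'_def move_def) (simp add: F' filling_def)
    then show ?thesis using r0 c0 by (simp add: tableau_of_filling H'o)
  qed
  define lg where "lg = {y. enat y \<in># \<Lambda> (Suc i) \<and> k < enat y \<and> enat y \<le> H (Suc i) (Suc (Suc c))}"
  have kH: "k \<le> H (Suc i) (Suc (Suc c))" using tab_row_le[OF tab] by (simp add: k_def)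
  \<comment> \<open>The receiving cell has its old legs, all above \<open>k\<close>, and those of
    the gap between \<open>a\<close> and \<open>k\<close>.\<close>
  have L5: "{y. enat y \<in># \<Lambda> (Suc i) \<and> a < enat y \<and> enat y \<le> H (Suc i) (Suc (Suc c))} = lg \<union> mv"
  proof -
    have "enat y \<in># \<Lambda> (Suc i) \<and> a < enat y \<and> enat y \<le> k \<longleftrightarrow> y \<in> mv" for y
      using leg_r[of "enat y"] Hc n le_less_trans[of "H (Suc i) c" a "enat y"]
      unfolding mv_def F' filling_def k_def by auto
    then have "y \<in> mv \<longleftrightarrow> enat y \<in># \<Lambda> (Suc i) \<and> a < enat y \<and> enat y \<le> k" for y by blast
    then show ?thesis using ak kH order_trans[of _ k] le_less_trans[of a k] by (auto simp: lg_def not_le)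
  qed
  have C5: "?T' (Suc i, Suc c) = Some \<lparr>hook = n, legs = lg \<union> mv, arms = image_mset the_enat (single k)\<rparr>"
  proof -
    have "filter_mset (\<lambda>x. a \<le> x \<and> x < H (Suc (Suc i)) (Suc c)) (single k) = single k"
      using ak kS by (cases "k = \<infinity>") (auto simp: single_finite)
    then show ?thesis using n L5 by (simp add: tableau_of_filling filling_def H'o \<alpha>'_def move_def)
  qed
  have ast: "astep True (H, \<alpha>, \<Lambda>) (grown H (Suc i) (Suc c)) (H', \<alpha>', \<Lambda>)"
    unfolding H'_def \<alpha>'_def k_def by (rule astep_hookI[OF st]) auto
  have "arm_bump ?T = ?T((r, c) \<mapsto> F\<lparr>legs := legs F - mv, arms := arms F - {#n#}\<rparr>,
     (Suc i, Suc c) \<mapsto> \<lparr>hook = n, legs = lg \<union> mv, arms = image_mset the_enat (single k)\<rparr>)"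
  proof (cases "k = \<infinity>")
    case True
    have "\<forall>x\<in>col_entries ?T (Suc c). \<not> n \<le> x"
    proof
      fix x assume "x \<in> col_entries ?T (Suc c)"
      then have "present True (H, \<alpha>, \<Lambda>) (Suc c) (enat x)" using col_entries_tableau_of[where c = c, OF v e] by simp
      with astep_no_present[OF v _ s this] ast True n show "\<not> n \<le> x" by (auto simp: grown_def k_def)
    qed
    moreover have "col_len ?T (Suc c) = i"
    proof -
      have "i' \<le> i \<longleftrightarrow> H i' (Suc c) \<noteq> \<infinity>" for i'
      proof (cases "i' \<le> i")
        case le: True
        have "H i' (Suc c) < a" using tab_col_le[OF tab le, of "Suc c"] Ha by (rule le_less_trans)
        then show ?thesis using le lt_finite by blast
      next
        case False
        then have "k \<le> H i' (Suc c)" using tab_col_le[OF tab, of "Suc i" i' "Suc c"] by (simp add: k_def)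
        then show ?thesis using False True by simp
      qed
      then have "{i'. (i', Suc c) \<in> dom ?T} = {1..i}" unfolding dom_tableau_of by auto
      then show ?thesis by (simp add: col_len_def)
    qed
    moreover have "lg = {}" by (simp add: lg_def True)
    ultimately show ?thesis
      using arm_bump_new[OF sel(3,4,1,2) F _ _ mv_def] True by simp
  next
    case False
    then obtain m where m: "k = enat m" by auto
    obtain G where G: "?T (Suc i, Suc c) = Some G" using False by (auto simp: tableau_of_filling k_def)
    have G': "G = \<lparr>hook = m, legs = lg, arms = {#}\<rparr>"
      using G False m e unfolding tableau_of_filling filling_def lg_def k_def by auto
    have "present True (H, \<alpha>, \<Lambda>) (Suc c) (enat m)" using m by (auto simp: present_def k_def)
    then have mc: "m \<in> col_entries ?T (Suc c)" using col_entries_tableau_of[where c = c, OF v e] by simp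
    have nm: "n \<le> m" using ak n m by simp
    have mn: "m \<le> x" if "x \<in> col_entries ?T (Suc c)" "n \<le> x" for x
    proof -
      have "present True (H, \<alpha>, \<Lambda>) (Suc c) (enat x)" using col_entries_tableau_of[where c = c, OF v e] that by simp
      then show ?thesis
        using astep_min_present[OF v ast[unfolded \<alpha>'_def] s, of "enat x"] that(2) n m by simp
    qed
    have min: "Min {x \<in> col_entries ?T (Suc c). n \<le> x} = m"
      by (rule Min_eqI) (use finite_entries_tableau_of[OF v] mn mc nm in auto)
    have least: "(LEAST i. \<exists>H. ?T (i, Suc c) = Some H \<and> m \<in> entries H) = Suc i"
    proof (rule Least_equality)
      show "\<exists>H. ?T (Suc i, Suc c) = Some H \<and> m \<in> entries H" using G G' by (simp add: entries_def)
      fix p assume "\<exists>G. ?T (p, Suc c) = Some G \<and> m \<in> entries G"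
      then obtain G where G: "?T (p, Suc c) = Some G" "m \<in> entries G" by blast
      note D = tableau_ofD[OF v G(1)]
      have "H (Suc i) (Suc c) \<le> enat m" "enat m \<le> H (Suc i) (Suc c)" using m by (auto simp: k_def)
      consider "H p (Suc c) = enat m" | "enat m \<in># \<Lambda> p" "H p (Suc c) < enat m" "enat m \<le> H p (Suc (Suc c))"
        using G(2) D(3,4,5) e by (auto simp: entries_def)
      then show "Suc i \<le> p"
      proof cases
        case 1
        have "\<not> p \<le> i"
        proof
          assume "p \<le> i"
          then have "enat m < a" using tab_col_le[OF tab, of p i "Suc c"] Ha 1 by simp
          then show False using ak m by simp
        qed
        then show ?thesis by simp
      next
        case 2
        have "enat m < H (Suc p) (Suc c)" using leg_upper[OF v 2(1,3)] .
        then have "k < H (Suc p) (Suc c)" using m by simp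
        then have "\<not> Suc p \<le> Suc i"
          using tab_col_le[OF tab, of "Suc p" "Suc i" "Suc c"] unfolding k_def by (meson leD)
        then show ?thesis by simp
      qed
    qed
    have mv2: "mv = (if Suc i = r then {x \<in> legs F. n < x} else {})" by (rule mv_def)
    show ?thesis
      using arm_bump_old[OF sel(3,4,1,2) F min mc nm least G mv2 refl] G' m
      by (simp add: replace_entry_def single_finite)
  qed
  moreover have "?T((r, c) \<mapsto> F\<lparr>legs := legs F - mv, arms := arms F - {#n#}\<rparr>,
     (Suc i, Suc c) \<mapsto> \<lparr>hook = n, legs = lg \<union> mv, arms = image_mset the_enat (single k)\<rparr>) = ?T'"
  proof (rule two_updates[where T' = ?T'])
    fix z :: cell
    assume z: "z \<noteq> (r, c)" "z \<noteq> (Suc i, Suc c)"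
    obtain x y where xy: "z = (x, y)" by (cases z)
    consider "y = c" | "y = Suc c" | "y \<noteq> c" "y \<noteq> Suc c" by blast
    then show "?T' z = ?T z" using C1[of y x] C2[of x] C3[of x] z unfolding xy by cases auto
  qed (rule C4 C5)+
  ultimately show ?thesis by (simp add: H'_def \<alpha>'_def k_def)
qed

lemma in_swap_extra:
  assumes "count (\<Lambda> i) k \<le> 1"
  shows "y \<in># swap_extra \<Lambda> i k a p \<longleftrightarrow> (if p = i then y = a \<or> y \<noteq> k \<and> y \<in># \<Lambda> i else y \<in># \<Lambda> p)"
proof -
  have "k \<notin># \<Lambda> i - {#k#}" using assms by (simp add: in_diff_count)
  then show ?thesis by (auto simp: swap_extra_def in_remove_neq dest: in_diffD)
qed

text \<open>No hook changes here, so only the cell losing \<open>a\<close> and the cell where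
  \<open>a\<close> replaces the leg \<open>k\<close> are affected.\<close>

lemma arm_bump_extra:
  assumes v: "valid True (H, \<alpha>, \<Lambda>)" and st: "extra_step True H \<alpha> \<Lambda> c a i k" and k: "k \<noteq> \<infinity>"
  shows "arm_bump (tableau_of (H, \<alpha>, \<Lambda>)) = tableau_of (H, move \<alpha> c a k, swap_extra \<Lambda> i k a)"
proof -
  let ?T = "tableau_of (H, \<alpha>, \<Lambda>)"
  define \<alpha>' where "\<alpha>' = move \<alpha> c a k"
  define \<Lambda>' where "\<Lambda>' = swap_extra \<Lambda> i k a"
  let ?T' = "tableau_of (H, \<alpha>', \<Lambda>')"
  have tab: "tab True H" and al: "arms_ok True H \<alpha>" and la: "arms_ok False (tp H) \<Lambda>" using v by auto
  have s: "source \<alpha> c a" and Ha: "H i (Suc c) < a" and ak: "a \<le> k" and kL: "k \<in># \<Lambda> i"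
    and kH: "k \<le> H i (Suc (Suc c))"
    using st by (auto simp: extra_step_def slot_def)
  have kS: "k < H (Suc i) (Suc c)" using leg_upper[OF v kL kH] .
  have a: "a \<in># \<alpha> c" and e: "\<alpha> (Suc c) = {#}" using s by (auto simp: source_def)
  have c0: "0 < c" using arms_okD(1)[OF al a] .
  have i0: "0 < i" using arms_okD(1)[OF la kL] .
  obtain n r F where n: "a = enat n" and F: "?T (r, c) = Some F" and r: "H r c \<le> a" "a < H (Suc r) c"
    and sel: "Max {x. \<exists>i F. ?T (i, c) = Some F \<and> x \<in># arms F} = n"
      "Max {i. \<exists>F. ?T (i, c) = Some F \<and> n \<in># arms F} = r" "has_arms ?T" "arm_col ?T = c"
    using arm_source[OF v s] by blast
  obtain m where m: "k = enat m" using k by auto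
  have Hc: "H (Suc i) c \<le> a" using arms_okD(4)[OF al a, of i] Ha by simp
  have ir: "Suc i \<le> r"
  proof (rule ccontr)
    assume "\<not> Suc i \<le> r"
    then show False using tab_col_le[OF tab, of "Suc r" "Suc i" c] Hc r by simp
  qed
  have c1: "count (\<Lambda> i) k \<le> 1" using la by (simp add: arms_ok_def)
  have F': "F = filling H \<alpha> \<Lambda> r c" and r0: "0 < r" "H r c \<noteq> \<infinity>"
    using F by (auto simp: tableau_of_filling split: if_splits)
  have aP: "H p c \<le> a \<and> a < H (Suc p) c \<longleftrightarrow> p = r" for p
    using col_slot_unique[OF tab, of p c a r] r by blast
  have Hk: "H i (Suc c) < k" using Ha ak by (rule less_le_trans)
  have aH: "a \<le> H i (Suc (Suc c))" using ak kH by (rule order_trans)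
  \<comment> \<open>Both \<open>a\<close> and \<open>k\<close> fall into the leg range of cell
    \<open>(i, c + 1)\<close>, so their exchange is invisible in the other cells of the row.\<close>
  have L: "{y. enat y \<in># \<Lambda>' p \<and> H p q < enat y \<and> enat y \<le> H p (Suc q)} =
      {y. enat y \<in># \<Lambda> p \<and> H p q < enat y \<and> enat y \<le> H p (Suc q)}" if "(p, q) \<noteq> (i, Suc c)" for p q
  proof (cases "p = i")
    case True
    then have "q \<noteq> Suc c" using that by simp
    then have "\<not> (H i q < k \<and> k \<le> H i (Suc q))" "\<not> (H i q < a \<and> a \<le> H i (Suc q))"
      using row_slot_unique[OF tab Hk kH] row_slot_unique[OF tab Ha aH] by blast+
    then show ?thesis unfolding True \<Lambda>'_def in_swap_extra[where \<Lambda> = \<Lambda>, OF c1] using n m by auto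
  next
    case False
    then show ?thesis by (simp add: \<Lambda>'_def swap_extra_def)
  qed
  have C1: "?T' (p, q) = ?T (p, q)" if "q \<noteq> c" "q \<noteq> Suc c" for p q
    using that L[of p q] by (simp add: tableau_of_filling filling_def \<alpha>'_def move_def)
  have C2: "?T' (p, c) = ?T (p, c)" if "p \<noteq> r" for p
  proof -
    have "filter_mset (\<lambda>x. H p c \<le> x \<and> x < H (Suc p) c) (\<alpha>' c) =
        filter_mset (\<lambda>x. H p c \<le> x \<and> x < H (Suc p) c) (\<alpha> c)"
      using aP[of p] that unfolding \<alpha>'_def move_def by (auto simp: filter_remove)
    then show ?thesis using L[of p c] by (simp add: tableau_of_filling filling_def)
  qed
  have C3: "?T' (p, Suc c) = ?T (p, Suc c)" if p: "p \<noteq> i" for p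
  proof -
    have "\<not> (H p (Suc c) \<le> k \<and> k < H (Suc p) (Suc c))"
      using col_slot_unique[OF tab less_imp_le[OF Hk] kS] p by blast
    then have "filter_mset (\<lambda>x. H p (Suc c) \<le> x \<and> x < H (Suc p) (Suc c)) (single k) = {#}"
      using k by (auto simp: single_finite)
    then have "filling H \<alpha>' \<Lambda>' p (Suc c) = filling H \<alpha> \<Lambda> p (Suc c)"
      using p e L[of p "Suc c"] by (simp add: filling_def \<alpha>'_def move_def)
    then show ?thesis by (simp add: tableau_of_filling)
  qed
  have C4: "?T' (r, c) = Some (F\<lparr>legs := legs F - {}, arms := arms F - {#n#}\<rparr>)"
  proof -
    have "image_mset the_enat (filter_mset (\<lambda>x. H r c \<le> x \<and> x < H (Suc r) c) (\<alpha> c - {#a#})) = arms F - {#n#}"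
      using a r n unfolding F' filling_def filter_remove by (simp add: image_remove)
    then have "filling H \<alpha>' \<Lambda>' r c = F\<lparr>legs := legs F - {}, arms := arms F - {#n#}\<rparr>"
      using L[of r c] by (simp add: filling_def \<alpha>'_def move_def) (simp add: F' filling_def)
    then show ?thesis using r0 c0 by (simp add: tableau_of_filling)
  qed
  define G where "G = filling H \<alpha> \<Lambda> i (Suc c)"
  have G: "?T (i, Suc c) = Some G" using i0 lt_finite[OF Ha] by (simp add: tableau_of_filling G_def)
  note GD = tableau_ofD[OF v G]
  have Ge: "arms G = {#}" using e by (simp add: G_def filling_def)
  have mG: "m \<in> legs G" using GD(4) kL Hk kH m by simp
  have hG: "hook G \<noteq> m" using GD(3) Hk m by simp
  have C5: "?T' (i, Suc c) = Some (G\<lparr>legs := insert n (legs G - {m}), arms := {#m#}\<rparr>)"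
  proof -
    have "filter_mset (\<lambda>x. H i (Suc c) \<le> x \<and> x < H (Suc i) (Suc c)) (single k) = {#k#}"
      using k Hk kS by (auto simp: single_finite)
    moreover have "{y. enat y \<in># \<Lambda>' i \<and> H i (Suc c) < enat y \<and> enat y \<le> H i (Suc (Suc c))} = insert n (legs G - {m})"
      unfolding \<Lambda>'_def in_swap_extra[where \<Lambda> = \<Lambda>, OF c1] G_def filling_def
      using Ha aH n m by auto
    ultimately have "filling H \<alpha>' \<Lambda>' i (Suc c) = G\<lparr>legs := insert n (legs G - {m}), arms := {#m#}\<rparr>"
      using m by (simp add: filling_def \<alpha>'_def move_def) (simp add: G_def filling_def)
    then show ?thesis using i0 lt_finite[OF Ha] by (simp add: tableau_of_filling)
  qed
  have ast: "astep True (H, \<alpha>, \<Lambda>) None (H, \<alpha>', \<Lambda>')"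
    unfolding \<alpha>'_def \<Lambda>'_def by (rule astep_extraI[OF st k]) auto
  have "m \<in> entries G" using mG by (simp add: entries_def)
  then have mc: "m \<in> col_entries ?T (Suc c)" unfolding col_entries_def using G by blast
  have nm: "n \<le> m" using ak n m by simp
  have mn: "m \<le> x" if "x \<in> col_entries ?T (Suc c)" "n \<le> x" for x
  proof -
    have "present True (H, \<alpha>, \<Lambda>) (Suc c) (enat x)" using col_entries_tableau_of[where c = c, OF v e] that by simp
    then show ?thesis
      using astep_min_present[OF v ast[unfolded \<alpha>'_def] s, of "enat x"] that(2) n m by simp
  qed
  have min: "Min {x \<in> col_entries ?T (Suc c). n \<le> x} = m"
    by (rule Min_eqI) (use finite_entries_tableau_of[OF v] mn mc nm in auto)
  have least: "(LEAST i. \<exists>H. ?T (i, Suc c) = Some H \<and> m \<in> entries H) = i"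
  proof (rule Least_equality)
    show "\<exists>H. ?T (i, Suc c) = Some H \<and> m \<in> entries H" using G \<open>m \<in> entries G\<close> by blast
    fix p assume "\<exists>G. ?T (p, Suc c) = Some G \<and> m \<in> entries G"
    then obtain G where G: "?T (p, Suc c) = Some G" "m \<in> entries G" by blast
    note D = tableau_ofD[OF v G(1)]
    consider "H p (Suc c) = enat m" | "enat m \<in># \<Lambda> p" "H p (Suc c) < enat m" "enat m \<le> H p (Suc (Suc c))"
      using G(2) D(3,4,5) e by (auto simp: entries_def)
    then show "i \<le> p"
    proof cases
      case 1
      have "\<not> p \<le> i"
      proof
        assume "p \<le> i"
        then have "enat m < k" using tab_col_le[OF tab, of p i "Suc c"] Hk 1 by simp
        then show False using m by simp
      qed
      then show ?thesis by simp
    next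
      case 2
      have "k < H (Suc p) (Suc c)" using leg_upper[OF v 2(1,3)] m by simp
      then have "H i (Suc c) < H (Suc p) (Suc c)" using Hk by (rule less_trans[rotated])
      then have "\<not> Suc p \<le> i"
        using tab_col_le[OF tab, of "Suc p" i "Suc c"] by (meson leD)
      then show ?thesis by simp
    qed
  qed
  \<comment> \<open>The landing row \<open>i\<close> lies strictly below \<open>r\<close>, so no
    legs travel.\<close>
  have mv: "{} = (if i = r then {x \<in> legs F. n < x} else {})" using ir by simp
  have "arm_bump ?T = ?T((r, c) \<mapsto> F\<lparr>legs := legs F - {}, arms := arms F - {#n#}\<rparr>,
     (i, Suc c) \<mapsto> G\<lparr>legs := insert n (legs G - {m}), arms := {#m#}\<rparr>)"
    using arm_bump_old[OF sel(3,4,1,2) F min mc nm least G mv refl] Ge mG hG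
    by (cases G) (simp add: replace_entry_def)
  moreover have "?T((r, c) \<mapsto> F\<lparr>legs := legs F - {}, arms := arms F - {#n#}\<rparr>,
     (i, Suc c) \<mapsto> G\<lparr>legs := insert n (legs G - {m}), arms := {#m#}\<rparr>) = ?T'"
  proof (rule two_updates[where T' = ?T'])
    fix z :: cell
    assume z: "z \<noteq> (r, c)" "z \<noteq> (i, Suc c)"
    obtain x y where xy: "z = (x, y)" by (cases z)
    consider "y = c" | "y = Suc c" | "y \<noteq> c" "y \<noteq> Suc c" by blast
    then show "?T' z = ?T z" using C1[of y x] C2[of x] C3[of x] z unfolding xy by cases auto
  qed (rule C4 C5)+
  ultimately show ?thesis by (simp add: \<Lambda>'_def \<alpha>'_def)
qed

lemma arm_bump_astep:
  assumes v: "valid True s" and st: "astep True s g s'"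
  shows "arm_bump (tableau_of s) = tableau_of s'"
proof -
  obtain H \<alpha> \<Lambda> where s: "s = (H, \<alpha>, \<Lambda>)" by (cases s)
  show ?thesis
    using st[unfolded s] v[unfolded s]
  proof (cases rule: astepE)
    case (hook c a i)
    then show ?thesis using arm_bump_hook[OF v[unfolded s]] s by blast
  next
    case (extra c a i k)
    then show ?thesis using arm_bump_extra[OF v[unfolded s]] s by blast
  qed
qed

section \<open>Leg bumping in coordinates\<close>

lemma leg_source:
  assumes v: "valid True (H, \<alpha>, \<Lambda>)" and s: "source \<Lambda> r l"
  obtains n g F where "l = enat n" "tableau_of (H, \<alpha>, \<Lambda>) (r, g) = Some F" "H r g < l" "l \<le> H r (Suc g)"
    "Max {x. \<exists>j F. tableau_of (H, \<alpha>, \<Lambda>) (r, j) = Some F \<and> x \<in> legs F} = n"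
    "Max {j. \<exists>F. tableau_of (H, \<alpha>, \<Lambda>) (r, j) = Some F \<and> n \<in> legs F} = g"
    "has_legs (tableau_of (H, \<alpha>, \<Lambda>))" "leg_row (tableau_of (H, \<alpha>, \<Lambda>)) = r"
proof -
  have tab: "tab True H" and la: "arms_ok False (tp H) \<Lambda>" using v by auto
  have a: "l \<in># \<Lambda> r" "\<forall>x\<in>#\<Lambda> r. x \<le> l" using s by (auto simp: source_def)
  obtain n where n: "l = enat n" using arms_okD(3)[OF la a(1)] by auto
  obtain g F where g: "tableau_of (H, \<alpha>, \<Lambda>) (r, g) = Some F" "H r g < l" "l \<le> H r (Suc g)"
    using leg_location[OF v a(1)] by blast
  have "Max {x. \<exists>j F. tableau_of (H, \<alpha>, \<Lambda>) (r, j) = Some F \<and> x \<in> legs F} = n"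
    unfolding has_legs_tableau_of(3)[OF v] using Max_enat a n by blast
  moreover have "{j. \<exists>F. tableau_of (H, \<alpha>, \<Lambda>) (r, j) = Some F \<and> n \<in> legs F} = {g}"
  proof -
    have "n \<in> legs F" using tableau_ofD(4)[OF v g(1)] a g n by simp
    moreover have "j = g" if "tableau_of (H, \<alpha>, \<Lambda>) (r, j) = Some G" "n \<in> legs G" for j G
      using tableau_ofD(4)[OF v that(1)] that(2) row_slot_unique[OF tab g(2,3)] n by blast
    ultimately show ?thesis using g by blast
  qed
  moreover have "has_legs (tableau_of (H, \<alpha>, \<Lambda>))"
    unfolding has_legs_tableau_of(1)[OF v] using a by (metis empty_iff set_mset_empty)
  ultimately show ?thesis using that n g leg_row_tableau_of[OF v s] by simp
qed

text \<open>The transposed argument is carried out anew, because cells store legs as a set and arms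
  as a multiset and \<open>tableau_of\<close> has no symmetry to exploit. The travelling arms form a
  multiset, and those left behind are obtained by subtraction.\<close>

lemma leg_bump_hook:
  assumes v: "valid True (H, \<alpha>, \<Lambda>)" and st: "hook_step False (tp H) \<Lambda> \<alpha> r l j"
  shows "leg_bump (tableau_of (H, \<alpha>, \<Lambda>)) =
    tableau_of (set_hook H (Suc r) (Suc j) l, \<alpha>, move \<Lambda> r l (H (Suc r) (Suc j)))"
proof -
  let ?T = "tableau_of (H, \<alpha>, \<Lambda>)"
  define k where "k = H (Suc r) (Suc j)"
  define H' where "H' = set_hook H (Suc r) (Suc j) l"
  define \<Lambda>' where "\<Lambda>' = move \<Lambda> r l k"
  let ?T' = "tableau_of (H', \<alpha>, \<Lambda>')"
  have tab: "tab True H" and al: "arms_ok True H \<alpha>" and la: "arms_ok False (tp H) \<Lambda>" using v by auto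
  have s: "source \<Lambda> r l" and Hl: "H (Suc r) j \<le> l" and lk: "l < k"
    using st by (auto simp: hook_step_def slot_def k_def)
  have l: "l \<in># \<Lambda> r" and e: "\<Lambda> (Suc r) = {#}" using s by (auto simp: source_def)
  have r0: "0 < r" using arms_okD(1)[OF la l] .
  have c1: "count (\<Lambda> r) l \<le> 1" using la by (simp add: arms_ok_def)
  obtain n g F where n: "l = enat n" and F: "?T (r, g) = Some F" and g: "H r g < l" "l \<le> H r (Suc g)"
    and sel: "Max {x. \<exists>j F. ?T (r, j) = Some F \<and> x \<in> legs F} = n"
      "Max {j. \<exists>F. ?T (r, j) = Some F \<and> n \<in> legs F} = g" "has_legs ?T" "leg_row ?T = r"
    using leg_source[OF v s] by blast
  have Hc: "H r (Suc j) < l" using arms_okD(4)[OF la l, of j] Hl by simp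
  have jg: "Suc j \<le> g"
  proof (rule ccontr)
    assume "\<not> Suc j \<le> g"
    then show False using tab_row_le[OF tab, of "Suc g" "Suc j" r] Hc g by simp
  qed
  \<comment> \<open>Arms of column \<open>j + 1\<close> in the gap from \<open>l\<close> to
    \<open>k\<close> exist only if \<open>l\<close> comes from that column, which is when the
    definition moves arms.\<close>
  have arm_g: "Suc j = g" if x: "x \<in># \<alpha> (Suc j)" "l \<le> x" "x < k" for x
  proof (rule ccontr)
    assume "Suc j \<noteq> g"
    then have "H r (Suc (Suc j)) < x"
      using tab_row_le[OF tab, of "Suc (Suc j)" g r] jg g x by simp
    then have "k \<le> x" using arms_okD(4)[OF al x(1), of r] by (simp add: k_def)
    then show False using x by simp
  qed
  define mv where "mv = (if Suc j = g then {#x \<in># arms F. n \<le> x#} else {#})"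
  have F': "F = filling H \<alpha> \<Lambda> r g" and g0: "0 < g" "H r g \<noteq> \<infinity>"
    using F by (auto simp: tableau_of_filling split: if_splits)
  have H'o: "H' p q = (if p = Suc r \<and> q = Suc j then l else H p q)" for p q
    by (simp add: H'_def set_hook_def)
  have lP: "H r q < l \<and> l \<le> H r (Suc q) \<longleftrightarrow> q = g" for q
    using row_slot_unique[OF tab g, of q] g by blast
  have \<Lambda>r: "y \<in># \<Lambda>' r \<longleftrightarrow> y \<noteq> l \<and> y \<in># \<Lambda> r" for y
    using c1 by (cases "y = l") (auto simp: \<Lambda>'_def move_def in_diff_count in_remove_neq)
  have \<Lambda>s: "\<Lambda>' (Suc r) = single k" by (simp add: \<Lambda>'_def move_def)
  have C1: "?T' (p, q) = ?T (p, q)" if "p \<noteq> r" "p \<noteq> Suc r" for p q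
    using that by (simp add: tableau_of_filling filling_def H'o \<Lambda>'_def move_def)
  have C2: "?T' (r, q) = ?T (r, q)" if "q \<noteq> g" for q
  proof -
    have "x < l \<longleftrightarrow> x < k" if "x \<in># \<alpha> q" "q = Suc j" for x
      using arm_g[of x] that \<open>q \<noteq> g\<close> lk less_trans[of x l k] by (metis not_less)
    then have "filter_mset (\<lambda>x. H r q \<le> x \<and> x < H' (Suc r) q) (\<alpha> q) =
        filter_mset (\<lambda>x. H r q \<le> x \<and> x < H (Suc r) q) (\<alpha> q)"
      by (intro filter_mset_cong refl) (auto simp: H'o k_def)
    moreover have "{y. enat y \<in># \<Lambda>' r \<and> H r q < enat y \<and> enat y \<le> H r (Suc q)} =
        {y. enat y \<in># \<Lambda> r \<and> H r q < enat y \<and> enat y \<le> H r (Suc q)}"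
      using lP[of q] that unfolding \<Lambda>r by auto
    moreover have "H' r p = H r p" for p by (simp add: H'o)
    ultimately show ?thesis by (simp add: tableau_of_filling filling_def)
  qed
  have kP: "\<not> (H (Suc r) q < k \<and> k \<le> H (Suc r) (Suc q))" if "q \<noteq> j" for q
    using row_slot_unique[OF tab, of "Suc r" j k q] le_less_trans[OF Hl lk] that by (auto simp: k_def)
  have C3: "?T' (Suc r, q) = ?T (Suc r, q)" if q: "q \<noteq> Suc j" for q
  proof -
    have "{y. enat y \<in># single k \<and> H' (Suc r) q < enat y \<and> enat y \<le> H' (Suc r) (Suc q)} = {}"
      using kP[of q] q lk by (cases "k = \<infinity>"; cases "q = j") (auto simp: single_finite H'o)
    then have "filling H' \<alpha> \<Lambda>' (Suc r) q = filling H \<alpha> \<Lambda> (Suc r) q"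
      using q e by (simp add: filling_def \<Lambda>s) (simp add: H'o)
    then show ?thesis using q by (simp add: tableau_of_filling H'o)
  qed
  have fin: "the_enat x \<ge> n \<longleftrightarrow> x \<ge> l" if x: "x \<in># \<alpha> q" for x q
  proof -
    obtain i where "x = enat i" using arms_okD(3)[OF al x] by auto
    then show ?thesis using n by simp
  qed
  have C4: "?T' (r, g) = Some (F\<lparr>legs := legs F - {n}, arms := arms F - mv\<rparr>)"
  proof -
    have "{y. enat y \<in># \<Lambda>' r \<and> H r g < enat y \<and> enat y \<le> H r (Suc g)} = legs F - {n}"
      unfolding \<Lambda>r F' filling_def using n by auto
    moreover have "image_mset the_enat (filter_mset (\<lambda>x. H r g \<le> x \<and> x < H' (Suc r) g) (\<alpha> g)) = arms F - mv"
    proof (cases "Suc j = g")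
      case True
      have "arms F - mv = filter_mset (\<lambda>x. \<not> n \<le> x) (arms F)"
        using True unfolding mv_def by (simp add: multiset_partition[of "arms F" "\<lambda>x. n \<le> x", symmetric])
          (metis add_diff_cancel_left' multiset_partition)
      also have "\<dots> = image_mset the_enat (filter_mset (\<lambda>x. H r g \<le> x \<and> x < l) (\<alpha> g))"
        unfolding F' filling_def using True lk
        by (auto simp: filter_mset_image_mset filter_filter_mset k_def fin intro!: arg_cong[of _ _ "image_mset the_enat"] filter_mset_cong)
      finally show ?thesis using True by (simp add: H'o)
    next
      case False
      then show ?thesis by (simp add: mv_def F' filling_def H'o)
    qed
    moreover have "H' r p = H r p" for p by (simp add: H'o)
    ultimately have "filling H' \<alpha> \<Lambda>' r g = F\<lparr>legs := legs F - {n}, arms := arms F - mv\<rparr>"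
      by (simp add: filling_def) (simp add: F' filling_def)
    then show ?thesis using r0 g0 by (simp add: tableau_of_filling H'o)
  qed
  define ar where "ar = image_mset the_enat (filter_mset (\<lambda>x. k \<le> x \<and> x < H (Suc (Suc r)) (Suc j)) (\<alpha> (Suc j)))"
  have kH: "k \<le> H (Suc (Suc r)) (Suc j)" using tab_col_le[OF tab] by (simp add: k_def)
  have M5: "image_mset the_enat (filter_mset (\<lambda>x. l \<le> x \<and> x < H (Suc (Suc r)) (Suc j)) (\<alpha> (Suc j))) = ar + mv"
  proof -
    have "filter_mset (\<lambda>x. l \<le> x \<and> x < H (Suc (Suc r)) (Suc j)) (\<alpha> (Suc j)) =
        filter_mset (\<lambda>x. k \<le> x \<and> x < H (Suc (Suc r)) (Suc j)) (\<alpha> (Suc j)) +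
        filter_mset (\<lambda>x. l \<le> x \<and> x < k) (\<alpha> (Suc j))"
      using lk kH by (auto simp: multiset_eq_iff not_le not_less)
    moreover have "image_mset the_enat (filter_mset (\<lambda>x. l \<le> x \<and> x < k) (\<alpha> (Suc j))) = mv"
    proof (cases "Suc j = g")
      case True
      have "H r g \<le> x \<and> x < H (Suc r) g \<and> n \<le> the_enat x \<longleftrightarrow> l \<le> x \<and> x < k" if "x \<in># \<alpha> g" for x
        using fin[OF that] g(1) True less_le_trans[of "H r g" l x] unfolding k_def by auto
      then have "filter_mset (\<lambda>x. H r g \<le> x \<and> x < H (Suc r) g \<and> n \<le> the_enat x) (\<alpha> g) = filter_mset (\<lambda>x. l \<le> x \<and> x < k) (\<alpha> g)"
        by (intro filter_mset_cong) auto
      then show ?thesis using True unfolding mv_def F' filling_def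
        by (simp add: filter_mset_image_mset filter_filter_mset conj_ac)
    next
      case False
      then have "filter_mset (\<lambda>x. l \<le> x \<and> x < k) (\<alpha> (Suc j)) = {#}" using arm_g unfolding filter_mset_eq_mempty_iff by blast
      then show ?thesis using False by (simp add: mv_def)
    qed
    ultimately show ?thesis by (simp add: ar_def)
  qed
  define lg where "lg = {y. enat y \<in># single k}"
  have C5: "?T' (Suc r, Suc j) = Some \<lparr>hook = n, legs = lg, arms = ar + mv\<rparr>"
  proof -
    have "k \<le> H (Suc r) (Suc (Suc j))" using tab_row_le[OF tab] by (simp add: k_def)
    then have "{y. enat y \<in># single k \<and> l < enat y \<and> enat y \<le> H (Suc r) (Suc (Suc j))} = lg"
      using lk by (auto simp: lg_def single_def)
    then show ?thesis using n M5 by (simp add: tableau_of_filling filling_def H'o \<Lambda>s)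
  qed
  have ast: "astep False (tp H, \<Lambda>, \<alpha>) (grown (tp H) (Suc j) (Suc r)) (set_hook (tp H) (Suc j) (Suc r) l, move \<Lambda> r l k, \<alpha>)"
    by (rule astep_hookI[OF st]) (auto simp: k_def)
  have vt: "valid False (tp H, \<Lambda>, \<alpha>)" using valid_tr[OF v] by simp
  have "leg_bump ?T = ?T((r, g) \<mapsto> F\<lparr>legs := legs F - {n}, arms := arms F - mv\<rparr>,
     (Suc r, Suc j) \<mapsto> \<lparr>hook = n, legs = lg, arms = ar + mv\<rparr>)"
  proof (cases "k = \<infinity>")
    case True
    have "\<forall>x\<in>row_entries ?T (Suc r). \<not> n < x"
    proof
      fix x assume "x \<in> row_entries ?T (Suc r)"
      then have "present False (tp H, \<Lambda>, \<alpha>) (Suc r) (enat x)" using row_entries_tableau_of[where r = r, OF v e] by simp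
      with astep_no_present[OF vt _ s this] ast True n show "\<not> n < x" by (auto simp: grown_def k_def)
    qed
    moreover have "row_len ?T (Suc r) = j"
    proof -
      have "j' \<le> j \<longleftrightarrow> H (Suc r) j' \<noteq> \<infinity>" for j'
      proof (cases "j' \<le> j")
        case le: True
        have "H (Suc r) j' < k" using tab_row_le[OF tab le, of "Suc r"] le_less_trans[OF Hl lk] by (rule le_less_trans)
        then show ?thesis using le lt_finite by blast
      next
        case False
        then have "k \<le> H (Suc r) j'" using tab_row_le[OF tab, of "Suc j" j' "Suc r"] by (simp add: k_def)
        then show ?thesis using False True by simp
      qed
      then have "{j'. (Suc r, j') \<in> dom ?T} = {1..j}" unfolding dom_tableau_of by auto
      then show ?thesis by (simp add: row_len_def)
    qed
    moreover have "lg = {}" "ar = {#}" using True by (auto simp: lg_def ar_def filter_mset_eq_mempty_iff dest: arms_okD(3)[OF al])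
    ultimately show ?thesis
      using leg_bump_new[OF sel(3,4,1,2) F _ _ mv_def] True by simp
  next
    case False
    then obtain m where m: "k = enat m" by auto
    obtain G where G: "?T (Suc r, Suc j) = Some G" using False by (auto simp: tableau_of_filling k_def)
    have G': "G = \<lparr>hook = m, legs = {}, arms = ar\<rparr>"
      using G False m e unfolding tableau_of_filling filling_def ar_def k_def by auto
    have "present False (tp H, \<Lambda>, \<alpha>) (Suc r) (enat m)" using m by (auto simp: present_def k_def)
    then have mc: "m \<in> row_entries ?T (Suc r)" using row_entries_tableau_of[where r = r, OF v e] by simp
    have nm: "n < m" using lk n m by simp
    have mn: "m \<le> x" if "x \<in> row_entries ?T (Suc r)" "n < x" for x
    proof -
      have "present False (tp H, \<Lambda>, \<alpha>) (Suc r) (enat x)" using row_entries_tableau_of[where r = r, OF v e] that by simp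
      then show ?thesis
        using astep_min_present[OF vt ast s, of "enat x"] that(2) n m by simp
    qed
    have min: "Min {x \<in> row_entries ?T (Suc r). n < x} = m"
      by (rule Min_eqI) (use finite_entries_tableau_of[OF v] mn mc nm in auto)
    have least: "(LEAST j. \<exists>H. ?T (Suc r, j) = Some H \<and> m \<in> entries H) = Suc j"
    proof (rule Least_equality)
      show "\<exists>H. ?T (Suc r, Suc j) = Some H \<and> m \<in> entries H" using G G' by (simp add: entries_def)
      fix q assume "\<exists>G. ?T (Suc r, q) = Some G \<and> m \<in> entries G"
      then obtain G where G: "?T (Suc r, q) = Some G" "m \<in> entries G" by blast
      note D = tableau_ofD[OF v G(1)]
      have Hk: "H (Suc r) j < k" using Hl lk by (rule le_less_trans)
      consider "H (Suc r) q = enat m" | "enat m \<in># \<alpha> q" "H (Suc r) q \<le> enat m" "enat m < H (Suc (Suc r)) q"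
        using G(2) D(3,4,5) e by (auto simp: entries_def)
      then show "Suc j \<le> q"
      proof cases
        case 1
        have "\<not> q \<le> j"
        proof
          assume "q \<le> j"
          then have "enat m < k" using tab_row_le[OF tab, of q j "Suc r"] Hk 1 by simp
          then show False using m by simp
        qed
        then show ?thesis by simp
      next
        case 2
        have "k \<le> H (Suc r) (Suc q)" using arm_upper[OF v 2(1,3)] m by simp
        then have "H (Suc r) j < H (Suc r) (Suc q)" using Hk by (rule less_le_trans[rotated])
        then have "\<not> Suc q \<le> j"
          using tab_row_le[OF tab, of "Suc q" j "Suc r"] by (meson leD)
        \<comment> \<open>Rows increase only weakly, so \<open>m\<close> might also occur as an arm
          of the cell to the left; the side condition of the hook step puts such arms into a higher
          row.\<close>
        moreover have "q \<noteq> j"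
        proof
          assume "q = j"
          then have "H (Suc (Suc r)) j \<le> enat m" using st 2(1) lk m by (auto simp: hook_step_def)
          then show False using 2(3) \<open>q = j\<close> by simp
        qed
        ultimately show ?thesis by simp
      qed
    qed
    show ?thesis
      using leg_bump_old[OF sel(3,4,1,2) F min mc nm least G mv_def refl] G' m
      by (simp add: replace_entry_def single_finite lg_def)
  qed
  moreover have "?T((r, g) \<mapsto> F\<lparr>legs := legs F - {n}, arms := arms F - mv\<rparr>,
     (Suc r, Suc j) \<mapsto> \<lparr>hook = n, legs = lg, arms = ar + mv\<rparr>) = ?T'"
  proof (rule two_updates[where T' = ?T'])
    fix z :: cell
    assume z: "z \<noteq> (r, g)" "z \<noteq> (Suc r, Suc j)"
    obtain x y where xy: "z = (x, y)" by (cases z)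
    consider "x = r" | "x = Suc r" | "x \<noteq> r" "x \<noteq> Suc r" by blast
    then show "?T' z = ?T z" using C1[of x y] C2[of y] C3[of y] z unfolding xy by cases auto
  qed (rule C4 C5)+
  ultimately show ?thesis by (simp add: H'_def \<Lambda>'_def k_def)
qed

lemma leg_bump_extra:
  assumes v: "valid True (H, \<alpha>, \<Lambda>)" and st: "extra_step False (tp H) \<Lambda> \<alpha> r l j k" and k: "k \<noteq> \<infinity>"
  shows "leg_bump (tableau_of (H, \<alpha>, \<Lambda>)) = tableau_of (H, swap_extra \<alpha> j k l, move \<Lambda> r l k)"
proof -
  let ?T = "tableau_of (H, \<alpha>, \<Lambda>)"
  define \<alpha>' where "\<alpha>' = swap_extra \<alpha> j k l"
  define \<Lambda>' where "\<Lambda>' = move \<Lambda> r l k"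
  let ?T' = "tableau_of (H, \<alpha>', \<Lambda>')"
  have tab: "tab True H" and al: "arms_ok True H \<alpha>" and la: "arms_ok False (tp H) \<Lambda>" using v by auto
  have s: "source \<Lambda> r l" and Hl: "H (Suc r) j \<le> l" and lk: "l < k" and k\<alpha>: "k \<in># \<alpha> j"
    and kH: "k < H (Suc (Suc r)) j"
    using st by (auto simp: extra_step_def slot_def)
  have kS: "k \<le> H (Suc r) (Suc j)" using arm_upper[OF v k\<alpha> kH] .
  have l: "l \<in># \<Lambda> r" and e: "\<Lambda> (Suc r) = {#}" using s by (auto simp: source_def)
  have r0: "0 < r" using arms_okD(1)[OF la l] .
  have j0: "0 < j" using arms_okD(1)[OF al k\<alpha>] .
  have c1: "count (\<Lambda> r) l \<le> 1" using la by (simp add: arms_ok_def)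
  obtain n g F where n: "l = enat n" and F: "?T (r, g) = Some F" and g: "H r g < l" "l \<le> H r (Suc g)"
    and sel: "Max {x. \<exists>j F. ?T (r, j) = Some F \<and> x \<in> legs F} = n"
      "Max {j. \<exists>F. ?T (r, j) = Some F \<and> n \<in> legs F} = g" "has_legs ?T" "leg_row ?T = r"
    using leg_source[OF v s] by blast
  obtain m where m: "k = enat m" using k by auto
  have Hc: "H r (Suc j) < l" using arms_okD(4)[OF la l, of j] Hl by simp
  have jg: "Suc j \<le> g"
  proof (rule ccontr)
    assume "\<not> Suc j \<le> g"
    then show False using tab_row_le[OF tab, of "Suc g" "Suc j" r] Hc g by simp
  qed
  have F': "F = filling H \<alpha> \<Lambda> r g" and g0: "0 < g" "H r g \<noteq> \<infinity>"
    using F by (auto simp: tableau_of_filling split: if_splits)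
  have lP: "H r q < l \<and> l \<le> H r (Suc q) \<longleftrightarrow> q = g" for q
    using row_slot_unique[OF tab g, of q] g by blast
  have \<Lambda>r: "y \<in># \<Lambda>' r \<longleftrightarrow> y \<noteq> l \<and> y \<in># \<Lambda> r" for y
    using c1 by (cases "y = l") (auto simp: \<Lambda>'_def move_def in_diff_count in_remove_neq)
  have \<Lambda>s: "\<Lambda>' (Suc r) = {#k#}" using k by (simp add: \<Lambda>'_def move_def single_finite)
  have Hk: "H (Suc r) j < k" using Hl lk by (rule le_less_trans)
  have lH: "l < H (Suc (Suc r)) j" using lk kH by (rule less_trans)
  have M: "filter_mset (\<lambda>x. H p q \<le> x \<and> x < H (Suc p) q) (\<alpha>' q) = filter_mset (\<lambda>x. H p q \<le> x \<and> x < H (Suc p) q) (\<alpha> q)"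
    if "(p, q) \<noteq> (Suc r, j)" for p q
  proof (cases "q = j")
    case True
    then have "p \<noteq> Suc r" using that by simp
    then have "\<not> (H p j \<le> k \<and> k < H (Suc p) j)" "\<not> (H p j \<le> l \<and> l < H (Suc p) j)"
      using col_slot_unique[OF tab less_imp_le[OF Hk] kH] col_slot_unique[OF tab Hl lH] by blast+
    then show ?thesis unfolding True \<alpha>'_def swap_extra_def by (auto simp: filter_remove)
  next
    case False
    then show ?thesis by (simp add: \<alpha>'_def swap_extra_def)
  qed
  have C1: "?T' (p, q) = ?T (p, q)" if "p \<noteq> r" "p \<noteq> Suc r" for p q
    using that M[of p q] by (simp add: tableau_of_filling filling_def \<Lambda>'_def move_def)
  have C2: "?T' (r, q) = ?T (r, q)" if "q \<noteq> g" for q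
  proof -
    have "{y. enat y \<in># \<Lambda>' r \<and> H r q < enat y \<and> enat y \<le> H r (Suc q)} =
        {y. enat y \<in># \<Lambda> r \<and> H r q < enat y \<and> enat y \<le> H r (Suc q)}"
      using lP[of q] that unfolding \<Lambda>r by auto
    then show ?thesis using M[of r q] by (simp add: tableau_of_filling filling_def)
  qed
  have C3: "?T' (Suc r, q) = ?T (Suc r, q)" if q: "q \<noteq> j" for q
  proof -
    have "\<not> (H (Suc r) q < k \<and> k \<le> H (Suc r) (Suc q))"
      using row_slot_unique[OF tab Hk kS] q by blast
    then have "{y. enat y \<in># \<Lambda>' (Suc r) \<and> H (Suc r) q < enat y \<and> enat y \<le> H (Suc r) (Suc q)} = {}"
      unfolding \<Lambda>s by auto
    then show ?thesis using q e M[of "Suc r" q] by (simp add: tableau_of_filling filling_def)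
  qed
  have C4: "?T' (r, g) = Some (F\<lparr>legs := legs F - {n}, arms := arms F - {#}\<rparr>)"
  proof -
    have "{y. enat y \<in># \<Lambda>' r \<and> H r g < enat y \<and> enat y \<le> H r (Suc g)} = legs F - {n}"
      unfolding \<Lambda>r F' filling_def using n by auto
    then have "filling H \<alpha>' \<Lambda>' r g = F\<lparr>legs := legs F - {n}, arms := arms F - {#}\<rparr>"
      using M[of r g] by (simp add: filling_def) (simp add: F' filling_def)
    then show ?thesis using r0 g0 by (simp add: tableau_of_filling)
  qed
  define G where "G = filling H \<alpha> \<Lambda> (Suc r) j"
  have G: "?T (Suc r, j) = Some G" using j0 lt_finite[OF Hk] by (simp add: tableau_of_filling G_def)
  note GD = tableau_ofD[OF v G]
  have Ge: "legs G = {}" using e by (simp add: G_def filling_def)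
  have mG: "m \<in># arms G" using GD(5) k\<alpha> Hk kH m by simp
  have hG: "hook G \<noteq> m" using GD(3) Hk m by simp
  have C5: "?T' (Suc r, j) = Some (G\<lparr>legs := {m}, arms := add_mset n (arms G - {#m#})\<rparr>)"
  proof -
    have "image_mset the_enat (filter_mset (\<lambda>x. H (Suc r) j \<le> x \<and> x < H (Suc (Suc r)) j) (\<alpha>' j)) = add_mset n (arms G - {#m#})"
      using Hl lH Hk kH k\<alpha> n m unfolding \<alpha>'_def swap_extra_def G_def filling_def
      by (simp add: filter_remove image_remove)
    moreover have "{y. enat y \<in># \<Lambda>' (Suc r) \<and> H (Suc r) j < enat y \<and> enat y \<le> H (Suc r) (Suc j)} = {m}"
      unfolding \<Lambda>s using Hk kS m by auto
    ultimately have "filling H \<alpha>' \<Lambda>' (Suc r) j = G\<lparr>legs := {m}, arms := add_mset n (arms G - {#m#})\<rparr>"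
      by (simp add: filling_def) (simp add: G_def filling_def)
    then show ?thesis using j0 lt_finite[OF Hk] by (simp add: tableau_of_filling)
  qed
  have ast: "astep False (tp H, \<Lambda>, \<alpha>) None (tp H, move \<Lambda> r l k, swap_extra \<alpha> j k l)"
    by (rule astep_extraI[OF st k]) auto
  have vt: "valid False (tp H, \<Lambda>, \<alpha>)" using valid_tr[OF v] by simp
  have mE: "m \<in> entries G" using mG by (simp add: entries_def)
  then have mc: "m \<in> row_entries ?T (Suc r)" unfolding row_entries_def using G by blast
  have nm: "n < m" using lk n m by simp
  have mn: "m \<le> x" if "x \<in> row_entries ?T (Suc r)" "n < x" for x
  proof -
    have "present False (tp H, \<Lambda>, \<alpha>) (Suc r) (enat x)" using row_entries_tableau_of[where r = r, OF v e] that by simp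
    then show ?thesis
      using astep_min_present[OF vt ast s, of "enat x"] that(2) n m by simp
  qed
  have min: "Min {x \<in> row_entries ?T (Suc r). n < x} = m"
    by (rule Min_eqI) (use finite_entries_tableau_of[OF v] mn mc nm in auto)
  have least: "(LEAST j. \<exists>H. ?T (Suc r, j) = Some H \<and> m \<in> entries H) = j"
  proof (rule Least_equality)
    show "\<exists>H. ?T (Suc r, j) = Some H \<and> m \<in> entries H" using G mE by blast
    fix q assume "\<exists>G. ?T (Suc r, q) = Some G \<and> m \<in> entries G"
    then obtain G where G: "?T (Suc r, q) = Some G" "m \<in> entries G" by blast
    note D = tableau_ofD[OF v G(1)]
    consider "H (Suc r) q = enat m" | "enat m \<in># \<alpha> q" "H (Suc r) q \<le> enat m" "enat m < H (Suc (Suc r)) q"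
      using G(2) D(3,4,5) e by (auto simp: entries_def)
    then show "j \<le> q"
    proof cases
      case 1
      have "\<not> q \<le> j"
      proof
        assume "q \<le> j"
        then have "enat m < k" using tab_row_le[OF tab, of q j "Suc r"] Hk 1 by simp
        then show False using m by simp
      qed
      then show ?thesis by simp
    next
      case 2
      have "k \<le> H (Suc r) (Suc q)" using arm_upper[OF v 2(1,3)] m by simp
      then have "H (Suc r) j < H (Suc r) (Suc q)" using Hk by (rule less_le_trans[rotated])
      then have "\<not> Suc q \<le> j"
        using tab_row_le[OF tab, of "Suc q" j "Suc r"] by (meson leD)
      then show ?thesis by simp
    qed
  qed
  \<comment> \<open>The landing column \<open>j\<close> lies strictly to the left of
    \<open>g\<close>, so no arms travel.\<close>
  have mv: "{#} = (if j = g then {#x \<in># arms F. n \<le> x#} else {#})" using jg by simp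
  have "leg_bump ?T = ?T((r, g) \<mapsto> F\<lparr>legs := legs F - {n}, arms := arms F - {#}\<rparr>,
     (Suc r, j) \<mapsto> G\<lparr>legs := {m}, arms := add_mset n (arms G - {#m#})\<rparr>)"
    using leg_bump_old[OF sel(3,4,1,2) F min mc nm least G mv refl] Ge mG hG
    by (cases G) (simp add: replace_entry_def)
  moreover have "?T((r, g) \<mapsto> F\<lparr>legs := legs F - {n}, arms := arms F - {#}\<rparr>,
     (Suc r, j) \<mapsto> G\<lparr>legs := {m}, arms := add_mset n (arms G - {#m#})\<rparr>) = ?T'"
  proof (rule two_updates[where T' = ?T'])
    fix z :: cell
    assume z: "z \<noteq> (r, g)" "z \<noteq> (Suc r, j)"
    obtain x y where xy: "z = (x, y)" by (cases z)
    consider "x = r" | "x = Suc r" | "x \<noteq> r" "x \<noteq> Suc r" by blast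
    then show "?T' z = ?T z" using C1[of x y] C2[of y] C3[of y] z unfolding xy by cases auto
  qed (rule C4 C5)+
  ultimately show ?thesis by (simp add: \<Lambda>'_def \<alpha>'_def)
qed

lemma leg_bump_lstep:
  assumes v: "valid True s" and st: "lstep True s g s'"
  shows "leg_bump (tableau_of s) = tableau_of s'"
proof -
  obtain H \<alpha> \<Lambda> where s: "s = (H, \<alpha>, \<Lambda>)" by (cases s)
  show ?thesis
    using st[unfolded s] v[unfolded s]
  proof (cases rule: lstepE)
    case (hook r l j)
    then show ?thesis using leg_bump_hook[OF v[unfolded s], of r l j] s by simp
  next
    case (extra r l j k)
    then show ?thesis using leg_bump_extra[OF v[unfolded s], of r l j k] s by simp
  qed
qed

section \<open>From hook-valued tableaux to coordinates\<close>

definition grid_of :: "hv_tableau \<Rightarrow> grid" where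
  "grid_of T i j = (if i = 0 \<or> j = 0 then 0 else case T (i, j) of None \<Rightarrow> \<infinity> | Some F \<Rightarrow> enat (hook F))"

definition arms_of :: "hv_tableau \<Rightarrow> extras" where
  "arms_of T c = (\<Sum>i | (i, c) \<in> dom T. image_mset enat (arms (the (T (i, c)))))"

definition legs_of :: "hv_tableau \<Rightarrow> extras" where
  "legs_of T r = (\<Sum>j | (r, j) \<in> dom T. image_mset enat (mset_set (legs (the (T (r, j))))))"

lemma in_mset_sum_iff: "finite I \<Longrightarrow> x \<in># (\<Sum>i\<in>I. f i) \<longleftrightarrow> (\<exists>i\<in>I. x \<in># f i)"
  by (simp add: set_mset_sum)

lemma filter_mset_sum: "finite I \<Longrightarrow> filter_mset P (\<Sum>i\<in>I. f i) = (\<Sum>i\<in>I. filter_mset P (f i))"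
  by (induction I rule: finite_induct) auto

lemma sum_single: "finite I \<Longrightarrow> i \<in> I \<Longrightarrow> (\<And>j. j \<in> I \<Longrightarrow> j \<noteq> i \<Longrightarrow> f j = 0) \<Longrightarrow> sum f I = f i"
  using sum.mono_neutral_right[of I "{i}" f] by simp

lemma count_enat: "count (image_mset enat M) (enat n) = count M n"
  by (induction M) auto

text \<open>The entries of a cell are bounded by the hook to the right and strictly by the hook
  above. These two bounds give admissibility, and they also locate each entry in its column or row,
  so that decoding returns the original cells.\<close>

lemma encode:
  assumes T: "hook_valued_tableau T"
  shows "valid True (grid_of T, arms_of T, legs_of T)"
    and "tableau_of (grid_of T, arms_of T, legs_of T) = T"
proof -
  let ?H = "grid_of T"
  have yd: "young_diagram (dom T)" using T by (simp add: hook_valued_tableau_def)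
  have fin: "finite (dom T)" using yd by (simp add: young_diagram_def)
  have pos: "0 < i \<and> 0 < j" if "(i, j) \<in> dom T" for i j
  proof -
    have "case (i, j) of (i, j) \<Rightarrow> 1 \<le> i \<and> 1 \<le> j"
      using yd that unfolding young_diagram_def by blast
    then show ?thesis by simp
  qed
  have down: "(i', j') \<in> dom T" if "(i, j) \<in> dom T" "0 < i'" "i' \<le> i" "0 < j'" "j' \<le> j" for i j i' j'
    using yd that unfolding young_diagram_def by (metis One_nat_def Suc_leI)
  have ss: "0 < hook F" "finite (legs F)" "\<And>x. x \<in> legs F \<Longrightarrow> hook F < x" "\<And>x. x \<in># arms F \<Longrightarrow> hook F \<le> x"
    if "T p = Some F" for p F
    using T that ranI[of T p F] by (auto simp: hook_valued_tableau_def ssyt_hook_def)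
  have right: "x \<le> y" if "T (i, j) = Some F" "T (i, Suc j) = Some K" "x \<in> entries F" "y \<in> entries K" for i j F K x y
    using T that unfolding hook_valued_tableau_def by blast
  have up: "x < y" if "T (i, j) = Some F" "T (Suc i, j) = Some K" "x \<in> entries F" "y \<in> entries K" for i j F K x y
    using T that unfolding hook_valued_tableau_def by blast
  have he: "hook F \<in> entries F" for F by (simp add: entries_def)
  have H0: "?H i 0 = 0" "?H 0 j = 0" for i j by (auto simp: grid_of_def)
  have HS: "?H i j = enat (hook F)" if "T (i, j) = Some F" for i j F
    using that pos[of i j] by (auto simp: grid_of_def)
  have HN: "?H i j = \<infinity> \<longleftrightarrow> T (i, j) = None" if "0 < i" "0 < j" for i j
    using that by (auto simp: grid_of_def split: option.splits)
  have Hr: "enat x \<le> ?H i (Suc j)" if "T (i, j) = Some F" "x \<in> entries F" for i j F x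
  proof (cases "T (i, Suc j)")
    case None
    then have "?H i (Suc j) = \<infinity>" using HN[of i "Suc j"] pos[of i j] that(1) by auto
    then show ?thesis by simp
  next
    case (Some K)
    then show ?thesis using right[OF that(1) Some that(2) he] HS[OF Some] by simp
  qed
  have Hu: "enat x < ?H (Suc i) j" if "T (i, j) = Some F" "x \<in> entries F" for i j F x
  proof (cases "T (Suc i, j)")
    case None
    then have "?H (Suc i) j = \<infinity>" using HN[of "Suc i" j] pos[of i j] that(1) by auto
    then show ?thesis by simp
  next
    case (Some K)
    then show ?thesis using up[OF that(1) Some that(2) he] HS[OF Some] by simp
  qed
  have Hpos: "0 < ?H i j" if "0 < i" "0 < j" for i j
    using that ss(1) by (auto simp: grid_of_def zero_enat_def split: option.splits)
  have tab: "tab True ?H"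
    unfolding tab_def
  proof (intro conjI allI impI)
    fix i j :: nat
    show "?H i 0 = 0" "?H 0 j = 0" by (rule H0)+
    show "0 < ?H i j" if "0 < i" "0 < j" using Hpos that by blast
    show "cmp True (?H i j) (?H i (Suc j))" if i: "0 < i" and n: "?H i (Suc j) \<noteq> \<infinity>"
    proof (cases "j = 0")
      case False
      then have "(i, j) \<in> dom T" using down[of i "Suc j" i j] n i HN[of i "Suc j"] by auto
      then obtain F where F: "T (i, j) = Some F" by auto
      show ?thesis using Hr[OF F he] HS[OF F] by simp
    qed (simp add: H0)
    show "cmp (\<not> True) (?H i j) (?H (Suc i) j)" if j: "0 < j" and n: "?H (Suc i) j \<noteq> \<infinity>"
    proof (cases "i = 0")
      case False
      then have "(i, j) \<in> dom T" using down[of "Suc i" j i j] n j HN[of "Suc i" j] by auto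
      then obtain F where F: "T (i, j) = Some F" by auto
      show ?thesis using Hu[OF F he] HS[OF F] by simp
    next
      case True
      then show ?thesis using Hpos[of "Suc i" j] j by (simp add: H0)
    qed
  next
    have "{(i, j). 0 < i \<and> 0 < j \<and> ?H i j \<noteq> \<infinity>} = dom T"
    proof (intro set_eqI)
      fix p :: cell
      obtain i j where p: "p = (i, j)" by (cases p)
      show "p \<in> {(i, j). 0 < i \<and> 0 < j \<and> ?H i j \<noteq> \<infinity>} \<longleftrightarrow> p \<in> dom T"
        using HN[of i j] pos[of i j] unfolding p domIff mem_Collect_eq prod.case by metis
    qed
    then show "finite {(i, j). 0 < i \<and> 0 < j \<and> ?H i j \<noteq> \<infinity>}" using fin by (simp only:)
  qed
  have finc: "finite {i. (i, c) \<in> dom T}" for c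
    using finite_vimageI[OF fin, of "\<lambda>i. (i, c)"] by (simp add: vimage_def inj_on_def)
  have finr: "finite {j. (r, j) \<in> dom T}" for r
    using finite_vimageI[OF fin, of "\<lambda>j. (r, j)"] by (simp add: vimage_def inj_on_def)
  have inA: "x \<in># arms_of T c \<longleftrightarrow> (\<exists>i F n. T (i, c) = Some F \<and> n \<in># arms F \<and> x = enat n)" for x c
    unfolding arms_of_def in_mset_sum_iff[OF finc] by force
  have inL: "x \<in># legs_of T r \<longleftrightarrow> (\<exists>j F n. T (r, j) = Some F \<and> n \<in> legs F \<and> x = enat n)" for x r
    unfolding legs_of_def in_mset_sum_iff[OF finr]
  proof
    assume "\<exists>i\<in>{j. (r, j) \<in> dom T}. x \<in># image_mset enat (mset_set (legs (the (T (r, i)))))"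
    then obtain j F where "T (r, j) = Some F" "x \<in># image_mset enat (mset_set (legs F))" by auto
    then show "\<exists>j F n. T (r, j) = Some F \<and> n \<in> legs F \<and> x = enat n" using ss(2) by fastforce
  next
    assume "\<exists>j F n. T (r, j) = Some F \<and> n \<in> legs F \<and> x = enat n"
    then obtain j F n where "T (r, j) = Some F" "n \<in> legs F" "x = enat n" by blast
    then show "\<exists>i\<in>{j. (r, j) \<in> dom T}. x \<in># image_mset enat (mset_set (legs (the (T (r, i)))))"
      using ss(2) by (intro bexI[of _ j]) auto
  qed
  have locA: "?H i c \<le> enat n" "enat n < ?H (Suc i) c" "enat n \<le> ?H i (Suc c)"
    if "T (i, c) = Some F" "n \<in># arms F" for i c F n
  proof -
    have "n \<in> entries F" using that by (simp add: entries_def)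
    then show "enat n < ?H (Suc i) c" "enat n \<le> ?H i (Suc c)" using Hu Hr that by blast+
    show "?H i c \<le> enat n" using HS[OF that(1)] ss(4)[OF that] by simp
  qed
  have locL: "?H i c < enat n" "enat n < ?H (Suc i) c" "enat n \<le> ?H i (Suc c)"
    if "T (i, c) = Some F" "n \<in> legs F" for i c F n
  proof -
    have "n \<in> entries F" using that by (simp add: entries_def)
    then show "enat n < ?H (Suc i) c" "enat n \<le> ?H i (Suc c)" using Hu Hr that by blast+
    show "?H i c < enat n" using HS[OF that(1)] ss(3)[OF that] by simp
  qed
  have okA: "arms_ok True ?H (arms_of T)"
    unfolding arms_ok_def
  proof (intro conjI allI impI)
    fix c x assume "x \<in># arms_of T c"
    then obtain i F n where n: "T (i, c) = Some F" "n \<in># arms F" "x = enat n" using inA by blast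
    note l = locA[OF n(1,2)]
    show "0 < c" using pos[of i c] n(1) by auto
    have "0 < hook F" "hook F \<le> n" using ss(1,4)[OF n(1)] n(2) by auto
    then show "0 < x" using n(3) by (simp add: zero_enat_def)
    show "x < \<infinity>" using n(3) by simp
    fix i' assume *: "cmp (\<not> True) (?H i' (Suc c)) x"
    \<comment> \<open>An arm of row \<open>i\<close> is at most every hook of column
      \<open>c + 1\<close> from row \<open>i\<close> upward, so the premise holds only in lower
      rows.\<close>
    have "\<not> i \<le> i'"
    proof
      assume "i \<le> i'"
      then have "enat n \<le> ?H i' (Suc c)" using tab_col_le[OF tab] l(3) order_trans by blast
      then show False using * n(3) by simp
    qed
    then have "?H (Suc i') c \<le> ?H i c" using tab_col_le[OF tab, of "Suc i'" i c] by simp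
    then show "cmp True (?H (Suc i') c) x" using l(1) n(3) order_trans by simp
  qed simp
  have okL: "arms_ok False (tp ?H) (legs_of T)"
    unfolding arms_ok_def
  proof (intro conjI allI impI)
    fix r x assume "x \<in># legs_of T r"
    then obtain c F n where n: "T (r, c) = Some F" "n \<in> legs F" "x = enat n" using inL by blast
    note l = locL[OF n(1,2)]
    show "0 < r" using pos[of r c] n(1) by auto
    show "0 < x" using n(3) l(1) by (metis not_gr_zero not_less_zero)
    show "x < \<infinity>" using n(3) by simp
    fix j assume *: "cmp (\<not> False) (tp ?H j (Suc r)) x"
    have "\<not> c \<le> j"
    proof
      assume "c \<le> j"
      then have "?H (Suc r) c \<le> ?H (Suc r) j" using tab_row_le[OF tab] by blast
      then show False using * n(3) l(2) by simp
    qed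
    then have "?H r (Suc j) \<le> ?H r c" using tab_row_le[OF tab, of "Suc j" c r] by simp
    then show "cmp False (tp ?H (Suc j) r) x" using l(1) n(3) by simp
  next
    fix r x
    let ?f = "\<lambda>j. image_mset enat (mset_set (legs (the (T (r, j)))))"
    \<comment> \<open>Two cells of a row cannot share a leg: a leg exceeds its own hook, and that
      hook bounds all entries of the cells before it.\<close>
    show "count (legs_of T r) x \<le> 1"
    proof (cases "x \<in># legs_of T r")
      case False
      then have "count (legs_of T r) x = 0" by (rule not_in_iff[THEN iffD1])
      then show ?thesis by simp
    next
      case True
      then obtain c F n where n: "T (r, c) = Some F" "n \<in> legs F" "x = enat n" using inL by blast
      note l = locL[OF n(1,2)]
      have o: "count (?f j) x = 0" if j: "j \<in> {j. (r, j) \<in> dom T}" "j \<noteq> c" for j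
      proof (rule not_in_iff[THEN iffD1], rule notI)
        assume "x \<in># ?f j"
        moreover obtain G where "T (r, j) = Some G" using j(1) by auto
        ultimately have G: "T (r, j) = Some G" "n \<in> legs G" using ss(2) n(3) by auto
        note l' = locL[OF G]
        show False using row_slot_unique[OF tab l(1,3) l'(1,3)] j(2) by simp
      qed
      have "count (legs_of T r) x = (\<Sum>j | (r, j) \<in> dom T. count (?f j) x)"
        unfolding legs_of_def by (rule count_sum)
      also have "\<dots> = count (?f c) x"
        by (rule sum_single) (use finr o n(1) in auto)
      also have "\<dots> = count (mset_set (legs F)) n"
        using n(1,3) by (simp add: count_enat)
      finally show ?thesis using ss(2)[OF n(1)] n(2) by simp
    qed
  qed
  show v: "valid True (?H, arms_of T, legs_of T)" using tab okA okL by simp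
  show "tableau_of (?H, arms_of T, legs_of T) = T"
  proof
    fix p :: cell
    obtain i j where p: "p = (i, j)" by (cases p)
    show "tableau_of (?H, arms_of T, legs_of T) p = T p"
    proof (cases "T (i, j)")
      case None
      then show ?thesis unfolding p tableau_of_filling using HN[of i j] by (cases "0 < i \<and> 0 < j") auto
    next
      case (Some F)
      have ij: "0 < i" "0 < j" using pos[of i j] Some by auto
      have "filling ?H (arms_of T) (legs_of T) i j = F"
      proof -
        let ?f = "\<lambda>i. image_mset enat (arms (the (T (i, j))))"
        have "{y. enat y \<in># legs_of T i \<and> ?H i j < enat y \<and> enat y \<le> ?H i (Suc j)} = legs F"
        proof (intro set_eqI iffI)
          fix y assume y: "y \<in> {y. enat y \<in># legs_of T i \<and> ?H i j < enat y \<and> enat y \<le> ?H i (Suc j)}"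
          then obtain j' G where G: "T (i, j') = Some G" "y \<in> legs G" using inL by auto
          then have "j' = j" using row_slot_unique[OF tab, of i j "enat y" j'] locL[OF G] y by simp
          then show "y \<in> legs F" using G Some by simp
        next
          fix y assume "y \<in> legs F"
          then show "y \<in> {y. enat y \<in># legs_of T i \<and> ?H i j < enat y \<and> enat y \<le> ?H i (Suc j)}"
            using inL locL[OF Some] Some by blast
        qed
        moreover have "filter_mset (\<lambda>x. ?H i j \<le> x \<and> x < ?H (Suc i) j) (arms_of T j) = image_mset enat (arms F)"
        proof -
          let ?P = "\<lambda>x. ?H i j \<le> x \<and> x < ?H (Suc i) j"
          have "filter_mset ?P (arms_of T j) = (\<Sum>i' | (i', j) \<in> dom T. filter_mset ?P (?f i'))"
            unfolding arms_of_def by (rule filter_mset_sum[OF finc])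
          also have "\<dots> = filter_mset ?P (?f i)"
          proof (rule sum_single[OF finc])
            show "i \<in> {i'. (i', j) \<in> dom T}" using Some by auto
            fix i' assume i': "i' \<in> {i'. (i', j) \<in> dom T}" "i' \<noteq> i"
            then obtain G where G: "T (i', j) = Some G" by auto
            have "\<not> ?P (enat n)" if "n \<in># arms G" for n
              using col_slot_unique[OF tab, of i j "enat n" i'] locA[OF G that] i'(2) by blast
            then show "filter_mset ?P (?f i') = {#}" using G by auto
          qed
          also have "\<dots> = ?f i"
          proof -
            have "?P x" if "x \<in># ?f i" for x using locA[OF Some] that Some by auto
            then show ?thesis by (simp add: filter_mset_eq_conv)
          qed
          finally show ?thesis using Some by simp
        qed
        ultimately show ?thesis
          using HS[OF Some] by (cases F) (simp add: filling_def multiset.map_comp comp_def)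
      qed
      then show ?thesis unfolding p tableau_of_filling using HN[OF ij] Some ij by simp
    qed
  qed
qed

section \<open>Iterated bumps until the shape grows\<close>

lemma astep_dom:
  assumes "astep True s g s'" "valid True s"
  shows "dom (tableau_of s') = (case g of None \<Rightarrow> dom (tableau_of s) | Some x \<Rightarrow> insert x (dom (tableau_of s)))"
    and "g = Some x \<Longrightarrow> x \<notin> dom (tableau_of s)"
proof -
  obtain H \<alpha> \<Lambda> where s: "s = (H, \<alpha>, \<Lambda>)" by (cases s)
  have al: "arms_ok True H \<alpha>" using assms(2) s by simp
  have "dom (tableau_of s') = (case g of None \<Rightarrow> dom (tableau_of s) | Some x \<Rightarrow> insert x (dom (tableau_of s))) \<and>
     (\<forall>x. g = Some x \<longrightarrow> x \<notin> dom (tableau_of s))"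
    using assms(1,2)[unfolded s]
  proof (cases rule: astepE)
    case (hook c a i)
    then have "a \<noteq> \<infinity>" using arms_okD(3)[OF al, of a c] by (auto simp: hook_step_def source_def)
    then show ?thesis using hook(2) unfolding hook(3) s dom_tableau_of
      by (auto simp: grown_def set_hook_def split: if_splits)
  next
    case (extra c a i k)
    show ?thesis unfolding extra(2,4) s dom_tableau_of by simp
  qed
  then show "dom (tableau_of s') = (case g of None \<Rightarrow> dom (tableau_of s) | Some x \<Rightarrow> insert x (dom (tableau_of s)))"
    "g = Some x \<Longrightarrow> x \<notin> dom (tableau_of s)" by blast+
qed

lemma least_growth:
  assumes "\<forall>i\<le>m. dom ((f ^^ i) T) = dom T" "dom T \<subset> dom ((f ^^ Suc m) T)"
  shows "(LEAST m. dom T \<subset> dom ((f ^^ m) T)) = Suc m"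
proof (rule Least_equality)
  show "dom T \<subset> dom ((f ^^ Suc m) T)" by (rule assms(2))
  fix y assume y: "dom T \<subset> dom ((f ^^ y) T)"
  have "\<not> y \<le> m" using y assms(1) by blast
  then show "Suc m \<le> y" by simp
qed

text \<open>The steps before the last create no cell, so the length of a run is the least number of
  bumps in the definition of uncrowding.\<close>

lemma arun_iterate:
  assumes "arun True s x s'" "valid True s"
  shows "(\<exists>m. (arm_bump ^^ Suc m) (tableau_of s) = tableau_of s' \<and>
      (\<forall>i\<le>m. dom ((arm_bump ^^ i) (tableau_of s)) = dom (tableau_of s))) \<and>
    dom (tableau_of s') = insert x (dom (tableau_of s)) \<and> x \<notin> dom (tableau_of s)"
  using assms
proof (induction rule: arun.induct)
  case (last s x s')
  have "(arm_bump ^^ Suc 0) (tableau_of s) = tableau_of s'" using arm_bump_astep[OF last(2,1)] by simp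
  moreover have "\<forall>i\<le>0. dom ((arm_bump ^^ i) (tableau_of s)) = dom (tableau_of s)" by simp
  moreover have "dom (tableau_of s') = insert x (dom (tableau_of s))"
    using astep_dom(1)[OF last(1,2)] by simp
  moreover have "x \<notin> dom (tableau_of s)" by (rule astep_dom(2)[OF last(1,2) refl])
  ultimately show ?case by blast
next
  case (step s s1 x s')
  have v1: "valid True s1" using astep_valid[OF step(1,4)] .
  have d1: "dom (tableau_of s1) = dom (tableau_of s)" using astep_dom(1)[OF step(1,4)] by simp
  have b: "arm_bump (tableau_of s) = tableau_of s1" using arm_bump_astep[OF step(4,1)] .
  obtain m where m: "(arm_bump ^^ Suc m) (tableau_of s1) = tableau_of s'"
    "\<forall>i\<le>m. dom ((arm_bump ^^ i) (tableau_of s1)) = dom (tableau_of s1)" using step.IH[OF v1] by blast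
  have "(arm_bump ^^ Suc (Suc m)) (tableau_of s) = tableau_of s'"
    unfolding funpow_Suc_right[of "Suc m"] comp_def b m(1) ..
  moreover have "dom ((arm_bump ^^ i) (tableau_of s)) = dom (tableau_of s)" if "i \<le> Suc m" for i
  proof (cases i)
    case (Suc i')
    have "(arm_bump ^^ i) (tableau_of s) = (arm_bump ^^ i') (tableau_of s1)"
      unfolding Suc funpow_Suc_right comp_def b ..
    moreover have "i' \<le> m" using that Suc by simp
    ultimately show ?thesis using m(2) unfolding d1 by metis
  qed simp
  moreover have "dom (tableau_of s') = insert x (dom (tableau_of s))" "x \<notin> dom (tableau_of s)"
    using step.IH[OF v1] unfolding d1 by blast+
  ultimately show ?case by blast
qed

lemma lstep_dom:
  assumes "lstep True s g s'" "valid True s"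
  shows "dom (tableau_of s') = (case g of None \<Rightarrow> dom (tableau_of s) | Some x \<Rightarrow> insert x (dom (tableau_of s)))"
    and "g = Some x \<Longrightarrow> x \<notin> dom (tableau_of s)"
proof -
  obtain H \<alpha> \<Lambda> where s: "s = (H, \<alpha>, \<Lambda>)" by (cases s)
  have la: "arms_ok False (tp H) \<Lambda>" using assms(2) s by simp
  have "dom (tableau_of s') = (case g of None \<Rightarrow> dom (tableau_of s) | Some x \<Rightarrow> insert x (dom (tableau_of s))) \<and>
     (\<forall>x. g = Some x \<longrightarrow> x \<notin> dom (tableau_of s))"
    using assms(1,2)[unfolded s]
  proof (cases rule: lstepE)
    case (hook r l j)
    then have "l \<noteq> \<infinity>" using arms_okD(3)[OF la, of l r] by (auto simp: hook_step_def source_def)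
    then show ?thesis using hook(2) unfolding hook(3) s dom_tableau_of
      by (auto simp: grown_def set_hook_def split: if_splits)
  next
    case (extra r l j k)
    show ?thesis unfolding extra(2,4) s dom_tableau_of by simp
  qed
  then show "dom (tableau_of s') = (case g of None \<Rightarrow> dom (tableau_of s) | Some x \<Rightarrow> insert x (dom (tableau_of s)))"
    "g = Some x \<Longrightarrow> x \<notin> dom (tableau_of s)" by blast+
qed

lemma lrun_iterate:
  assumes "lrun True s x s'" "valid True s"
  shows "(\<exists>m. (leg_bump ^^ Suc m) (tableau_of s) = tableau_of s' \<and>
      (\<forall>i\<le>m. dom ((leg_bump ^^ i) (tableau_of s)) = dom (tableau_of s))) \<and>
    dom (tableau_of s') = insert x (dom (tableau_of s)) \<and> x \<notin> dom (tableau_of s)"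
  using assms
proof (induction rule: lrun.induct)
  case (last s x' s' x)
  have "(leg_bump ^^ Suc 0) (tableau_of s) = tableau_of s'" using leg_bump_lstep[OF last(3,1)] by simp
  moreover have "\<forall>i\<le>0. dom ((leg_bump ^^ i) (tableau_of s)) = dom (tableau_of s)" by simp
  moreover have "dom (tableau_of s') = insert x (dom (tableau_of s))"
    using lstep_dom(1)[OF last(1,3)] last(2) by simp
  moreover have "x \<notin> dom (tableau_of s)" by (rule lstep_dom(2)[OF last(1,3,2)])
  ultimately show ?case by blast
next
  case (step s s1 x s')
  have v1: "valid True s1" using lstep_valid[OF step(1,4)] .
  have d1: "dom (tableau_of s1) = dom (tableau_of s)" using lstep_dom(1)[OF step(1,4)] by simp
  have b: "leg_bump (tableau_of s) = tableau_of s1" using leg_bump_lstep[OF step(4,1)] .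
  obtain m where m: "(leg_bump ^^ Suc m) (tableau_of s1) = tableau_of s'"
    "\<forall>i\<le>m. dom ((leg_bump ^^ i) (tableau_of s1)) = dom (tableau_of s1)" using step.IH[OF v1] by blast
  have "(leg_bump ^^ Suc (Suc m)) (tableau_of s) = tableau_of s'"
    unfolding funpow_Suc_right[of "Suc m"] comp_def b m(1) ..
  moreover have "dom ((leg_bump ^^ i) (tableau_of s)) = dom (tableau_of s)" if "i \<le> Suc m" for i
  proof (cases i)
    case (Suc i')
    have "(leg_bump ^^ i) (tableau_of s) = (leg_bump ^^ i') (tableau_of s1)"
      unfolding Suc funpow_Suc_right comp_def b ..
    moreover have "i' \<le> m" using that Suc by simp
    ultimately show ?thesis using m(2) unfolding d1 by metis
  qed simp
  moreover have "dom (tableau_of s') = insert x (dom (tableau_of s))" "x \<notin> dom (tableau_of s)"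
    using step.IH[OF v1] unfolding d1 by blast+
  ultimately show ?case by blast
qed

section \<open>Uncrowding of decoded states\<close>

definition grows :: "hv_tableau \<Rightarrow> cell \<Rightarrow> hv_tableau \<Rightarrow> bool" where
  "grows T x T' \<longleftrightarrow> x \<notin> dom T \<and> dom T' = insert x (dom T)"

lemma grows_unique: "grows T x T' \<Longrightarrow> grows T y T' \<Longrightarrow> y = x"
  by (auto simp: grows_def)

lemma arm_uncrowd_arun:
  assumes r: "arun True s x s'" and v: "valid True s" and h: "has_arms (tableau_of s)"
  shows "arm_uncrowd (tableau_of s) = tableau_of s'" "grows (tableau_of s) x (tableau_of s')"
proof -
  show g: "grows (tableau_of s) x (tableau_of s')" using arun_iterate[OF r v] by (simp add: grows_def)
  obtain m where m: "(arm_bump ^^ Suc m) (tableau_of s) = tableau_of s'"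
      "\<forall>i\<le>m. dom ((arm_bump ^^ i) (tableau_of s)) = dom (tableau_of s)"
    using arun_iterate[OF r v] by blast
  have "dom (tableau_of s) \<subset> dom ((arm_bump ^^ Suc m) (tableau_of s))"
    using g unfolding m(1) grows_def by blast
  from least_growth[OF m(2) this] show "arm_uncrowd (tableau_of s) = tableau_of s'"
    using h m(1) by (simp add: arm_uncrowd_def)
qed

lemma leg_uncrowd_lrun:
  assumes r: "lrun True s x s'" and v: "valid True s" and h: "has_legs (tableau_of s)"
  shows "leg_uncrowd (tableau_of s) = tableau_of s'" "grows (tableau_of s) x (tableau_of s')"
proof -
  show g: "grows (tableau_of s) x (tableau_of s')" using lrun_iterate[OF r v] by (simp add: grows_def)
  obtain m where m: "(leg_bump ^^ Suc m) (tableau_of s) = tableau_of s'"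
      "\<forall>i\<le>m. dom ((leg_bump ^^ i) (tableau_of s)) = dom (tableau_of s)"
    using lrun_iterate[OF r v] by blast
  have "dom (tableau_of s) \<subset> dom ((leg_bump ^^ Suc m) (tableau_of s))"
    using g unfolding m(1) grows_def by blast
  from least_growth[OF m(2) this] show "leg_uncrowd (tableau_of s) = tableau_of s'"
    using h m(1) by (simp add: leg_uncrowd_def)
qed

text \<open>Decoded valid states are closed under uncrowding, and every hook-valued tableau is one
  of them; so the tableau conditions are examined only once, for the initial tableau.\<close>

definition good :: "hv_tableau \<Rightarrow> bool" where
  "good T \<longleftrightarrow> (\<exists>s. valid True s \<and> T = tableau_of s)"

lemma good_hook_valued: "hook_valued_tableau T \<Longrightarrow> good T"
  unfolding good_def using encode by metis

lemma good_young:
  assumes "good T" shows "young_diagram (dom T)"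
proof -
  obtain H \<alpha> \<Lambda> where v: "valid True (H, \<alpha>, \<Lambda>)" and T: "T = tableau_of (H, \<alpha>, \<Lambda>)"
    using assms unfolding good_def by (metis prod_cases3)
  have tab: "tab True H" using v by simp
  have "H i' j' \<noteq> \<infinity>" if "H i j \<noteq> \<infinity>" "i' \<le> i" "j' \<le> j" for i j i' j'
    using tab_row_le[OF tab that(3), of i'] tab_col_le[OF tab that(2), of j] that(1) le_finite order_trans by metis
  then have cl: "(i', j') \<in> {(i, j). 0 < i \<and> 0 < j \<and> H i j \<noteq> \<infinity>}"
    if "(i, j) \<in> {(i, j). 0 < i \<and> 0 < j \<and> H i j \<noteq> \<infinity>}" "1 \<le> i'" "i' \<le> i" "1 \<le> j'" "j' \<le> j" for i j i' j'
    using that unfolding mem_Collect_eq prod.case by (metis Suc_le_eq One_nat_def)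
  show ?thesis
    unfolding young_diagram_def T dom_tableau_of
  proof (intro conjI)
    show "finite {(i, j). 0 < i \<and> 0 < j \<and> H i j \<noteq> \<infinity>}" by (rule tab_finite[OF tab])
    show "\<forall>(i, j)\<in>{(i, j). 0 < i \<and> 0 < j \<and> H i j \<noteq> \<infinity>}. 1 \<le> i \<and> 1 \<le> j" by auto
  qed (intro allI impI, elim conjE, rule cl, assumption+)
qed

lemma bump_state:
  assumes v: "valid True s" and h: "has_arms (tableau_of s)"
  obtains a where "bump_col s (arm_col (tableau_of s)) a"
proof -
  obtain H \<alpha> \<Lambda> where s: "s = (H, \<alpha>, \<Lambda>)" by (cases s)
  note v' = v[unfolded s]
  obtain c where "\<alpha> c \<noteq> {#}" using h has_arms_tableau_of(1)[OF v'] unfolding s by blast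
  then obtain c a where "source \<alpha> c a" using source_exists[OF v'] by blast
  then show ?thesis using that[of a] arm_col_tableau_of[OF v'] unfolding s by simp
qed

lemma leg_state:
  assumes v: "valid True s" and h: "has_legs (tableau_of s)"
  obtains l where "bump_col (tr s) (leg_row (tableau_of s)) l"
proof -
  obtain H \<alpha> \<Lambda> where s: "s = (H, \<alpha>, \<Lambda>)" by (cases s)
  note v' = v[unfolded s]
  have vt: "valid False (tp H, \<Lambda>, \<alpha>)" using valid_tr[OF v'] by simp
  obtain r where "\<Lambda> r \<noteq> {#}" using h has_legs_tableau_of(1)[OF v'] unfolding s by blast
  then obtain r l where "source \<Lambda> r l" using source_exists[OF vt] by blast
  then show ?thesis using that[of l] leg_row_tableau_of[OF v'] unfolding s by simp
qed

lemma lrun_exists: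
  assumes "valid True s" "bump_col (tr s) r l"
  shows "\<exists>x s'. lrun True s x s'"
proof -
  obtain x s' where "arun False (tr s) x s'" using arun_exists[of False "tr s" r l] valid_tr[OF assms(1)] assms(2) by auto
  from arun_tr[OF this] have "lrun True s (prod.swap x) (tr s')" by simp
  then show ?thesis by blast
qed

lemma has_arms_cong:
  assumes "valid True s" "valid True s'" "\<And>j. size (fst (snd s') j) = size (fst (snd s) j)"
  shows "has_arms (tableau_of s') = has_arms (tableau_of s)" "arm_col (tableau_of s') = arm_col (tableau_of s)"
proof -
  obtain H \<alpha> \<Lambda> where s: "s = (H, \<alpha>, \<Lambda>)" by (cases s)
  obtain H' \<alpha>' \<Lambda>' where s': "s' = (H', \<alpha>', \<Lambda>')" by (cases s')
  have *: "\<alpha>' j = {#} \<longleftrightarrow> \<alpha> j = {#}" for j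
    using assms(3)[of j] unfolding s s' by (metis fst_conv snd_conv size_eq_0_iff_empty)
  show "has_arms (tableau_of s') = has_arms (tableau_of s)"
    unfolding s s' has_arms_tableau_of(1)[OF assms(1)[unfolded s]] has_arms_tableau_of(1)[OF assms(2)[unfolded s']] * ..
  show "arm_col (tableau_of s') = arm_col (tableau_of s)"
    unfolding arm_col_def s s' has_arms_tableau_of(2)[OF assms(1)[unfolded s]] has_arms_tableau_of(2)[OF assms(2)[unfolded s']] * ..
qed

lemma has_legs_cong:
  assumes "valid True s" "valid True s'" "\<And>j. size (snd (snd s') j) = size (snd (snd s) j)"
  shows "has_legs (tableau_of s') = has_legs (tableau_of s)" "leg_row (tableau_of s') = leg_row (tableau_of s)"
proof -
  obtain H \<alpha> \<Lambda> where s: "s = (H, \<alpha>, \<Lambda>)" by (cases s)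
  obtain H' \<alpha>' \<Lambda>' where s': "s' = (H', \<alpha>', \<Lambda>')" by (cases s')
  have *: "\<Lambda>' j = {#} \<longleftrightarrow> \<Lambda> j = {#}" for j
    using assms(3)[of j] unfolding s s' by (metis snd_conv size_eq_0_iff_empty)
  show "has_legs (tableau_of s') = has_legs (tableau_of s)"
    unfolding s s' has_legs_tableau_of(1)[OF assms(1)[unfolded s]] has_legs_tableau_of(1)[OF assms(2)[unfolded s']] * ..
  show "leg_row (tableau_of s') = leg_row (tableau_of s)"
    unfolding leg_row_def s s' has_legs_tableau_of(2)[OF assms(1)[unfolded s]] has_legs_tableau_of(2)[OF assms(2)[unfolded s']] * ..
qed

lemma arun_leg_sizes:
  assumes "arun True s x s'" "valid True s"
  shows "size (snd (snd s') j) = size (snd (snd s) j)"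
proof -
  have *: "fst (snd (tr t)) = snd (snd t)" for t by (cases t) simp
  show ?thesis
    using lrun_sizes[OF arun_tr[OF assms(1)], of j] valid_tr[OF assms(2)] by (simp add: *)
qed

section \<open>The uncrowding maps\<close>

lemma sum_size_filter:
  assumes "finite I" "\<And>x. x \<in># M \<Longrightarrow> \<exists>!i. P i x" "\<And>x i. x \<in># M \<Longrightarrow> P i x \<Longrightarrow> i \<in> I"
  shows "(\<Sum>i\<in>I. size (filter_mset (P i) M)) = size M"
  using assms(2,3)
proof (induction M)
  case (add x M)
  obtain i where i: "P i x" "\<And>j. P j x \<Longrightarrow> j = i" using add.prems(1)[of x] by auto
  have "i \<in> I" using add.prems(2)[of x i] i(1) by simp
  have "(\<Sum>j\<in>I. size (filter_mset (P j) (add_mset x M))) =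
      (\<Sum>j\<in>I. size (filter_mset (P j) M) + (if j = i then 1 else 0))"
  proof (rule sum.cong[OF refl])
    fix j
    have "\<not> P j x" if "j \<noteq> i" using i(2) that by blast
    then show "size (filter_mset (P j) (add_mset x M)) = size (filter_mset (P j) M) + (if j = i then 1 else 0)"
      using i(1) by (cases "j = i") simp_all
  qed
  also have "\<dots> = (\<Sum>j\<in>I. size (filter_mset (P j) M)) + 1"
    using assms(1) \<open>i \<in> I\<close> by (simp add: sum.distrib)
  also have "(\<Sum>j\<in>I. size (filter_mset (P j) M)) = size M"
  proof (rule add.IH)
    show "\<exists>!i. P i x'" if "x' \<in># M" for x' using add.prems(1)[of x'] that by simp
    show "i \<in> I" if "x' \<in># M" "P i x'" for x' i using add.prems(2)[of x' i] that by simp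
  qed
  finally show ?case by simp
qed simp

text \<open>Double counting with abstract locations: each element of line \<open>j\<close> lies in
  exactly one cell of that line. It serves arms with columns as lines and, after swapping
  coordinates, legs with rows as lines.\<close>

lemma sum_located:
  fixes M :: "nat \<Rightarrow> 'a multiset"
  assumes D: "finite D" and in_D: "\<And>i j x. x \<in># M j \<Longrightarrow> P i j x \<Longrightarrow> (i, j) \<in> D"
    and uniq: "\<And>j x. x \<in># M j \<Longrightarrow> \<exists>!i. P i j x"
    and C: "finite C" "\<And>j. j \<notin> C \<Longrightarrow> M j = {#}"
  shows "(\<Sum>(i, j)\<in>D. size (filter_mset (P i j) (M j))) = (\<Sum>j\<in>C. size (M j))"
proof -
  define I where "I = fst ` D"
  define J where "J = C \<union> snd ` D"
  have f: "finite I" "finite J" using D C by (auto simp: I_def J_def)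
  have sub: "D \<subseteq> I \<times> J"
  proof
    fix p assume p: "p \<in> D"
    show "p \<in> I \<times> J"
      unfolding mem_Times_iff I_def J_def using imageI[OF p, of fst] imageI[OF p, of snd] by blast
  qed
  have e: "filter_mset (P i j) (M j) = {#}" if "(i, j) \<notin> D" for i j
    unfolding filter_mset_eq_mempty_iff using in_D that by blast
  have "(\<Sum>(i, j)\<in>D. size (filter_mset (P i j) (M j))) = (\<Sum>(i, j)\<in>I \<times> J. size (filter_mset (P i j) (M j)))"
  proof (rule sum.mono_neutral_left[OF finite_cartesian_product[OF f] sub], rule ballI)
    fix p assume p: "p \<in> I \<times> J - D"
    obtain i j where ij: "p = (i, j)" by (cases p)
    have "(i, j) \<notin> D" using p ij by blast
    from e[OF this] show "(case p of (i, j) \<Rightarrow> size (filter_mset (P i j) (M j))) = 0"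
      unfolding ij prod.case by (simp only: size_empty)
  qed
  also have "\<dots> = (\<Sum>i\<in>I. \<Sum>j\<in>J. size (filter_mset (P i j) (M j)))"
    by (rule sum.cartesian_product[symmetric])
  also have "\<dots> = (\<Sum>j\<in>J. \<Sum>i\<in>I. size (filter_mset (P i j) (M j)))"
    by (rule sum.swap)
  also have "\<dots> = (\<Sum>j\<in>J. size (M j))"
  proof (rule sum.cong[OF refl])
    fix j
    show "(\<Sum>i\<in>I. size (filter_mset (P i j) (M j))) = size (M j)"
    proof (rule sum_size_filter[OF f(1)])
      fix x i assume "x \<in># M j" "P i j x"
      then have "(i, j) \<in> D" by (rule in_D)
      then show "i \<in> I" unfolding I_def by (rule rev_image_eqI) simp
    qed (rule uniq)
  qed
  also have "\<dots> = (\<Sum>j\<in>C. size (M j))"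
  proof (rule sum.mono_neutral_right[OF f(2)], goal_cases)
    case 1
    then show ?case unfolding J_def by (rule Un_upper1)
  next
    case 2
    then show ?case using C(2) by (auto simp only: size_empty Diff_iff)
  qed
  finally show ?thesis .
qed

lemma num_arms_tableau_of:
  assumes v: "valid True (H, \<alpha>, \<Lambda>)" and C: "finite C" "\<And>j. j \<notin> C \<Longrightarrow> \<alpha> j = {#}"
  shows "num_arms (tableau_of (H, \<alpha>, \<Lambda>)) = (\<Sum>j\<in>C. size (\<alpha> j))"
proof -
  have tab: "tab True H" using v by simp
  let ?P = "\<lambda>i j x. H i j \<le> x \<and> x < H (Suc i) j"
  let ?D = "dom (tableau_of (H, \<alpha>, \<Lambda>))"
  have loc: "(i, j) \<in> ?D \<and> (\<exists>!i. ?P i j x)" if x: "x \<in># \<alpha> j" "?P i j x" for i j x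
  proof -
    obtain r F where r: "tableau_of (H, \<alpha>, \<Lambda>) (r, j) = Some F" "?P r j x" using arm_location[OF v x(1)] by blast
    have u: "i = r" if "?P i j x" for i using col_slot_unique[OF tab, of r j x i] r(2) that by blast
    have "(r, j) \<in> ?D" using r(1) by (rule domI)
    moreover have "\<exists>!i. ?P i j x" by (rule ex1I[of _ r]) (rule r(2), rule u)
    ultimately show ?thesis using u[OF x(2)] by simp
  qed
  have "num_arms (tableau_of (H, \<alpha>, \<Lambda>)) = (\<Sum>(i, j)\<in>?D. size (filter_mset (?P i j) (\<alpha> j)))"
    unfolding num_arms_def
  proof (rule sum.cong[OF refl])
    fix p assume "p \<in> ?D"
    moreover obtain i j where p: "p = (i, j)" by (cases p)
    ultimately have "the (tableau_of (H, \<alpha>, \<Lambda>) p) = filling H \<alpha> \<Lambda> i j"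
      by (auto simp: tableau_of_filling split: if_splits)
    then show "size (arms (the (tableau_of (H, \<alpha>, \<Lambda>) p))) = (case p of (i, j) \<Rightarrow> size (filter_mset (?P i j) (\<alpha> j)))"
      by (simp add: filling_def p)
  qed
  also have "\<dots> = (\<Sum>j\<in>C. size (\<alpha> j))"
  proof (rule sum_located[OF _ _ _ C])
    show "finite ?D" unfolding dom_tableau_of by (rule tab_finite[OF tab])
    show "(i, j) \<in> ?D" if "x \<in># \<alpha> j" "?P i j x" for i j x using loc[OF that] by (rule conjunct1)
    show "\<exists>!i. ?P i j x" if x: "x \<in># \<alpha> j" for j x
    proof -
      obtain r where "?P r j x" using arm_location[OF v x] by blast
      from loc[OF x this] show ?thesis by (rule conjunct2)
    qed
  qed
  finally show ?thesis .
qed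

text \<open>A state keeps legs as a multiset and a cell keeps them as a set; with multiplicities at
  most one the sizes agree.\<close>

lemma card_eq_size:
  assumes "\<And>x. count M x \<le> 1" "\<And>x. x \<in># M \<Longrightarrow> x < \<infinity>"
  shows "card {y. enat y \<in># M \<and> P (enat y)} = size (filter_mset P M)"
proof -
  let ?N = "filter_mset P M"
  have "enat ` {y. enat y \<in># M \<and> P (enat y)} = set_mset ?N"
  proof (intro set_eqI iffI)
    fix x assume x: "x \<in># ?N"
    then have "x < \<infinity>" using assms(2)[of x] by simp
    then obtain y where y: "x = enat y" by auto
    show "x \<in> enat ` {y. enat y \<in># M \<and> P (enat y)}"
      unfolding y by (rule imageI) (use x y in simp)
  next
    fix x assume "x \<in> enat ` {y. enat y \<in># M \<and> P (enat y)}"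
    then show "x \<in># ?N" by auto
  qed
  moreover have "card (enat ` {y. enat y \<in># M \<and> P (enat y)}) = card {y. enat y \<in># M \<and> P (enat y)}"
    by (rule card_image) (simp add: inj_on_def)
  ultimately have "card {y. enat y \<in># M \<and> P (enat y)} = card (set_mset ?N)" by simp
  also have "\<dots> = (\<Sum>x\<in>set_mset ?N. count ?N x)"
  proof -
    have "count ?N x = 1" if x: "x \<in># ?N" for x
    proof -
      have "0 < count ?N x" using x by (rule count_greater_zero_iff[THEN iffD2])
      moreover have "count ?N x \<le> count M x" by simp
      ultimately show ?thesis using assms(1)[of x] by linarith
    qed
    then have "(\<Sum>x\<in>set_mset ?N. count ?N x) = (\<Sum>x\<in>set_mset ?N. 1)" by (rule sum.cong[OF refl])
    then show ?thesis by simp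
  qed
  also have "\<dots> = size ?N" by (simp add: size_multiset_overloaded_eq)
  finally show ?thesis .
qed

lemma num_legs_tableau_of:
  assumes v: "valid True (H, \<alpha>, \<Lambda>)" and C: "finite C" "\<And>j. j \<notin> C \<Longrightarrow> \<Lambda> j = {#}"
  shows "num_legs (tableau_of (H, \<alpha>, \<Lambda>)) = (\<Sum>j\<in>C. size (\<Lambda> j))"
proof -
  have tab: "tab True H" and la: "arms_ok False (tp H) \<Lambda>" using v by auto
  let ?P = "\<lambda>j i x. H i j < x \<and> x \<le> H i (Suc j)"
  let ?D = "dom (tableau_of (H, \<alpha>, \<Lambda>))"
  have loc: "(i, j) \<in> ?D \<and> (\<exists>!j. ?P j i x)" if x: "x \<in># \<Lambda> i" "?P j i x" for i j x
  proof -
    obtain r F where r: "tableau_of (H, \<alpha>, \<Lambda>) (i, r) = Some F" "?P r i x" using leg_location[OF v x(1)] by blast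
    have u: "j = r" if "?P j i x" for j using row_slot_unique[OF tab, of i r x j] r(2) that by blast
    have "(i, r) \<in> ?D" using r(1) by (rule domI)
    moreover have "\<exists>!j. ?P j i x" by (rule ex1I[of _ r]) (rule r(2), rule u)
    ultimately show ?thesis using u[OF x(2)] by simp
  qed
  have "num_legs (tableau_of (H, \<alpha>, \<Lambda>)) = (\<Sum>(i, j)\<in>?D. size (filter_mset (?P j i) (\<Lambda> i)))"
    unfolding num_legs_def
  proof (rule sum.cong[OF refl])
    fix p assume "p \<in> ?D"
    moreover obtain i j where p: "p = (i, j)" by (cases p)
    ultimately have "the (tableau_of (H, \<alpha>, \<Lambda>) p) = filling H \<alpha> \<Lambda> i j"
      by (auto simp: tableau_of_filling split: if_splits)
    moreover have "card {y. enat y \<in># \<Lambda> i \<and> ?P j i (enat y)} = size (filter_mset (?P j i) (\<Lambda> i))"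
      by (rule card_eq_size) (use la in \<open>simp_all add: arms_ok_def\<close>)
    ultimately show "card (legs (the (tableau_of (H, \<alpha>, \<Lambda>) p))) = (case p of (i, j) \<Rightarrow> size (filter_mset (?P j i) (\<Lambda> i)))"
      by (simp add: filling_def p)
  qed
  also have "\<dots> = (\<Sum>(j, i)\<in>prod.swap ` ?D. size (filter_mset (?P j i) (\<Lambda> i)))"
    by (subst sum.reindex) (auto simp: case_prod_beta inj_on_def)
  also have "\<dots> = (\<Sum>j\<in>C. size (\<Lambda> j))"
  proof (rule sum_located[OF _ _ _ C])
    show "finite (prod.swap ` ?D)" unfolding dom_tableau_of by (rule finite_imageI[OF tab_finite[OF tab]])
    show "(j, i) \<in> prod.swap ` ?D" if "x \<in># \<Lambda> i" "?P j i x" for i j x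
      using imageI[OF conjunct1[OF loc[OF that]], of prod.swap] by simp
    show "\<exists>!j. ?P j i x" if x: "x \<in># \<Lambda> i" for i x
    proof -
      obtain r where "?P r i x" using leg_location[OF v x] by blast
      from loc[OF x this] show ?thesis by (rule conjunct2)
    qed
  qed
  finally show ?thesis .
qed

section \<open>Facts about one uncrowding step\<close>

lemma source_after:
  assumes "source \<alpha> c a" "source (\<alpha>(c := \<alpha> c - {#a#})) c' a'"
  shows "c' \<le> c"
proof (rule ccontr)
  assume "\<not> c' \<le> c"
  then have "c < c'" by simp
  then show False using assms by (simp add: source_def)
qed

lemma sum_size_after:
  assumes "source \<alpha> c a"
  shows "(\<Sum>j\<le>c. size ((\<alpha>(c := \<alpha> c - {#a#})) j)) < (\<Sum>j\<le>c. size (\<alpha> j))"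
proof (rule sum_strict_mono_ex1)
  have "size (\<alpha> c - {#a#}) < size (\<alpha> c)" using assms by (simp add: source_def size_Diff1_less)
  then show "\<exists>j\<in>{..c}. size ((\<alpha>(c := \<alpha> c - {#a#})) j) < size (\<alpha> j)" by auto
  show "\<forall>j\<in>{..c}. size ((\<alpha>(c := \<alpha> c - {#a#})) j) \<le> size (\<alpha> j)" by (auto simp: size_mset_mono)
qed simp

text \<open>Collects what the treatment of words needs, so that states need not appear there. The
  next index is not larger because the run only deletes an arm from column \<open>c\<close>; if it
  is equal, the next new cell is further right by \<open>arun_col_strict\<close>.\<close>

lemma good_arm_step:
  assumes "good T" "has_arms T"
  shows "\<exists>x. good (arm_uncrowd T) \<and> grows T x (arm_uncrowd T) \<and> 0 < arm_col T \<and> arm_col T < snd x \<and>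
     (has_arms (arm_uncrowd T) \<longrightarrow> arm_col (arm_uncrowd T) \<le> arm_col T \<and>
       (arm_col (arm_uncrowd T) = arm_col T \<longrightarrow>
         (\<forall>y. grows (arm_uncrowd T) y (arm_uncrowd (arm_uncrowd T)) \<longrightarrow> snd x < snd y))) \<and>
     num_arms (arm_uncrowd T) < num_arms T \<and>
     has_legs (arm_uncrowd T) = has_legs T \<and> leg_row (arm_uncrowd T) = leg_row T"
proof -
  obtain s where v: "valid True s" and T: "T = tableau_of s" using assms(1) by (auto simp: good_def)
  define c where "c = arm_col T"
  obtain a where a: "bump_col s c a" using bump_state[OF v] assms(2) T c_def by blast
  obtain x s' where r: "arun True s x s'" using arun_exists[OF v a] by blast
  have v': "valid True s'" using arun_valid[OF r v] .
  note u = arm_uncrowd_arun[OF r v assms(2)[unfolded T]]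
  note col = arun_col[OF r v a]
  obtain H \<alpha> \<Lambda> where s: "s = (H, \<alpha>, \<Lambda>)" by (cases s)
  obtain H' \<alpha>' \<Lambda>' where s': "s' = (H', \<alpha>', \<Lambda>')" by (cases s')
  have so: "source \<alpha> c a" using a s by simp
  have \<alpha>': "\<alpha>' = \<alpha>(c := \<alpha> c - {#a#})" using col s s' by simp
  have c0: "0 < c" using arms_okD(1)[of True H \<alpha> a c] so v s by (simp add: source_def)
  have e: "\<alpha> j = {#}" "\<alpha>' j = {#}" if "j \<notin> {..c}" for j using so that by (auto simp: source_def \<alpha>')
  have num: "num_arms (tableau_of s') < num_arms (tableau_of s)"
    using num_arms_tableau_of[OF v[unfolded s], of "{..c}"] num_arms_tableau_of[OF v'[unfolded s'], of "{..c}"]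
      sum_size_after[OF so] e unfolding s s' \<alpha>' by simp
  have nx: "arm_col (tableau_of s') \<le> c \<and> (arm_col (tableau_of s') = c \<longrightarrow>
      (\<forall>y. grows (tableau_of s') y (arm_uncrowd (tableau_of s')) \<longrightarrow> snd x < snd y))"
    if h: "has_arms (tableau_of s')"
  proof -
    obtain a' where a': "bump_col s' (arm_col (tableau_of s')) a'" using bump_state[OF v' h] by blast
    obtain z t where z: "arun True s' z t" using arun_exists[OF v' a'] by blast
    note uz = arm_uncrowd_arun[OF z v' h]
    have "arm_col (tableau_of s') \<le> c" using source_after[OF so] a' unfolding s' bump_col_simp \<alpha>' by blast
    moreover have "snd x < snd y"
      if "arm_col (tableau_of s') = c" "grows (tableau_of s') y (arm_uncrowd (tableau_of s'))" for y
    proof -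
      have "y = z" using grows_unique that(2) uz by metis
      then show ?thesis using arun_col_strict[OF r z v a] a' that(1) by simp
    qed
    ultimately show ?thesis by blast
  qed
  have lg: "has_legs (tableau_of s') = has_legs (tableau_of s)" "leg_row (tableau_of s') = leg_row (tableau_of s)"
    using has_legs_cong[OF v v'] arun_leg_sizes[OF r v] by blast+
  have g: "good (tableau_of s')" using v' good_def by blast
  show ?thesis
    unfolding T u(1)
    using u(2) g num nx lg c0 col unfolding c_def T by blast
qed

lemma good_leg_step:
  assumes "good T" "has_legs T"
  shows "\<exists>x. good (leg_uncrowd T) \<and> grows T x (leg_uncrowd T) \<and> 0 < leg_row T \<and> leg_row T < fst x \<and>
     (has_legs (leg_uncrowd T) \<longrightarrow> leg_row (leg_uncrowd T) \<le> leg_row T \<and>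
       (leg_row (leg_uncrowd T) = leg_row T \<longrightarrow>
         (\<forall>y. grows (leg_uncrowd T) y (leg_uncrowd (leg_uncrowd T)) \<longrightarrow> fst x < fst y))) \<and>
     num_legs (leg_uncrowd T) < num_legs T \<and>
     has_arms (leg_uncrowd T) = has_arms T \<and> arm_col (leg_uncrowd T) = arm_col T"
proof -
  obtain s where v: "valid True s" and T: "T = tableau_of s" using assms(1) by (auto simp: good_def)
  define c where "c = leg_row T"
  obtain a where a: "bump_col (tr s) c a" using leg_state[OF v] assms(2) T c_def by blast
  obtain x s' where r: "lrun True s x s'" using lrun_exists[OF v a] by blast
  have v': "valid True s'" using lrun_valid[OF r v] .
  have vt: "valid False (tr s)" using valid_tr[OF v] by simp
  have rt: "arun False (tr s) (prod.swap x) (tr s')" using lrun_tr[OF r] by simp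
  note u = leg_uncrowd_lrun[OF r v assms(2)[unfolded T]]
  note col = arun_col[OF rt vt a]
  obtain H \<alpha> \<Lambda> where s: "s = (H, \<alpha>, \<Lambda>)" by (cases s)
  obtain H' \<alpha>' \<Lambda>' where s': "s' = (H', \<alpha>', \<Lambda>')" by (cases s')
  have so: "source \<Lambda> c a" using a s by simp
  have \<Lambda>': "\<Lambda>' = \<Lambda>(c := \<Lambda> c - {#a#})" using col s s' by simp
  have c0: "0 < c" using arms_okD(1)[of False "tp H" \<Lambda> a c] so v s by (simp add: source_def)
  have e: "\<Lambda> j = {#}" "\<Lambda>' j = {#}" if "j \<notin> {..c}" for j using so that by (auto simp: source_def \<Lambda>')
  have num: "num_legs (tableau_of s') < num_legs (tableau_of s)"
    using num_legs_tableau_of[OF v[unfolded s], of "{..c}"] num_legs_tableau_of[OF v'[unfolded s'], of "{..c}"]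
      sum_size_after[OF so] e unfolding s s' \<Lambda>' by simp
  have nx: "leg_row (tableau_of s') \<le> c \<and> (leg_row (tableau_of s') = c \<longrightarrow>
      (\<forall>y. grows (tableau_of s') y (leg_uncrowd (tableau_of s')) \<longrightarrow> fst x < fst y))"
    if h: "has_legs (tableau_of s')"
  proof -
    obtain a' where a': "bump_col (tr s') (leg_row (tableau_of s')) a'" using leg_state[OF v' h] by blast
    obtain z t where z: "lrun True s' z t" using lrun_exists[OF v' a'] by blast
    have zt: "arun False (tr s') (prod.swap z) (tr t)" using lrun_tr[OF z] by simp
    note uz = leg_uncrowd_lrun[OF z v' h]
    have "leg_row (tableau_of s') \<le> c" using source_after[OF so] a' unfolding s' tr.simps bump_col_simp \<Lambda>' by blast
    moreover have "fst x < fst y"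
      if "leg_row (tableau_of s') = c" "grows (tableau_of s') y (leg_uncrowd (tableau_of s'))" for y
    proof -
      have "y = z" using grows_unique that(2) uz by metis
      then show ?thesis using arun_col_strict[OF rt zt vt a] a' that(1) by simp
    qed
    ultimately show ?thesis by blast
  qed
  have lg: "has_arms (tableau_of s') = has_arms (tableau_of s)" "arm_col (tableau_of s') = arm_col (tableau_of s)"
    using has_arms_cong[OF v v'] lrun_sizes[OF r v] by blast+
  have g: "good (tableau_of s')" using v' good_def by blast
  have "c < fst x" using col by simp
  then show ?thesis
    unfolding T u(1)
    using u(2) g num nx lg c0 unfolding c_def T by blast
qed

lemma uncrowd_commute:
  assumes "good T" "has_arms T" "has_legs T" "grows T x (arm_uncrowd T)" "grows T y (leg_uncrowd T)"
  shows "leg_uncrowd (arm_uncrowd T) = arm_uncrowd (leg_uncrowd T) \<and>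
    (\<exists>x' y'. meet x y x' y' \<and> grows (arm_uncrowd T) y' (leg_uncrowd (arm_uncrowd T)) \<and>
      grows (leg_uncrowd T) x' (arm_uncrowd (leg_uncrowd T)))"
proof -
  obtain s where v: "valid True s" and T: "T = tableau_of s" using assms(1) by (auto simp: good_def)
  obtain c a where a: "bump_col s c a" using bump_state[OF v] assms(2) T by blast
  obtain r l where l: "bump_col (tr s) r l" using leg_state[OF v] assms(3) T by blast
  obtain x1 s1 where r1: "arun True s x1 s1" using arun_exists[OF v a] by blast
  obtain y1 s2 where r2: "lrun True s y1 s2" using lrun_exists[OF v l] by blast
  note u1 = arm_uncrowd_arun[OF r1 v assms(2)[unfolded T]]
  note u2 = leg_uncrowd_lrun[OF r2 v assms(3)[unfolded T]]
  have xy: "x1 = x" "y1 = y" using grows_unique u1 u2 assms(4,5) T by metis+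
  obtain s3 x' y' where m: "meet x y x' y'" and r3: "lrun True s1 y' s3" "arun True s2 x' s3"
    using run_commute[OF r1 r2 v] xy by blast
  have v1: "valid True s1" and v2: "valid True s2" using arun_valid[OF r1 v] lrun_valid[OF r2 v] by auto
  have h1: "has_legs (tableau_of s1)" using has_legs_cong(1)[OF v v1] arun_leg_sizes[OF r1 v] assms(3) T by blast
  have h2: "has_arms (tableau_of s2)" using has_arms_cong(1)[OF v v2] lrun_sizes[OF r2 v] assms(2) T by blast
  note w1 = leg_uncrowd_lrun[OF r3(1) v1 h1] and w2 = arm_uncrowd_arun[OF r3(2) v2 h2]
  show ?thesis unfolding T u1(1) u2(1) w1(1) w2(1) using m w1(2) w2(2) by blast
qed

section \<open>Words and the shuffle\<close>

declare foldr_replicate [simp del]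

fun has :: "letter \<Rightarrow> hv_tableau \<Rightarrow> bool" where
  "has A T = has_arms T"
| "has L T = has_legs T"

fun idx :: "letter \<Rightarrow> hv_tableau \<Rightarrow> nat" where
  "idx A T = arm_col T"
| "idx L T = leg_row T"

fun mark :: "letter \<Rightarrow> nat \<Rightarrow> symbol" where
  "mark A = Alpha"
| "mark L = Beta"

text \<open>The coordinate of the new cell that grows strictly while the same index is recorded
  again.\<close>

fun axis :: "letter \<Rightarrow> cell \<Rightarrow> nat" where
  "axis A p = snd p"
| "axis L p = fst p"

fun extra_count :: "letter \<Rightarrow> hv_tableau \<Rightarrow> nat" where
  "extra_count A T = num_arms T"
| "extra_count L T = num_legs T"

lemma letter_step:
  assumes "good T" "has f T"
  shows "\<exists>x. good (apply_letter f T) \<and> grows T x (apply_letter f T) \<and> 0 < idx f T \<and> idx f T < axis f x \<and>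
     (has f (apply_letter f T) \<longrightarrow> idx f (apply_letter f T) \<le> idx f T \<and>
       (idx f (apply_letter f T) = idx f T \<longrightarrow>
         (\<forall>y. grows (apply_letter f T) y (apply_letter f (apply_letter f T)) \<longrightarrow> axis f x < axis f y))) \<and>
     extra_count f (apply_letter f T) < extra_count f T \<and>
     (\<forall>g. g \<noteq> f \<longrightarrow> has g (apply_letter f T) = has g T \<and> idx g (apply_letter f T) = idx g T)"
proof (cases f)
  case A
  obtain x where "good (arm_uncrowd T) \<and> grows T x (arm_uncrowd T) \<and> 0 < arm_col T \<and> arm_col T < snd x \<and>
     (has_arms (arm_uncrowd T) \<longrightarrow> arm_col (arm_uncrowd T) \<le> arm_col T \<and>
       (arm_col (arm_uncrowd T) = arm_col T \<longrightarrow>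
         (\<forall>y. grows (arm_uncrowd T) y (arm_uncrowd (arm_uncrowd T)) \<longrightarrow> snd x < snd y))) \<and>
     num_arms (arm_uncrowd T) < num_arms T \<and>
     has_legs (arm_uncrowd T) = has_legs T \<and> leg_row (arm_uncrowd T) = leg_row T"
    using good_arm_step[OF assms(1)] assms(2) unfolding A has.simps by blast
  moreover have "has g (apply_letter A T) = has g T \<and> idx g (apply_letter A T) = idx g T"
    if "g \<noteq> A" "has_legs (arm_uncrowd T) = has_legs T" "leg_row (arm_uncrowd T) = leg_row T" for g
    using that by (cases g) simp_all
  ultimately show ?thesis unfolding A apply_letter.simps axis.simps extra_count.simps has.simps(1) idx.simps(1) by blast
next
  case L
  obtain x where "good (leg_uncrowd T) \<and> grows T x (leg_uncrowd T) \<and> 0 < leg_row T \<and> leg_row T < fst x \<and>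
     (has_legs (leg_uncrowd T) \<longrightarrow> leg_row (leg_uncrowd T) \<le> leg_row T \<and>
       (leg_row (leg_uncrowd T) = leg_row T \<longrightarrow>
         (\<forall>y. grows (leg_uncrowd T) y (leg_uncrowd (leg_uncrowd T)) \<longrightarrow> fst x < fst y))) \<and>
     num_legs (leg_uncrowd T) < num_legs T \<and>
     has_arms (leg_uncrowd T) = has_arms T \<and> arm_col (leg_uncrowd T) = arm_col T"
    using good_leg_step[OF assms(1)] assms(2) unfolding L has.simps by blast
  moreover have "has g (apply_letter L T) = has g T \<and> idx g (apply_letter L T) = idx g T"
    if "g \<noteq> L" "has_arms (leg_uncrowd T) = has_arms T" "arm_col (leg_uncrowd T) = arm_col T" for g
    using that by (cases g) simp_all
  ultimately show ?thesis unfolding L apply_letter.simps axis.simps extra_count.simps has.simps(2) idx.simps(2) by blast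
qed

lemma letter_id: "\<not> has f T \<Longrightarrow> apply_letter f T = T"
  by (cases f) (simp_all add: arm_uncrowd_def leg_uncrowd_def)

lemma good_letter: "good T \<Longrightarrow> good (apply_letter f T)"
  using letter_step[of T f] letter_id[of f T] by (cases "has f T") (blast, simp)

lemma dom_letter: "good T \<Longrightarrow> dom T \<subseteq> dom (apply_letter f T)"
  using letter_step[of T f] letter_id[of f T] unfolding grows_def by (cases "has f T") (blast, simp)

lemma has_other:
  assumes "good T" "g \<noteq> f"
  shows "has g (apply_letter f T) = has g T" "idx g (apply_letter f T) = idx g T"
proof -
  have "has g (apply_letter f T) = has g T \<and> idx g (apply_letter f T) = idx g T"
    using letter_step[OF assms(1), of f] letter_id[of f T] assms(2) by (cases "has f T") (blast, simp)
  then show "has g (apply_letter f T) = has g T" "idx g (apply_letter f T) = idx g T" by blast+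
qed

section \<open>Words acting on a tableau together with its recording\<close>

definition record_step :: "letter \<Rightarrow> hv_tableau \<times> mixed \<Rightarrow> hv_tableau \<times> mixed" where
  "record_step f TQ = (case TQ of (T, Q) \<Rightarrow> (apply_letter f T,
     \<lambda>p. if p \<in> dom (apply_letter f T) - dom T then Some (mark f (idx f T)) else Q p))"

text \<open>Unlike \<open>uncrowd\<close>, a run may start from any recording tableau, so words can
  be split anywhere and inductions can follow the letters that act first.\<close>

abbreviation run :: "letter list \<Rightarrow> hv_tableau \<times> mixed \<Rightarrow> hv_tableau \<times> mixed" where
  "run w x \<equiv> foldr record_step w x"

lemma record_symbol_mark: "record_symbol f T = mark f (idx f T)"
  by (cases f) simp_all

lemma uncrowd_run: "uncrowd w T = run w (T, Map.empty)"
proof (induction w)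
  case (Cons f w)
  obtain P Q where e: "run w (T, Map.empty) = (P, Q)" by (cases "run w (T, Map.empty :: mixed)")
  show ?case using Cons unfolding foldr.simps comp_apply uncrowd.simps e record_symbol_mark record_step_def Let_def
    by simp
qed simp

lemma record_step_idle: "\<not> has f T \<Longrightarrow> record_step f (T, Q) = (T, Q)"
  by (simp add: record_step_def letter_id)

lemma record_step_grows:
  "grows T x (apply_letter f T) \<Longrightarrow> record_step f (T, Q) = (apply_letter f T, Q(x \<mapsto> mark f (idx f T)))"
  by (auto simp: record_step_def grows_def fun_eq_iff)

lemma fst_record_step: "fst (record_step f x) = apply_letter f (fst x)"
  by (simp add: record_step_def split: prod.split)

lemma run_good: "good T \<Longrightarrow> good (fst (run w (T, Q)))"
  by (induction w) (auto simp: fst_record_step good_letter)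

lemma run_dom: "good T \<Longrightarrow> dom T \<subseteq> dom (fst (run w (T, Q)))"
proof (induction w)
  case (Cons f w)
  then have "dom (fst (run w (T, Q))) \<subseteq> dom (fst (run (f # w) (T, Q)))"
    using dom_letter[OF run_good] by (simp add: fst_record_step)
  then show ?case using Cons by (meson order_trans)
qed simp

lemma record_step_outside: "q \<notin> dom (apply_letter f T) - dom T \<Longrightarrow> snd (record_step f (T, Q)) q = Q q"
  by (auto simp: record_step_def)

lemma run_old: "good T \<Longrightarrow> p \<in> dom T \<Longrightarrow> snd (run w (T, Q)) p = Q p"
proof (induction w)
  case (Cons f w)
  obtain T' Q' where e: "run w (T, Q) = (T', Q')" by (cases "run w (T, Q)")
  have "p \<in> dom T'" using run_dom[OF Cons.prems(1), of w Q] Cons.prems(2) e by auto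
  then have "snd (record_step f (T', Q')) p = Q' p" by (intro record_step_outside) simp
  then show ?case using Cons e by simp
qed simp

text \<open>Letters look at the tableau and never at the recorded symbols. So an exchange of symbols
  in old cells can be carried past the rest of a word.\<close>

lemma run_override:
  "good T \<Longrightarrow> p \<in> dom T \<Longrightarrow> run w (T, Q(p := s)) = (fst (run w (T, Q)), (snd (run w (T, Q)))(p := s))"
proof (induction w)
  case (Cons f w)
  obtain T' Q' where e: "run w (T, Q) = (T', Q')" by (cases "run w (T, Q)")
  have "p \<in> dom T'" using run_dom[OF Cons.prems(1), of w Q] Cons.prems(2) e by auto
  then have "record_step f (T', Q'(p := s)) = (fst (record_step f (T', Q')), (snd (record_step f (T', Q')))(p := s))"
    by (auto simp: record_step_def fun_eq_iff)
  moreover have "run w (T, Q(p := s)) = (T', Q'(p := s))"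
    using Cons.IH[OF Cons.prems] unfolding e by (simp only: fst_conv snd_conv)
  ultimately show ?case unfolding foldr.simps comp_apply e by (simp only:)
qed simp

lemma run_dom_Q: "good T \<Longrightarrow> dom Q \<subseteq> dom T \<Longrightarrow> dom (snd (run w (T, Q))) \<subseteq> dom (fst (run w (T, Q)))"
proof (induction w)
  case (Cons f w)
  obtain T' Q' where e: "run w (T, Q) = (T', Q')" by (cases "run w (T, Q)")
  have g: "good T'" using run_good[OF Cons.prems(1), of w Q] e by simp
  have "dom Q' \<subseteq> dom T'" using Cons e by simp
  then have "dom (snd (record_step f (T', Q'))) \<subseteq> dom (apply_letter f T')"
    using dom_letter[OF g, of f] by (fastforce simp: record_step_def dom_def split: if_splits)
  then show ?case using e by (simp add: fst_record_step)
qed simp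

lemma fst_run_replicate: "fst (run (replicate n f) (T, Q)) = (apply_letter f ^^ n) T"
  by (induction n) (simp_all add: fst_record_step)

text \<open>Peels off the letter that acts first, whereas unfolding \<open>replicate\<close> peels
  off the one that acts last.\<close>

lemma run_Suc: "run (replicate (Suc n) f) x = run (replicate n f) (record_step f x)"
proof -
  have "replicate (Suc n) f = replicate n f @ [f]" by (simp add: replicate_append_same)
  then show ?thesis by (simp only: foldr_append foldr.simps comp_apply id_apply)
qed

lemma grows_pos:
  assumes "good T" "(i, j) \<in> dom T" shows "0 < i" "0 < j"
proof -
  have "case (i, j) of (i, j) \<Rightarrow> 1 \<le> i \<and> 1 \<le> j"
    using good_young[OF assms(1)] assms(2) unfolding young_diagram_def by blast
  then show "0 < i" "0 < j" by simp_all
qed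

lemma good_down:
  assumes "good T" "(i, j) \<in> dom T" "0 < i'" "i' \<le> i" "0 < j'" "j' \<le> j"
  shows "(i', j') \<in> dom T"
  using good_young[OF assms(1)] assms(2-) unfolding young_diagram_def by (metis One_nat_def Suc_leI)

text \<open>Shapes are Young diagrams, so the cells above and to the right of a missing cell are
  missing too. This shows that a freshly added \<alpha> has no \<beta> beside it.\<close>

lemma neighbour_not_dom:
  assumes "good T" "good T'" "p \<in> dom T'" "p \<notin> dom T"
  shows "above p \<notin> dom T" "right_of p \<notin> dom T"
proof -
  obtain i j where p: "p = (i, j)" by (cases p)
  have "0 < i" "0 < j" using grows_pos assms(2,3) p by blast+
  then show "above p \<notin> dom T" "right_of p \<notin> dom T"
    using good_down[OF assms(1), of _ _ i j] assms(4) p by fastforce+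
qed

lemma run_replicate_cell:
  assumes "good T"
  shows "(q \<notin> dom (fst (run (replicate k f) (T, Q))) - dom T \<longrightarrow> snd (run (replicate k f) (T, Q)) q = Q q) \<and>
    (q \<in> dom (fst (run (replicate k f) (T, Q))) - dom T \<longrightarrow>
      (\<exists>i. snd (run (replicate k f) (T, Q)) q = Some (mark f i) \<and> 0 < i \<and> i < axis f q))"
proof (induction k)
  case (Suc k)
  obtain T' Q' where e: "run (replicate k f) (T, Q) = (T', Q')" by (cases "run (replicate k f) (T, Q)")
  have g: "good T'" and d: "dom T \<subseteq> dom T'"
    using run_good[OF assms, of "replicate k f" Q] run_dom[OF assms, of "replicate k f" Q] e by auto
  show ?case
  proof (cases "has f T'")
    case False
    then show ?thesis using Suc e by (simp add: record_step_idle)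
  next
    case True
    obtain x where x: "grows T' x (apply_letter f T')" "0 < idx f T'" "idx f T' < axis f x"
      using letter_step[OF g True] by blast
    show ?thesis using Suc e x d
      by (cases "q = x") (auto simp: record_step_grows[OF x(1)] grows_def)
  qed
qed simp

text \<open>The first conjunct drives the induction: it compares the next new cell with all recorded
  ones and is propagated by the comparison of consecutive steps. The other two are the order and
  strictness conditions in the domain of the shuffle.\<close>

lemma run_replicate_sorted:
  fixes f :: letter and Q :: mixed
  assumes "good T"
  defines "N k \<equiv> dom (fst (run (replicate k f) (T, Q))) - dom T"
    and "Qs k \<equiv> snd (run (replicate k f) (T, Q))" and "Ts k \<equiv> fst (run (replicate k f) (T, Q))"
  shows "(\<forall>p q i. has f (Ts k) \<longrightarrow> grows (Ts k) p (apply_letter f (Ts k)) \<longrightarrow> q \<in> N k \<longrightarrow> Qs k q = Some (mark f i) \<longrightarrow>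
       idx f (Ts k) \<le> i \<and> (i = idx f (Ts k) \<longrightarrow> axis f q < axis f p)) \<and>
    (\<forall>q q' i m. q \<in> N k \<longrightarrow> q' \<in> N k \<longrightarrow> Qs k q = Some (mark f i) \<longrightarrow> Qs k q' = Some (mark f m) \<longrightarrow>
       fst q \<le> fst q' \<longrightarrow> snd q \<le> snd q' \<longrightarrow> m \<le> i) \<and>
    (\<forall>q q' i. q \<in> N k \<longrightarrow> q' \<in> N k \<longrightarrow> Qs k q = Some (mark f i) \<longrightarrow> Qs k q' = Some (mark f i) \<longrightarrow>
       axis f q = axis f q' \<longrightarrow> q = q')"
proof (induction k)
  case 0
  then show ?case by (simp add: N_def)
next
  case (Suc k)
  define T' where "T' = Ts k"
  define Q' where "Q' = Qs k"
  have e: "run (replicate k f) (T, Q) = (T', Q')" by (simp add: T'_def Q'_def Ts_def Qs_def)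
  have g: "good T'" and d: "dom T \<subseteq> dom T'"
    using run_good[OF assms(1), of "replicate k f" Q] run_dom[OF assms(1), of "replicate k f" Q] e by auto
  show ?case
  proof (cases "has f T'")
    case False
    then have "run (replicate (Suc k) f) (T, Q) = run (replicate k f) (T, Q)"
      using e by (simp add: record_step_idle)
    then have "N (Suc k) = N k" "Qs (Suc k) = Qs k" "Ts (Suc k) = Ts k"
      by (simp_all only: N_def Qs_def Ts_def)
    then show ?thesis using Suc by simp
  next
    case True
    obtain x where x: "grows T' x (apply_letter f T')"
      and nx: "has f (apply_letter f T') \<longrightarrow> idx f (apply_letter f T') \<le> idx f T' \<and>
       (idx f (apply_letter f T') = idx f T' \<longrightarrow>
         (\<forall>y. grows (apply_letter f T') y (apply_letter f (apply_letter f T')) \<longrightarrow> axis f x < axis f y))"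
      using letter_step[OF g True] by blast
    have inj: "mark f i = mark f m \<longleftrightarrow> i = m" for i m by (cases f) auto
    have TS: "Ts (Suc k) = apply_letter f T'" and QS: "Qs (Suc k) = Q'(x \<mapsto> mark f (idx f T'))"
      using e by (simp_all add: Ts_def Qs_def record_step_grows[OF x])
    have NS: "N (Suc k) = insert x (N k)" and xN: "x \<notin> N k" "x \<notin> dom T'"
      using e x d by (auto simp: N_def record_step_grows[OF x] grows_def)
    have Nk: "N k \<subseteq> dom T'" using e by (auto simp: N_def)
    from Suc have B: "q \<in> N k \<Longrightarrow> Q' q = Some (mark f i) \<Longrightarrow> idx f T' \<le> i \<and> (i = idx f T' \<longrightarrow> axis f q < axis f x)"
      and C: "q \<in> N k \<Longrightarrow> q' \<in> N k \<Longrightarrow> Q' q = Some (mark f i) \<Longrightarrow> Q' q' = Some (mark f m) \<Longrightarrow>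
       fst q \<le> fst q' \<Longrightarrow> snd q \<le> snd q' \<Longrightarrow> m \<le> i"
      and D: "q \<in> N k \<Longrightarrow> q' \<in> N k \<Longrightarrow> Q' q = Some (mark f i) \<Longrightarrow> Q' q' = Some (mark f i) \<Longrightarrow>
       axis f q = axis f q' \<Longrightarrow> q = q'" for q q' i m
      using x True unfolding T'_def[symmetric] Q'_def[symmetric] by blast+
    have xpos: "0 < fst x" "0 < snd x"
      using grows_pos[OF good_letter[OF g], of "fst x" "snd x" f] x by (auto simp: grows_def)
    \<comment> \<open>A new cell is never weakly southwest of an older one, so in a comparable pair
      it can only be the northeast cell.\<close>
    have sw: "False" if "q' \<in> N k" "fst x \<le> fst q'" "snd x \<le> snd q'" for q'
      using good_down[OF g, of "fst q'" "snd q'" "fst x" "snd x"] that xpos Nk xN(2) by auto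
    show ?thesis
      unfolding TS QS NS
    proof (intro conjI allI impI)
      fix p q i
      assume h: "has f (apply_letter f T')" and p: "grows (apply_letter f T') p (apply_letter f (apply_letter f T'))"
        and q: "q \<in> insert x (N k)" and Qq: "(Q'(x \<mapsto> mark f (idx f T'))) q = Some (mark f i)"
      show "idx f (apply_letter f T') \<le> i"
        using nx h q Qq B[of q i] inj xN(1) by (cases "q = x") auto
      show "axis f q < axis f p" if i: "i = idx f (apply_letter f T')"
      proof (cases "q = x")
        case True
        then have "idx f (apply_letter f T') = idx f T'" using Qq i inj by simp
        then show ?thesis using nx h p True by blast
      next
        case False
        then have "idx f T' \<le> i \<and> (i = idx f T' \<longrightarrow> axis f q < axis f x)" using B[of q i] q Qq by auto
        then have "i = idx f T'" "axis f q < axis f x" using nx h i by auto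
        then show ?thesis using nx h p i by (metis less_trans)
      qed
    next
      fix q q' i m
      assume "q \<in> insert x (N k)" "q' \<in> insert x (N k)" "(Q'(x \<mapsto> mark f (idx f T'))) q = Some (mark f i)"
        "(Q'(x \<mapsto> mark f (idx f T'))) q' = Some (mark f m)" "fst q \<le> fst q'" "snd q \<le> snd q'"
      then show "m \<le> i" using sw[of q'] B[of q i] C[of q q' i m] inj by (cases "q = x"; cases "q' = x") auto
    next
      fix q q' i
      assume "q \<in> insert x (N k)" "q' \<in> insert x (N k)" "(Q'(x \<mapsto> mark f (idx f T'))) q = Some (mark f i)"
        "(Q'(x \<mapsto> mark f (idx f T'))) q' = Some (mark f i)" "axis f q = axis f q'"
      then show "q = q'" using B[of q i] B[of q' i] D[of q q' i] inj by (cases "q = x"; cases "q' = x") auto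
    qed
  qed
qed

lemma run_index_mono:
  assumes "good T" "run (replicate k f) (T, Q) = (T', Q')" "q \<in> dom T' - dom T" "q' \<in> dom T' - dom T"
    "Q' q = Some (mark f i)" "Q' q' = Some (mark f m)" "fst q \<le> fst q'" "snd q \<le> snd q'"
  shows "m \<le> i"
  by (rule run_replicate_sorted[OF assms(1), where f = f and Q = Q and k = k, unfolded assms(2) fst_conv snd_conv,
        THEN conjunct2, THEN conjunct1, rule_format, OF assms(3-8)])

lemma run_index_inj:
  assumes "good T" "run (replicate k f) (T, Q) = (T', Q')" "q \<in> dom T' - dom T" "q' \<in> dom T' - dom T"
    "Q' q = Some (mark f i)" "Q' q' = Some (mark f i)" "axis f q = axis f q'"
  shows "q = q'"
  by (rule run_replicate_sorted[OF assms(1), where f = f and Q = Q and k = k, unfolded assms(2) fst_conv snd_conv,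
        THEN conjunct2, THEN conjunct2, rule_format, OF assms(3-7)])

text \<open>Needed to decide which of two adjacent \<beta> the swap rule takes. From one effective
  \<open>L\<close> to the next the index does not increase, and it repeats only with a new cell in a
  strictly higher row; both facts chain along the block.\<close>

lemma run_later_beta:
  assumes "good T" "has_legs T" "grows T x (leg_uncrowd T)" "dom Q \<subseteq> dom (leg_uncrowd T)" "z \<notin> dom (leg_uncrowd T)"
    "snd (run (replicate n L) (leg_uncrowd T, Q)) z = Some (Beta k)"
  shows "k \<le> leg_row T \<and> (k = leg_row T \<longrightarrow> fst x < fst z)"
  using assms
proof (induction n arbitrary: T x Q)
  case 0
  then show ?case by auto
next
  case (Suc n)
  let ?T = "leg_uncrowd T"
  have g: "good ?T" using good_letter[OF Suc.prems(1), of L] by simp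
  have split: "run (replicate (Suc n) L) (?T, Q) = run (replicate n L) (record_step L (?T, Q))"
    by (rule run_Suc)
  show ?case
  proof (cases "has L ?T")
    case False
    then show ?thesis using Suc.IH[OF Suc.prems(1-5)] Suc.prems(6) unfolding split record_step_idle[OF False] by simp
  next
    case True
    obtain y where y: "grows ?T y (leg_uncrowd ?T)" using letter_step[OF g True] by auto
    have rs: "record_step L (?T, Q) = (leg_uncrowd ?T, Q(y \<mapsto> Beta (leg_row ?T)))"
      using record_step_grows[of ?T y L Q] y by simp
    obtain x' where x': "grows T x' ?T" "leg_row ?T \<le> leg_row T"
        "leg_row ?T = leg_row T \<Longrightarrow> \<forall>y. grows ?T y (leg_uncrowd ?T) \<longrightarrow> fst x' < fst y"
      using letter_step[OF Suc.prems(1), of L] Suc.prems(2) True by auto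
    have "x' = x" using grows_unique x'(1) Suc.prems(3) by blast
    note nx = x'(2) x'(3)[rule_format, unfolded \<open>x' = x\<close>, OF _ y]
    have gy: "good (leg_uncrowd ?T)" using good_letter[OF g, of L] by simp
    have run: "snd (run (replicate n L) (leg_uncrowd ?T, Q(y \<mapsto> Beta (leg_row ?T)))) z = Some (Beta k)"
      using Suc.prems(6) unfolding split rs .
    show ?thesis
    proof (cases "z = y")
      case zy: True
      have "y \<in> dom (leg_uncrowd ?T)" using y by (simp add: grows_def)
      from run_old[OF gy this, of "replicate n L"] run zy have "k = leg_row ?T" by simp
      then show ?thesis using nx zy by auto
    next
      case False
      have "k \<le> leg_row ?T \<and> (k = leg_row ?T \<longrightarrow> fst y < fst z)"
      proof (rule Suc.IH[OF g _ y _ _ run])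
        show "has_legs ?T" using True by simp
        show "dom (Q(y \<mapsto> Beta (leg_row ?T))) \<subseteq> dom (leg_uncrowd ?T)" using y Suc.prems(4) by (auto simp: grows_def)
        show "z \<notin> dom (leg_uncrowd ?T)" using y Suc.prems(5) False by (auto simp: grows_def)
      qed
      then show ?thesis using nx by (metis le_antisym le_trans less_trans)
    qed
  qed
qed

section \<open>One slide moves an \<open>A\<close> past a block of \<open>L\<close>\<close>

lemma slide_stop: "(\<And>i. \<not> movable Q i p) \<Longrightarrow> slide Q p = Q"
  unfolding slide_def by (subst while_unfold) simp

lemma slide_step:
  "movable Q i p \<Longrightarrow> swap_partner Q p = z \<Longrightarrow> slide Q p = slide (swap_cells Q p z) z"
  unfolding slide_def by (subst while_unfold) auto

lemma run_arms_beta: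
  assumes "good T" "snd (run (replicate m A) (T, Q)) q = Some (Beta k)"
  shows "Q q = Some (Beta k)"
  using run_replicate_cell[OF assms(1), of q m A Q] assms(2) by auto

text \<open>Induction over the \<open>L\<close>, exchanging \<open>A\<close> with the one that acts
  first. If their new cells differ, the recording does not change. If they coincide in
  \<open>p\<close>, the exchange swaps the \<alpha> in \<open>p\<close> with the \<beta> in the
  second new cell \<open>z\<close>; this is the first swap of the slide, and the induction
  hypothesis continues the slide at \<open>z\<close>.\<close>

lemma pass:
  assumes "good T" "has_arms T" "grows T p (arm_uncrowd T)" "dom Q \<subseteq> dom T"
  shows "slide (snd (run (replicate m A @ replicate n L) (record_step A (T, Q)))) p =
    snd (run (replicate m A @ A # replicate n L) (T, Q))"
  using assms
proof (induction n arbitrary: T Q p)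
  case 0
  let ?c = "arm_col T"
  have g: "good (arm_uncrowd T)" using good_letter[OF 0(1), of A] by simp
  have rs: "record_step A (T, Q) = (arm_uncrowd T, Q(p \<mapsto> Alpha ?c))"
    using record_step_grows[of T p A Q] 0 by simp
  have p: "p \<in> dom (arm_uncrowd T)" "p \<notin> dom T" using 0 by (auto simp: grows_def)
  \<comment> \<open>Every \<beta> comes from \<open>Q\<close> and so lies in the shape of
    \<open>T\<close>, which has no neighbour of the missing cell \<open>p\<close>; the slide stops
    at once.\<close>
  have "\<not> has_beta (snd (run (replicate m A) (arm_uncrowd T, Q(p \<mapsto> Alpha ?c)))) z" if "z = above p \<or> z = right_of p" for z
  proof
    assume "has_beta (snd (run (replicate m A) (arm_uncrowd T, Q(p \<mapsto> Alpha ?c)))) z"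
    then obtain k where "(Q(p \<mapsto> Alpha ?c)) z = Some (Beta k)"
      using run_arms_beta[OF g] unfolding has_beta_def by blast
    then have "z \<in> dom T" using 0(4) by (auto split: if_splits)
    then show False using neighbour_not_dom[OF 0(1) g p] that by blast
  qed
  then show ?case unfolding rs by (intro trans[OF slide_stop]) (auto simp: movable_def rs)
next
  case (Suc n)
  let ?w = "replicate m A @ replicate n L" and ?w' = "replicate m A @ A # replicate n L"
  define c where "c = arm_col T"
  define r where "r = leg_row T"
  have snoc: "replicate (Suc n) L = replicate n L @ [L]" by (simp add: replicate_append_same)
  have g: "good (arm_uncrowd T)" "good (leg_uncrowd T)"
    using good_letter[OF Suc.prems(1), of A] good_letter[OF Suc.prems(1), of L] by simp_all
  have rs: "record_step A (T, Q) = (arm_uncrowd T, Q(p \<mapsto> Alpha c))"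
    using record_step_grows[of T p A Q] Suc.prems by (simp add: c_def)
  have LHS: "run (replicate m A @ replicate (Suc n) L) x = run ?w (record_step L x)" for x
    unfolding snoc by simp
  have RHS: "run (replicate m A @ A # replicate (Suc n) L) x = run ?w' (record_step L x)" for x
    unfolding snoc by simp
  have hl: "has L (arm_uncrowd T) = has L T" "leg_row (arm_uncrowd T) = r"
    using has_other[OF Suc.prems(1), of L A] by (simp_all add: r_def)
  show ?case
  proof (cases "has L T")
    case False
    have "record_step L (T, Q) = (T, Q)" using record_step_idle[OF False] .
    moreover have "record_step L (record_step A (T, Q)) = record_step A (T, Q)"
      unfolding rs by (rule record_step_idle) (simp only: hl(1) False not_False_eq_True)
    ultimately show ?thesis unfolding LHS RHS using Suc.IH[OF Suc.prems] by simp
  next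
    case True
    obtain y where y: "grows T y (leg_uncrowd T)" using letter_step[OF Suc.prems(1) True] by auto
    have "has_legs T" using True by simp
    from uncrowd_commute[OF Suc.prems(1,2) this Suc.prems(3) y]
    obtain x' y' where P: "leg_uncrowd (arm_uncrowd T) = arm_uncrowd (leg_uncrowd T)" and m: "meet p y x' y'"
      and y': "grows (arm_uncrowd T) y' (leg_uncrowd (arm_uncrowd T))"
      and x': "grows (leg_uncrowd T) x' (arm_uncrowd (leg_uncrowd T))" by blast
    define P where "P = arm_uncrowd (leg_uncrowd T)"
    have rl: "record_step L (T, Q) = (leg_uncrowd T, Q(y \<mapsto> Beta r))"
      using record_step_grows[of T y L Q] y by (simp add: r_def)
    have ha: "has_arms (leg_uncrowd T)" "arm_col (leg_uncrowd T) = c"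
      using has_other[OF Suc.prems(1), of A L] Suc.prems(2) by (simp_all add: c_def)
    have ral: "record_step A (leg_uncrowd T, Q') = (P, Q'(x' \<mapsto> Alpha c))" for Q'
      using record_step_grows[of "leg_uncrowd T" x' A Q'] x' ha by (simp add: P_def)
    have rla: "record_step L (arm_uncrowd T, Q') = (P, Q'(y' \<mapsto> Beta r))" for Q'
      using record_step_grows[of "arm_uncrowd T" y' L Q'] y' hl P by (simp add: P_def)
    have dQ: "dom (Q(y \<mapsto> Beta r)) \<subseteq> dom (leg_uncrowd T)" using Suc.prems(4) y by (auto simp: grows_def)
    have IH: "slide (snd (run ?w (P, Q(y \<mapsto> Beta r, x' \<mapsto> Alpha c)))) x' = snd (run ?w' (leg_uncrowd T, Q(y \<mapsto> Beta r)))"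
      using Suc.IH[OF g(2) ha(1) x' dQ] unfolding ral .
    show ?thesis
    proof (cases "p = y")
      case False
      then have "x' = p" "y' = y" using m by (auto simp: meet_def)
      moreover have "Q(y \<mapsto> Beta r, p \<mapsto> Alpha c) = Q(p \<mapsto> Alpha c, y \<mapsto> Beta r)"
        using False by (rule fun_upd_twist[symmetric])
      ultimately show ?thesis unfolding LHS RHS rs rla rl using IH by simp
    next
      case py: True
      define z where "z = x'"
      have z: "z = above p \<or> z = right_of p" and y'z: "y' = z" using m py by (auto simp: meet_def z_def)
      have pz: "p \<noteq> z" using z by (cases p) auto
      have gP: "good P" using good_letter[OF g(2), of A] by (simp add: P_def)
      have p: "p \<in> dom (arm_uncrowd T)" "p \<notin> dom T" using Suc.prems(3) by (auto simp: grows_def)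
      have domP: "dom P = insert z (insert p (dom T))"
        using x' y py unfolding grows_def P_def z_def by simp
      \<comment> \<open>\<open>Q0\<close> records the two symbols for \<open>A\<close> acting before
        \<open>L\<close>; exchanging them gives the recording for the opposite order.\<close>
      define Q0 where "Q0 = Q(p \<mapsto> Alpha c, z \<mapsto> Beta r)"
      define R where "R = snd (run ?w (P, Q0))"
      have Rp: "R p = Some (Alpha c)" "R z = Some (Beta r)"
        using run_old[OF gP, of p ?w Q0] run_old[OF gP, of z ?w Q0] domP pz by (simp_all add: R_def Q0_def)
      have "Q(p \<mapsto> Beta r, z \<mapsto> Alpha c) = Q0(p := Some (Beta r), z := Some (Alpha c))"
        using pz by (auto simp: Q0_def fun_eq_iff)
      then have "snd (run ?w (P, Q(p \<mapsto> Beta r, z \<mapsto> Alpha c))) = R(p := Some (Beta r), z := Some (Alpha c))"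
        using run_override[OF gP, of z ?w "Q0(p := Some (Beta r))"] run_override[OF gP, of p ?w Q0] domP
        by (simp add: R_def)
      also have "\<dots> = swap_cells R p z" by (simp add: swap_cells_def Rp)
      finally have sw: "snd (run ?w (P, Q(p \<mapsto> Beta r, z \<mapsto> Alpha c))) = swap_cells R p z" .
      have mov: "movable R c p" using Rp z by (auto simp: movable_def has_beta_def)
      \<comment> \<open>The \<beta> in \<open>z\<close> comes from the first \<open>L\<close>, so a
        \<beta> in the other neighbour \<open>u\<close> of \<open>p\<close> was recorded by a later
        one.\<close>
      have later: "k \<le> r \<and> (k = r \<longrightarrow> fst z < fst u)" if u: "u = above p \<or> u = right_of p" "u \<noteq> z" "R u = Some (Beta k)" for u k
      proof -
        obtain Tn Qn where n: "run (replicate n L) (P, Q0) = (Tn, Qn)" by (cases "run (replicate n L) (P, Q0)")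
        have "good Tn" using run_good[OF gP, of "replicate n L" Q0] n by simp
        then have "Qn u = Some (Beta k)" using run_arms_beta[of Tn m Qn u k] u(3) n by (simp add: R_def)
        then have Qu: "snd (run (replicate n L) (leg_uncrowd (arm_uncrowd T), Q0)) u = Some (Beta k)"
          using n P by (simp add: P_def)
        have "u \<noteq> p" using u(1) by (cases p) auto
        then have "u \<notin> dom P" using domP u neighbour_not_dom[OF Suc.prems(1) g(1) p] by auto
        moreover have "dom Q0 \<subseteq> dom P" using domP Suc.prems(4) by (auto simp: Q0_def)
        moreover have "has_legs (arm_uncrowd T)" using hl True by simp
        ultimately show ?thesis
          using run_later_beta[OF g(1) _ y' _ _ Qu] hl(2) P y'z by (simp add: P_def)
      qed
      have part: "swap_partner R p = z"
      proof (cases p)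
        case ij: (Pair i j)
        from z show ?thesis
        proof
          assume z: "z = above p"
          \<comment> \<open>Here \<open>z\<close> lies in a higher row than the right neighbour,
            which excludes equal indices; the swap rule takes the cell above.\<close>
          have "k < r" if "R (right_of p) = Some (Beta k)" for k
            using later[of "right_of p" k] that z ij by (auto simp: le_less)
          then show ?thesis using Rp(2) z
            by (auto simp: swap_partner_def split: option.splits symbol.splits)
        next
          assume z: "z = right_of p"
          \<comment> \<open>Equal indices can occur here, and the swap rule breaks this tie in
            favour of the right cell.\<close>
          have "k \<le> r" if "R (above p) = Some (Beta k)" for k
            using later[of "above p" k] that z ij by auto
          then show ?thesis using Rp(2) z
            by (fastforce simp: swap_partner_def split: option.splits symbol.splits)
        qed
      qed
      have IH': "slide (snd (run ?w (P, Q(p \<mapsto> Beta r, z \<mapsto> Alpha c)))) z = snd (run ?w' (leg_uncrowd T, Q(p \<mapsto> Beta r)))"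
        using IH unfolding py z_def .
      have "slide R p = snd (run ?w' (leg_uncrowd T, Q(p \<mapsto> Beta r)))"
        using slide_step[OF mov part] IH' unfolding sw by (rule trans)
      then show ?thesis unfolding LHS RHS rs rla rl y'z py[symmetric] unfolding R_def Q0_def .
    qed
  qed
qed

text \<open>Letters \<open>A\<close> record no \<beta>, so a \<beta> next to \<open>q\<close> would
  lie in the old shape, which contains no neighbour of a missing cell.\<close>

lemma not_movable_outside:
  assumes "good T" "dom Q \<subseteq> dom T" "q \<notin> dom T"
  shows "\<not> movable (snd (run (replicate m A) (T, Q))) i q"
proof
  let ?R = "snd (run (replicate m A) (T, Q))" and ?T = "fst (run (replicate m A) (T, Q))"
  assume mv: "movable ?R i q"
  then have "q \<in> dom ?R" by (auto simp: movable_def)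
  then have q: "q \<in> dom ?T" using run_dom_Q[OF assms(1,2)] by blast
  obtain k z where "z = above q \<or> z = right_of q" "?R z = Some (Beta k)"
    using mv unfolding movable_def has_beta_def by blast
  moreover from this have "z \<in> dom T" using run_arms_beta[OF assms(1)] assms(2) by blast
  ultimately show False using neighbour_not_dom[OF assms(1) run_good[OF assms(1)] q assms(3)] by blast
qed

section \<open>The shuffle as a sequence of slides\<close>

lemma shuff_stop: "(\<And>i p. \<not> movable Q i p) \<Longrightarrow> shuff Q = Q"
  unfolding shuff_def by (subst while_unfold) simp

lemma shuff_step:
  assumes "movable Q i p"
  shows "shuff Q = shuff (slide Q (next_alpha Q))"
proof -
  have "\<exists>i p. movable Q i p" using assms by blast
  then show ?thesis unfolding shuff_def by (subst while_unfold) (simp only: if_True)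
qed

lemma next_alpha_eq:
  assumes "movable Q c p" "\<And>i q. movable Q i q \<Longrightarrow> c \<le> i \<and> (i = c \<longrightarrow> q = p \<or> snd q < snd p)"
  shows "next_alpha Q = p"
  unfolding next_alpha_def
proof (rule some_equality)
  show "\<exists>i. movable Q i p \<and> (\<forall>i' p'. movable Q i' p' \<longrightarrow> i \<le> i') \<and> (\<forall>p'. movable Q i p' \<longrightarrow> snd p' \<le> snd p)"
  proof (intro exI[of _ c] conjI allI impI)
    fix q assume "movable Q c q"
    then show "snd q \<le> snd p" using assms(2)[of c q] by auto
  qed (use assms in blast)+
next
  fix q assume "\<exists>i. movable Q i q \<and> (\<forall>i' p'. movable Q i' p' \<longrightarrow> i \<le> i') \<and> (\<forall>p'. movable Q i p' \<longrightarrow> snd p' \<le> snd q)"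
  then obtain i where i: "movable Q i q" "\<forall>i' p'. movable Q i' p' \<longrightarrow> i \<le> i'" "\<forall>p'. movable Q i p' \<longrightarrow> snd p' \<le> snd q"
    by blast
  have "i = c" using i(2) assms by (metis le_antisym i(1))
  then show "q = p" using i assms by (metis not_less)
qed

text \<open>Here \<open>m\<close> counts the letters \<open>A\<close> that have already been moved
  behind the block of \<open>L\<close>. Each induction step moves the \<open>A\<close> that acts
  directly before the \<open>L\<close>, that is, the last one of the initial block.\<close>

lemma shuff_run:
  assumes T: "good T"
  shows "shuff (snd (run (replicate m A @ replicate n L @ replicate k A) (T, Map.empty))) =
    snd (run (replicate (m + k) A @ replicate n L) (T, Map.empty))"
proof (induction k arbitrary: m)
  case 0
  obtain Tn Qn where n: "run (replicate n L) (T, Map.empty) = (Tn, Qn)" by (cases "run (replicate n L) (T, Map.empty :: mixed)")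
  have g: "good Tn" using run_good[OF T, of "replicate n L" Map.empty] n by simp
  have d: "dom Qn \<subseteq> dom Tn" using run_dom_Q[OF T, of Map.empty "replicate n L"] n by simp
  let ?R = "snd (run (replicate m A) (Tn, Qn))"
  \<comment> \<open>With no \<open>A\<close> acting before the \<open>L\<close>, the cells of
    \<open>Tn\<close> carry no \<alpha>, and those added afterwards cannot move.\<close>
  have "\<not> movable ?R i q" for i q
  proof (cases "q \<in> dom Tn")
    case True
    have "?R q = Qn q" by (rule run_old[OF g True])
    moreover have "Qn q \<noteq> Some (Alpha i)"
      using run_replicate_cell[OF T, of q n L Map.empty] n by auto
    ultimately show ?thesis by (simp add: movable_def)
  qed (rule not_movable_outside[OF g d])
  then show ?case using shuff_stop[of ?R] n by simp
next
  case (Suc k)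
  define T0 where "T0 = fst (run (replicate k A) (T, Map.empty))"
  define Q0 where "Q0 = snd (run (replicate k A) (T, Map.empty))"
  have e: "run (replicate k A) (T, Map.empty) = (T0, Q0)" by (simp add: T0_def Q0_def)
  have g: "good T0" using run_good[OF T, of "replicate k A" Map.empty] e by simp
  have d: "dom Q0 \<subseteq> dom T0" using run_dom_Q[OF T, of Map.empty "replicate k A"] e by simp
  define R where "R = snd (run (replicate m A @ replicate n L) (record_step A (T0, Q0)))"
  have LHS: "run (replicate m A @ replicate n L @ replicate (Suc k) A) (T, Map.empty) =
      run (replicate m A @ replicate n L) (record_step A (T0, Q0))"
    using e by simp
  have RHS: "run (replicate (Suc m) A @ replicate n L @ replicate k A) (T, Map.empty) =
      run (replicate m A @ A # replicate n L) (T0, Q0)"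
    by (simp only: foldr_append run_Suc e foldr.simps comp_apply)
  have IH: "shuff (snd (run (replicate m A @ A # replicate n L) (T0, Q0))) =
      snd (run (replicate (m + Suc k) A @ replicate n L) (T, Map.empty))"
    using Suc.IH[of "Suc m"] unfolding RHS by simp
  show ?case
  proof (cases "has A T0")
    case False
    \<comment> \<open>Leg uncrowding neither creates nor removes arms, so an idle \<open>A\<close>
      stays idle when it is moved behind the \<open>L\<close>.\<close>
    have "has A (fst (run (replicate n L) (T0, Q0))) = has A T0"
    proof (induction n)
      case (Suc n)
      then show ?case using has_other(1)[OF run_good[OF g], of A L] by (simp add: fst_record_step)
    qed simp
    then have "record_step A (run (replicate n L) (T0, Q0)) = run (replicate n L) (T0, Q0)"
      using False record_step_idle by (metis prod.collapse)
    then have "run (replicate m A @ A # replicate n L) (T0, Q0) = run (replicate m A @ replicate n L) (T0, Q0)"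
      by simp
    then show ?thesis using IH unfolding LHS record_step_idle[OF False] by simp
  next
    case True
    then obtain p where p: "grows T0 p (arm_uncrowd T0)" using letter_step[OF g True] by auto
    define c where "c = arm_col T0"
    have rs: "record_step A (T0, Q0) = (arm_uncrowd T0, Q0(p \<mapsto> Alpha c))"
      using record_step_grows[of T0 p A Q0] p by (simp add: c_def)
    have ga: "good (arm_uncrowd T0)" using good_letter[OF g, of A] by simp
    have da: "dom (Q0(p \<mapsto> Alpha c)) \<subseteq> dom (arm_uncrowd T0)" using d p by (auto simp: grows_def)
    have pass: "slide R p = snd (run (replicate m A @ A # replicate n L) (T0, Q0))"
      unfolding R_def by (rule pass[OF g _ p d]) (use True in simp)
    obtain Tn Qn where n: "run (replicate n L) (arm_uncrowd T0, Q0(p \<mapsto> Alpha c)) = (Tn, Qn)"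
      by (cases "run (replicate n L) (arm_uncrowd T0, Q0(p \<mapsto> Alpha c))")
    have gn: "good Tn" using run_good[OF ga, of "replicate n L" "Q0(p \<mapsto> Alpha c)"] n by simp
    have dn: "dom Qn \<subseteq> dom Tn" using run_dom_Q[OF ga da, of "replicate n L"] n by simp
    have R: "R = snd (run (replicate m A) (Tn, Qn))" unfolding R_def rs using n by simp
    \<comment> \<open>Only an \<alpha> recorded before the \<open>L\<close> can be movable. Among
      these the last one has the least index and, for that index, the rightmost cell, so it is the
      one that the shuffle selects.\<close>
    have key: "c \<le> i \<and> (i = c \<longrightarrow> q = p \<or> snd q < snd p)" if mv: "movable R i q" for i q
    proof -
      have "q \<in> dom Tn" using not_movable_outside[OF gn dn] mv R by blast
      then have "Qn q = Some (Alpha i)" using run_old[OF gn, of q "replicate m A" Qn] mv R by (simp add: movable_def)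
      then have "(Q0(p \<mapsto> Alpha c)) q = Some (Alpha i)"
        using run_replicate_cell[OF ga, of q n L "Q0(p \<mapsto> Alpha c)"] n by auto
      then consider "q = p" "i = c" | "q \<noteq> p" "Q0 q = Some (Alpha i)" by (auto split: if_splits)
      then show ?thesis
      proof cases
        case 2
        then have "q \<in> dom T0 - dom T"
          using run_replicate_cell[OF T, of q k A Map.empty] e by auto
        moreover have "idx A T0 \<le> i \<and> (i = idx A T0 \<longrightarrow> axis A q < axis A p)"
          if "has A T0" "grows T0 p (apply_letter A T0)" "q \<in> dom T0 - dom T" "Q0 q = Some (mark A i)"
          using run_replicate_sorted[OF T, where f = A and Q = Map.empty and k = k] that
          unfolding e fst_conv snd_conv by blast
        ultimately show ?thesis using True p 2(2) by (simp add: c_def)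
      qed simp
    qed
    \<comment> \<open>If the \<alpha> in \<open>p\<close> has no \<beta> beside it, its slide is the
      identity and no step of the shuffle is spent on it.\<close>
    have "shuff R = shuff (slide R p)"
    proof (cases "movable R c p")
      case True
      then show ?thesis using shuff_step[OF True] next_alpha_eq[OF True key] by simp
    next
      case False
      have "R p = Some (Alpha c)"
        using run_old[OF ga, of p "replicate m A @ replicate n L" "Q0(p \<mapsto> Alpha c)"] p
        unfolding R_def rs by (simp add: grows_def)
      then have "\<not> movable R i p" for i using False by (auto simp: movable_def)
      then show ?thesis using slide_stop[of R p] by simp
    qed
    then show ?thesis using IH unfolding LHS pass R_def[symmetric] by simp
  qed
qed

section \<open>Exhausted letters and commuting powers\<close>

lemma run_exhausted:
  assumes "good T" "extra_count f T \<le> n"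
  shows "\<not> has f (fst (run (replicate n f) (T, Q)))"
proof -
  have "has f (fst (run (replicate n f) (T, Q))) \<longrightarrow>
      extra_count f (fst (run (replicate n f) (T, Q))) + n \<le> extra_count f T" for n
  proof (induction n)
    case (Suc n)
    let ?T = "fst (run (replicate n f) (T, Q))"
    have g: "good ?T" by (rule run_good[OF assms(1)])
    show ?case
    proof (cases "has f ?T")
      case True
      then have "extra_count f (apply_letter f ?T) < extra_count f ?T" using letter_step[OF g] by blast
      then show ?thesis using Suc True by (simp add: fst_record_step)
    next
      case False
      then show ?thesis by (simp add: fst_record_step letter_id)
    qed
  qed simp
  note bound = this
  show ?thesis
  proof
    let ?U = "fst (run (replicate n f) (T, Q))"
    assume h: "has f ?U"
    have "extra_count f (apply_letter f ?U) < extra_count f ?U"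
      using letter_step[OF run_good[OF assms(1)] h] by blast
    moreover have "extra_count f ?U + n \<le> extra_count f T" using bound[of n] h by blast
    ultimately show False using assms(2) by linarith
  qed
qed

lemma run_extend:
  assumes "\<not> has f (fst (run (replicate m f) x))" "m \<le> n"
  shows "run (replicate n f) x = run (replicate m f) x"
  using assms(2)
proof (induction n rule: dec_induct)
  case (step n)
  then show ?case using assms(1) record_step_idle[of f "fst (run (replicate m f) x)" "snd (run (replicate m f) x)"] by simp
qed simp

text \<open>Further copies of an exhausted letter are idle, so the result does not depend on their
  number. This reconciles the different exponents of the two words.\<close>

lemma run_same:
  assumes "\<not> has f (fst (run (replicate m f) x))" "\<not> has f (fst (run (replicate n f) x))"
  shows "run (replicate n f) x = run (replicate m f) x"
  using run_extend[of f m x n] run_extend[of f n x m] assms by (metis nat_le_linear)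

lemma letters_commute:
  assumes "good T"
  shows "apply_letter L (apply_letter A T) = apply_letter A (apply_letter L T)"
proof (cases "has A T \<and> has L T")
  case True
  then obtain x y where "grows T x (apply_letter A T)" "grows T y (apply_letter L T)"
    using letter_step[OF assms] by meson
  then show ?thesis using uncrowd_commute[OF assms, of x y] True by simp
next
  case False
  then show ?thesis using letter_id has_other(1)[OF assms, of L A] has_other(1)[OF assms, of A L] by (metis letter.distinct(1))
qed

lemma funpow_good: "good T \<Longrightarrow> good ((apply_letter f ^^ n) T)"
  by (induction n) (auto intro: good_letter)

lemma funpow_letters_commute:
  assumes "good T"
  shows "(apply_letter L ^^ n) ((apply_letter A ^^ m) T) = (apply_letter A ^^ m) ((apply_letter L ^^ n) T)"
proof (induction n)
  case (Suc n)
  have "apply_letter L ((apply_letter A ^^ m) U) = (apply_letter A ^^ m) (apply_letter L U)" if U: "good U" for U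
  proof (induction m)
    case (Suc m)
    then show ?case
      using letters_commute[OF funpow_good[OF U, of m A]] by (simp del: apply_letter.simps)
  qed simp
  then show ?case using Suc funpow_good[OF assms, of n L] by (simp del: apply_letter.simps)
qed simp

lemma funpow_has_other: "good T \<Longrightarrow> g \<noteq> f \<Longrightarrow> has g ((apply_letter f ^^ n) T) = has g T"
  by (induction n) (auto simp: has_other(1)[OF funpow_good])

theorem theorem4p7:
  fixes T P1 P2 :: hv_tableau and Q1 Q2 :: mixed and M N M' N' :: nat
  assumes "hook_valued_tableau T"
    and "num_arms T \<le> M" and "num_legs T \<le> N"
    and "num_arms T \<le> M'" and "num_legs T \<le> N'"
    and "(P1, Q1) = uncrowd (replicate N L @ replicate M A) T"
    and "(P2, Q2) = uncrowd (replicate M' A @ replicate N' L) T"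
  shows "P2 = P1 \<and> shuff_domain (dom T) (dom P1) Q1 \<and> Q2 = shuff Q1"
proof -
  have T: "good T" using good_hook_valued assms(1) .
  obtain T1 QA where runA: "run (replicate M A) (T, Map.empty) = (T1, QA)"
    by (cases "run (replicate M A) (T, Map.empty :: mixed)")
  obtain TL QL where runL: "run (replicate N L) (T, Map.empty) = (TL, QL)"
    by (cases "run (replicate N L) (T, Map.empty :: mixed)")
  have PQ1: "run (replicate N L) (T1, QA) = (P1, Q1)" using assms(6) runA by (simp add: uncrowd_run)
  have g1: "good T1" and gL: "good TL"
    using run_good[OF T, of "replicate M A" Map.empty] run_good[OF T, of "replicate N L" Map.empty] runA runL by simp_all
  have gP: "good P1" using run_good[OF g1, of "replicate N L" QA] PQ1 by simp
  have TL: "TL = (apply_letter L ^^ N) T" and T1: "T1 = (apply_letter A ^^ M) T"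
    using arg_cong[OF runL, of fst] arg_cong[OF runA, of fst] by (simp_all add: fst_run_replicate)
  \<comment> \<open>The bound on the number of arms concerns \<open>T\<close>. It is transferred to
    \<open>TL\<close> by commuting the powers, since \<open>L\<close> does not affect whether arms
    are present.\<close>
  have fin: "\<not> has A ((apply_letter A ^^ m) TL)" if "num_arms T \<le> m" for m
  proof -
    have "\<not> has A ((apply_letter A ^^ m) T)"
      using run_exhausted[OF T, of A m Map.empty] that by (simp add: fst_run_replicate)
    moreover have "has A ((apply_letter L ^^ N) ((apply_letter A ^^ m) T)) = has A ((apply_letter A ^^ m) T)"
      by (rule funpow_has_other[OF funpow_good[OF T]]) simp
    ultimately show ?thesis unfolding TL funpow_letters_commute[OF T, symmetric] by blast
  qed
  have "\<not> has L (fst (run (replicate n L) (T, Map.empty)))" if "num_legs T \<le> n" for n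
    using run_exhausted[OF T, of L n Map.empty] that by simp
  from run_same[OF this[OF assms(3)] this[OF assms(5)]]
  have "run (replicate N' L) (T, Map.empty) = (TL, QL)" using runL by simp
  moreover have "run (replicate M' A) (TL, QL) = run (replicate M A) (TL, QL)"
  proof (rule run_same)
    show "\<not> has A (fst (run (replicate M A) (TL, QL)))" unfolding fst_run_replicate by (rule fin[OF assms(2)])
    show "\<not> has A (fst (run (replicate M' A) (TL, QL)))" unfolding fst_run_replicate by (rule fin[OF assms(4)])
  qed
  ultimately have PQ2: "(P2, Q2) = run (replicate M A @ replicate N L) (T, Map.empty)"
    using assms(7) runL by (simp add: uncrowd_run)
  have "P2 = P1"
  proof -
    have P2: "(P2, Q2) = run (replicate M A) (TL, QL)" using PQ2 runL by simp
    have "P2 = (apply_letter A ^^ M) TL"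
      using arg_cong[OF P2, of fst] by (simp add: fst_run_replicate)
    moreover have "P1 = (apply_letter L ^^ N) T1"
      using arg_cong[OF PQ1, of fst] by (simp add: fst_run_replicate)
    ultimately show ?thesis using funpow_letters_commute[OF T, of N M] by (simp only: TL T1)
  qed
  \<comment> \<open>The generalised statement at \<open>m = 0\<close>, where the whole block of
    \<open>A\<close> still has to be moved.\<close>
  moreover have "Q2 = shuff Q1"
    using shuff_run[OF T, of 0 N M] arg_cong[OF PQ2, of snd] runA PQ1 by simp
  moreover have "shuff_domain (dom T) (dom P1) Q1"
  proof -
    have d1: "dom T \<subseteq> dom T1" using run_dom[OF T, of "replicate M A" Map.empty] runA by simp
    have d2: "dom T1 \<subseteq> dom P1" using run_dom[OF g1, of "replicate N L" QA] PQ1 by simp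
    have cA: "q \<notin> dom T1 - dom T \<Longrightarrow> QA q = None"
      "q \<in> dom T1 - dom T \<Longrightarrow> \<exists>i. QA q = Some (Alpha i) \<and> 0 < i \<and> i < snd q" for q
      using run_replicate_cell[OF T, of q M A Map.empty] runA by auto
    have cL: "q \<notin> dom P1 - dom T1 \<Longrightarrow> Q1 q = QA q"
      "q \<in> dom P1 - dom T1 \<Longrightarrow> \<exists>i. Q1 q = Some (Beta i) \<and> 0 < i \<and> i < fst q" for q
      using run_replicate_cell[OF g1, of q N L QA] PQ1 by auto
    have isA: "q \<in> dom T1 - dom T \<and> QA q = Some (Alpha i) \<and> 0 < i \<and> i < snd q" if q: "Q1 q = Some (Alpha i)" for q i
    proof -
      have "q \<notin> dom P1 - dom T1"
      proof
        assume "q \<in> dom P1 - dom T1"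
        from cL(2)[OF this] show False using q by simp
      qed
      then have QA: "QA q = Some (Alpha i)" using cL(1)[of q] q by simp
      moreover have "q \<in> dom T1 - dom T" using cA(1)[of q] QA by (metis option.distinct(1))
      ultimately show ?thesis using cA(2)[of q] by simp
    qed
    have isB: "q \<in> dom P1 - dom T1 \<and> 0 < i \<and> i < fst q" if q: "Q1 q = Some (Beta i)" for q i
    proof -
      have "QA q \<noteq> Some (Beta i)" using cA(1)[of q] cA(2)[of q] by (cases "q \<in> dom T1 - dom T") auto
      then have "q \<in> dom P1 - dom T1" using cL(1)[of q] q by auto
      then show ?thesis using cL(2)[of q] q by simp
    qed
    have Aset: "{p. \<exists>k. Q1 p = Some (Alpha k)} = dom T1 - dom T"
    proof (intro set_eqI iffI)
      fix q assume q: "q \<in> dom T1 - dom T"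
      then have "Q1 q = QA q" using cL(1)[of q] by blast
      then show "q \<in> {p. \<exists>k. Q1 p = Some (Alpha k)}" using cA(2)[OF q] by auto
    next
      fix q assume "q \<in> {p. \<exists>k. Q1 p = Some (Alpha k)}"
      then obtain k where "Q1 q = Some (Alpha k)" by blast
      then show "q \<in> dom T1 - dom T" using isA[of q k] by simp
    qed
    have Bset: "{p. \<exists>k. Q1 p = Some (Beta k)} = dom P1 - dom T1"
    proof (intro set_eqI iffI)
      fix q assume q: "q \<in> dom P1 - dom T1"
      then show "q \<in> {p. \<exists>k. Q1 p = Some (Beta k)}" using cL(2)[OF q] by auto
    next
      fix q assume "q \<in> {p. \<exists>k. Q1 p = Some (Beta k)}"
      then obtain k where "Q1 q = Some (Beta k)" by blast
      then show "q \<in> dom P1 - dom T1" using isB[of q k] by simp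
    qed
    have domQ: "dom Q1 = dom P1 - dom T"
    proof -
      have "q \<in> dom Q1 \<longleftrightarrow> (\<exists>k. Q1 q = Some (Alpha k)) \<or> (\<exists>k. Q1 q = Some (Beta k))" for q
      proof (cases "Q1 q")
        case (Some x)
        then show ?thesis by (cases x) auto
      qed auto
      then have "dom Q1 = {p. \<exists>k. Q1 p = Some (Alpha k)} \<union> {p. \<exists>k. Q1 p = Some (Beta k)}" by blast
      then show ?thesis unfolding Aset Bset using d1 d2 by blast
    qed
    note yd = good_young[OF T] good_young[OF g1] good_young[OF gP]
    have "mixed_tableau (dom T) (dom P1) Q1"
      unfolding mixed_tableau_def by (intro conjI yd(1,3) order_trans[OF d1 d2] domQ)
    moreover have "flagged Q1"
    proof -
      have "0 < k \<and> k < j" if "Q1 (i, j) = Some (Alpha k)" for i j k using isA[OF that] by simp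
      moreover have "0 < k \<and> k < i" if "Q1 (i, j) = Some (Beta k)" for i j k using isB[OF that] by simp
      ultimately show ?thesis unfolding flagged_def by blast
    qed
    moreover have "alpha_column_strict Q1"
    proof -
      note C = run_index_mono[OF T runA] and D = run_index_inj[OF T runA]
      show ?thesis
        unfolding alpha_column_strict_def sw_decreasing_def
      proof (intro conjI allI impI; elim conjE)
        fix i j i' j' k m
        assume "Q1 (i, j) = Some (Alpha k)" "Q1 (i', j') = Some (Alpha m)" "i \<le> i'" "j \<le> j'"
        then show "m \<le> k" using C[of "(i, j)" "(i', j')" k m] isA[of "(i, j)" k] isA[of "(i', j')" m] by simp
      next
        fix i i' j k
        assume "Q1 (i, j) = Some (Alpha k)" "Q1 (i', j) = Some (Alpha k)"
        then show "i = i'" using D[of "(i, j)" "(i', j)" k] isA[of "(i, j)" k] isA[of "(i', j)" k] by simp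
      qed
    qed
    moreover have "beta_row_strict Q1"
    proof -
      note C = run_index_mono[OF g1 PQ1] and D = run_index_inj[OF g1 PQ1]
      show ?thesis
        unfolding beta_row_strict_def sw_decreasing_def
      proof (intro conjI allI impI; elim conjE)
        fix i j i' j' k m
        assume "Q1 (i, j) = Some (Beta k)" "Q1 (i', j') = Some (Beta m)" "i \<le> i'" "j \<le> j'"
        then show "m \<le> k" using C[of "(i, j)" "(i', j')" k m] isB[of "(i, j)" k] isB[of "(i', j')" m] by simp
      next
        fix i j j' k
        assume "Q1 (i, j) = Some (Beta k)" "Q1 (i, j') = Some (Beta k)"
        then show "j = j'" using D[of "(i, j)" "(i, j')" k] isB[of "(i, j)" k] isB[of "(i, j')" k] by simp
      qed
    qed
    \<comment> \<open>The separating partition is the shape reached after the block of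
      \<open>A\<close>.\<close>
    moreover have "alpha_beta_sorted (dom T) (dom P1) Q1"
      unfolding alpha_beta_sorted_def by (intro exI[of _ "dom T1"] conjI yd(2) d1 d2 Aset Bset)
    ultimately show ?thesis by (simp add: shuff_domain_def)
  qed
  ultimately show ?thesis by blast
qed

end
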